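(* Let $\mathcal{F}\subseteq[\mathcal{C}]^{<\omega}$ be hereditary, where $\mathcal{C}=2^\omega$ is the Cantor set. Assume that $\mathcal{F}$ has the Baire property in $[\mathcal{C}]^{<\omega}$ and satisfies $$\limsup_{n\to\infty}\frac{\log_2 d_{\mathcal{F}}(2^n)}{\log_2 n}=+\infty.$$ Then for every $k\geq1$ there exists a perfect $P\subseteq\mathcal{C}$ such that $[P]^k\subseteq\mathcal{F}$.
   Context: $\mathcal{C}=2^\omega$ is the Cantor set and $<$ is its strict lexicographical ordering. For $P\subseteq\mathcal{C}$ and $k\geq 1$, $[P]^k$ is the set of all $k$-element subsets of $P$, identified with the $<$-increasing sequences of length $k$ in $P$ (so $[\mathcal{C}]^k$ is an open subset of $\mathcal{C}^k$, hence a Polish space), and $[P]^{<\omega}=\bigcup_{k\geq1}[P]^k$. The set $[\mathcal{C}]^{<\omega}$ is the Polish space which is the topological direct sum of the spaces $[\mathcal{C}]^k$, $k\geq1$ (the empty set plays no role). A family $\mathcal{F}\subseteq[\mathcal{C}]^{<\omega}$ is hereditary if every (nonempty) subset of a member of $\mathcal{F}$ belongs to $\mathcal{F}$. For $n\geq1$, the density of $\mathcal{F}$ at $n$ is $$d_{\mathcal{F}}(n)=\min_{F\in[\mathcal{C}]^n}\max\{|G|: G\subseteq F\text{ and }G\in\mathcal{F}\},$$ with the maximum over an empty collection taken to be $0$. Perfect means nonempty, closed and without isolated points. *)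

theory Defs
  imports "HOL-Analysis.Analysis" "HOL-Library.Ramsey" "HOL-Library.Fun_Lexorder"
begin

type_synonym cantor = "nat \<Rightarrow> bool"

subsection \<open>Baire property\<close>

definition nowhere_dense_in :: "'a topology \<Rightarrow> 'a set \<Rightarrow> bool" where
  "nowhere_dense_in X N \<longleftrightarrow> N \<subseteq> topspace X \<and> X interior_of (X closure_of N) = {}"

definition meagre_in :: "'a topology \<Rightarrow> 'a set \<Rightarrow> bool" where
  "meagre_in X M \<longleftrightarrow>
     (\<exists>N :: nat \<Rightarrow> 'a set. (\<forall>n. nowhere_dense_in X (N n)) \<and> M = (\<Union>n. N n))"

definition Baire_property_in :: "'a topology \<Rightarrow> 'a set \<Rightarrow> bool" where
  "Baire_property_in X A \<longleftrightarrow>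
     A \<subseteq> topspace X \<and> (\<exists>U. openin X U \<and> meagre_in X ((A - U) \<union> (U - A)))"

subsection \<open>The space of nonempty finite subsets of the Cantor set\<close>

definition finite_subsets :: "cantor set set" where
  "finite_subsets = (\<Union>k\<in>{1..}. [UNIV]\<^bsup>k\<^esup>)"

text \<open>
  A \<open>k\<close>-element set is identified with its increasing enumeration in the strict
  lexicographical order \<^const>\<open>less_fun\<close> (with \<open>False < True\<close>). The \<open>k\<close>-th power of the
  Cantor set consists of the extensional functions on \<open>{..<k}\<close>.
\<close>

definition increasing_seqs :: "nat \<Rightarrow> (nat \<Rightarrow> cantor) set" where
  "increasing_seqs k =
     {x \<in> {..<k} \<rightarrow>\<^sub>E UNIV. \<forall>i j. i < j \<longrightarrow> j < k \<longrightarrow> less_fun (x i) (x j)}"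

text \<open>The points of the direct sum are the pairs \<open>(k, x)\<close> with \<open>k \<ge> 1\<close> and \<open>x \<in> increasing_seqs k\<close>.\<close>

definition finite_subsets_topology :: "(nat \<times> (nat \<Rightarrow> cantor)) topology" where
  "finite_subsets_topology =
     sum_topology
       (\<lambda>k. subtopology (product_topology (\<lambda>_. euclidean) {..<k}) (increasing_seqs k)) {1..}"

definition range_of_seq :: "nat \<times> (nat \<Rightarrow> cantor) \<Rightarrow> cantor set" where
  "range_of_seq = (\<lambda>(k, x). x ` {..<k})"

lemma topspace_finite_subsets_topology:
  "topspace finite_subsets_topology = Sigma {1..} increasing_seqs"
  unfolding finite_subsets_topology_def topspace_sum_topology
  by (auto simp: increasing_seqs_def)

text \<open>The identification of increasing sequences with finite sets is indeed a bijection.\<close>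

lemma bij_betw_range_of_seq:
  "bij_betw range_of_seq (topspace finite_subsets_topology) finite_subsets"
proof -
  interpret lex: linorder "\<lambda>x y :: cantor. less_fun x y \<or> x = y" less_fun
  proof
    fix x y z :: cantor
    show "less_fun x y \<longleftrightarrow> (less_fun x y \<or> x = y) \<and> \<not> (less_fun y x \<or> y = x)"
      by (auto dest: less_fun_asym simp: less_fun_irrefl)
    show "less_fun x x \<or> x = x" by simp
    show "less_fun x z \<or> x = z" if "less_fun x y \<or> x = y" "less_fun y z \<or> y = z"
      using that less_fun_trans[of x y z] by auto
    show "x = y" if "less_fun x y \<or> x = y" "less_fun y x \<or> y = x"
      using that less_fun_asym[of x y] by auto
    show "(less_fun x y \<or> x = y) \<or> less_fun y x \<or> y = x"
    proof (cases "x = y")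
      case False
      then have ex: "\<exists>n. x n \<noteq> y n" by auto
      define n where "n = (LEAST n. x n \<noteq> y n)"
      have n: "x n \<noteq> y n" unfolding n_def using ex by (rule LeastI_ex)
      have "\<forall>m<n. x m = y m" unfolding n_def using not_less_Least by blast
      then show ?thesis
        using n unfolding less_fun_def by (cases "x n") force+
    qed simp
  qed
  have sorted: "lex.sorted_list_of_set (x ` {..<k}) = map x [0..<k]" "card (x ` {..<k}) = k"
    if "x \<in> increasing_seqs k" for x k
  proof -
    have s: "sorted_wrt less_fun (map x [0..<k])"
      using that by (auto simp: sorted_wrt_iff_nth_less increasing_seqs_def)
    then have d: "distinct (map x [0..<k])"
      by (simp add: lex.strict_sorted_iff)
    have "set (map x [0..<k]) = x ` {..<k}" by auto
    then show "lex.sorted_list_of_set (x ` {..<k}) = map x [0..<k]"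
      using s lex.sorted_list_of_set.idem_if_sorted_distinct[of "map x [0..<k]"]
      by (simp add: lex.strict_sorted_iff)
    show "card (x ` {..<k}) = k"
      using distinct_card[OF d] \<open>set (map x [0..<k]) = x ` {..<k}\<close> by simp
  qed
  show ?thesis
    unfolding topspace_finite_subsets_topology bij_betw_def
  proof (intro conjI subset_antisym subsetI)
    show "inj_on range_of_seq (Sigma {1..} increasing_seqs)"
    proof (rule inj_onI, clarify)
      fix k x l y
      assume x: "x \<in> increasing_seqs k" and y: "y \<in> increasing_seqs l"
        and "range_of_seq (k, x) = range_of_seq (l, y)"
      then have eq: "x ` {..<k} = y ` {..<l}" by (simp add: range_of_seq_def)
      then have "k = l" using sorted(2)[OF x] sorted(2)[OF y] by simp
      note y' = y[folded \<open>k = l\<close>] and eq' = eq[folded \<open>k = l\<close>]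
      have "map x [0..<k] = lex.sorted_list_of_set (x ` {..<k})"
        by (rule sorted(1)[OF x, symmetric])
      also have "\<dots> = lex.sorted_list_of_set (y ` {..<k})" by (simp only: eq')
      also have "\<dots> = map y [0..<k]" by (rule sorted(1)[OF y'])
      finally have "map x [0..<k] = map y [0..<k]" .
      then have xy: "x i = y i" if "i \<in> {..<k}" for i
        using that by simp
      have "x \<in> {..<k} \<rightarrow>\<^sub>E UNIV" "y \<in> {..<k} \<rightarrow>\<^sub>E UNIV"
        using x y' by (simp_all add: increasing_seqs_def)
      then have "x = y" using xy by (rule PiE_ext)
      then show "k = l \<and> x = y" using \<open>k = l\<close> by simp
    qed
  next
    fix A assume "A \<in> range_of_seq ` Sigma {1..} increasing_seqs"
    then show "A \<in> finite_subsets"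
      using sorted(2) by (auto simp: range_of_seq_def finite_subsets_def nsets_def)
  next
    fix A assume "A \<in> finite_subsets"
    then have A: "finite A" "card A \<ge> 1" by (auto simp: finite_subsets_def nsets_def)
    define xs where "xs = lex.sorted_list_of_set A"
    define x where "x = restrict (\<lambda>i. xs ! i) {..<card A}"
    have xs: "sorted_wrt less_fun xs" "length xs = card A" "set xs = A"
      using A by (simp_all add: xs_def)
    have "x \<in> increasing_seqs (card A)"
      using xs by (auto simp: increasing_seqs_def x_def sorted_wrt_iff_nth_less)
    moreover have "range_of_seq (card A, x) = A"
      using xs by (auto simp: range_of_seq_def x_def set_conv_nth)
    ultimately show "A \<in> range_of_seq ` Sigma {1..} increasing_seqs"
      using A(2) by (intro image_eqI[of _ _ "(card A, x)"]) auto
  qed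
qed

subsection \<open>Families of finite sets\<close>

definition has_Baire_property :: "cantor set set \<Rightarrow> bool" where
  "has_Baire_property \<F> \<longleftrightarrow>
     Baire_property_in finite_subsets_topology
       {p \<in> topspace finite_subsets_topology. range_of_seq p \<in> \<F>}"

definition hereditary :: "cantor set set \<Rightarrow> bool" where
  "hereditary \<F> \<longleftrightarrow> (\<forall>A\<in>\<F>. \<forall>B. B \<subseteq> A \<and> B \<noteq> {} \<longrightarrow> B \<in> \<F>)"

text \<open>
  Inserting 0 realizes the convention that the maximum over an empty collection is 0.
\<close>

definition max_member_card :: "cantor set set \<Rightarrow> cantor set \<Rightarrow> nat" where
  "max_member_card \<F> F = Max (insert 0 {card G | G. G \<subseteq> F \<and> G \<in> \<F>})"

definition family_density :: "cantor set set \<Rightarrow> nat \<Rightarrow> nat" where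
  "family_density \<F> n = Min (max_member_card \<F> ` [UNIV]\<^bsup>n\<^esup>)"

text \<open>
  For \<open>log 2 (family_density \<F> (2 ^ n)) / log 2 n\<close>, the library values \<open>log 2 0 = 0\<close> (in place
  of minus infinity, when the density is 0) and \<open>x / 0 = 0\<close> (for \<open>n \<le> 1\<close>) do not affect
  whether the upper limit is infinite.
\<close>

text \<open>The maximum and the minimum above are over finite nonempty sets of numbers.\<close>

lemma finite_max_member_card:
  assumes "finite F"
  shows "finite (insert 0 {card G | G. G \<subseteq> F \<and> G \<in> \<F>})"
proof -
  have "{card G | G. G \<subseteq> F \<and> G \<in> \<F>} \<subseteq> card ` Pow F" by auto
  then show ?thesis using assms by (simp add: finite_subset)
qed

lemma finite_family_density:
  "finite (max_member_card \<F> ` [UNIV]\<^bsup>n\<^esup>)" "max_member_card \<F> ` [UNIV]\<^bsup>n\<^esup> \<noteq> {}"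
proof -
  have "max_member_card \<F> F \<le> n" if "F \<in> [UNIV]\<^bsup>n\<^esup>" for F
    using that finite_max_member_card[of F \<F>]
    by (auto simp: max_member_card_def nsets_def intro!: Max.boundedI card_mono)
  then show "finite (max_member_card \<F> ` [UNIV]\<^bsup>n\<^esup>)"
    by (auto intro: finite_subset[of _ "{..n}"])
  have "infinite (UNIV :: cantor set)"
    by (simp add: finite_UNIV_fun)
  then show "max_member_card \<F> ` [UNIV]\<^bsup>n\<^esup> \<noteq> {}"
    using infinite_arbitrarily_large[of "UNIV :: cantor set" n] by (auto simp: nsets_def)
qed

definition perfect :: "'a :: topological_space set \<Rightarrow> bool" where
  "perfect P \<longleftrightarrow> P \<noteq> {} \<and> closed P \<and> (\<forall>x\<in>P. \<not> x isolated_in P)"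

end

theory Submission
  imports Defs
begin

text \<open>
  By a Mycielski-type fusion along basic open sets, membership in \<open>\<F>\<close> of \<open>k\<close>-element sets becomes
  a continuous colouring on some perfect set, which is identified with the Cantor set. For such
  colourings one proves a dichotomy by induction on \<open>k\<close>: either some perfect set has only good
  \<open>k\<close>-subsets, or in some perfect set every set of branches of the first \<open>n\<close> splitting levels all of
  whose \<open>k\<close>-subsets are good has size at most a polynomial in \<open>n\<close>. The second alternative bounds
  \<open>log 2 (d (2 ^ n)) / log 2 n\<close>.

  For the induction step, a second fusion makes the colour of a \<open>k\<close>-set depend only on the
  \<open>(k - 1)\<close>-set of its nodes below the last splitting and on the node that splits; this uses a
  Halpern-Laeuchli argument, derived from an infinite Hales-Jewett theorem proved with ultrafilters.
  Call a \<open>(k - 1)\<close>-set good if all its late splittings are good. If all these sets are good in a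
  perfect set with at most one splitting node per level, then so are all \<open>k\<close>-sets. In the other case,
  among the branches of \<open>n + 1\<close> levels a set with only good \<open>k\<close>-subsets projects to such a set of
  \<open>n\<close> levels, and the nodes over which the projection is not injective form a set with only good
  \<open>(k - 1)\<close>-subsets; this gives the recursion for the bound.
\<close>

section \<open>Ultrafilters on variable words\<close>

text \<open>Counting branches of \<open>n\<close> levels makes sense after passing to a smaller
  perfect set only if that set comes with its own levels; this is why perfect sets are always
  parametrized by maps satisfying \<open>tree_emb\<close>. The obstacle in the induction step is
  that a fusion decides colours from the nodes of one fixed level, whereas two branches through a
  common node may part at any higher level, with arbitrary bits of the other branches in between.
  Uniformity over all these heights is what the partition theorem for words supplies. The recursion
  for the bound adds a term of exponent one lower at each new level, so its solution is polynomial
  in \<open>n\<close>, at most \<open>(n + 1) ^ j\<close> for sets of size \<open>j + 1\<close>.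
  Among the \<open>2 ^ n\<close> branches of \<open>n\<close> levels the logarithm of the density is
  therefore at most a constant multiple of \<open>log 2 n\<close>, which explains why the growth
  hypothesis compares exactly these two quantities.\<close>

lemma minimal_compact_set:
  fixes K :: "'a::topological_space set"
  assumes cc: "\<And>S::'a set. compact S \<Longrightarrow> closed S"
    and K: "compact K" "K \<noteq> {}" "P K"
    and Inter: "\<And>\<C>. \<C> \<noteq> {} \<Longrightarrow> (\<And>S. S \<in> \<C> \<Longrightarrow> S \<subseteq> K \<and> P S) \<Longrightarrow> P (\<Inter>\<C>)"
  obtains M where "compact M" "M \<noteq> {}" "M \<subseteq> K" "P M"
    "\<And>S. compact S \<Longrightarrow> S \<noteq> {} \<Longrightarrow> S \<subseteq> M \<Longrightarrow> P S \<Longrightarrow> S = M"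
proof -
  define \<A> where "\<A> = {S. compact S \<and> S \<noteq> {} \<and> S \<subseteq> K \<and> P S}"
  \<comment> \<open>Complements turn a minimal set into a maximal one, as Zorn's lemma wants it; the
    union of a chain is then the complement of an intersection that is nonempty by
    compactness.\<close>
  define \<B> where "\<B> = uminus ` \<A>"
  have "\<exists>M\<in>\<B>. \<forall>X\<in>\<B>. M \<subseteq> X \<longrightarrow> X = M"
  proof (rule subset_Zorn_nonempty)
    show "\<B> \<noteq> {}" using K by (auto simp: \<B>_def \<A>_def)
    fix \<C>' assume ne: "\<C>' \<noteq> {}" and chain: "subset.chain \<B> \<C>'"
    define \<C> where "\<C> = uminus ` \<C>'"
    have \<C>: "\<C> \<subseteq> \<A>" "\<C> \<noteq> {}" using chain ne by (auto simp: \<C>_def subset.chain_def \<B>_def)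
    have lin: "S \<subseteq> T \<or> T \<subseteq> S" if "S \<in> \<C>" "T \<in> \<C>" for S T
      using that chain by (auto simp: \<C>_def subset.chain_def)
    have fin: "\<exists>S\<in>\<C>. S \<subseteq> \<Inter>F" if "finite F" "F \<noteq> {}" "F \<subseteq> \<C>" for F
      using that
    proof (induction F rule: finite_ne_induct)
      case (insert S F)
      then obtain T where "T \<in> \<C>" "T \<subseteq> \<Inter>F" by auto
      then show ?case using lin[of S T] insert.prems by auto
    qed auto
    have comp: "compact S" "S \<noteq> {}" "S \<subseteq> K" "P S" if "S \<in> \<C>" for S
      using that \<C> by (auto simp: \<A>_def)
    have "K \<inter> \<Inter>\<C> \<noteq> {}"
    proof (rule compact_imp_fip[OF K(1)])
      show "closed T" if "T \<in> \<C>" for T using cc comp(1)[OF that] by blast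
      fix F assume F: "finite F" "F \<subseteq> \<C>"
      show "K \<inter> \<Inter>F \<noteq> {}"
      proof (cases "F = {}")
        case False
        then obtain S where "S \<in> \<C>" "S \<subseteq> \<Inter>F" using fin F by blast
        then show ?thesis using comp[of S] by blast
      qed (use K in auto)
    qed
    moreover have "\<Inter>\<C> \<subseteq> K" using comp \<C>(2) by blast
    moreover have "P (\<Inter>\<C>)" using Inter[of \<C>] comp \<C>(2) by blast
    moreover have "compact (\<Inter>\<C>)"
    proof -
      have "closed (\<Inter>\<C>)" using comp(1) cc by auto
      then have "compact (K \<inter> \<Inter>\<C>)" using K(1) by blast
      then show ?thesis using \<open>\<Inter>\<C> \<subseteq> K\<close> by (simp add: Int_absorb1)
    qed
    ultimately have "\<Inter>\<C> \<in> \<A>" by (auto simp: \<A>_def)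
    moreover have "\<Union>\<C>' = - \<Inter>\<C>" by (auto simp: \<C>_def)
    ultimately show "\<Union>\<C>' \<in> \<B>" by (auto simp: \<B>_def)
  qed
  then obtain M where M: "M \<in> \<A>" "\<And>X. X \<in> \<A> \<Longrightarrow> X \<subseteq> M \<Longrightarrow> X = M"
    unfolding \<B>_def by auto
  show thesis
  proof (rule that[of M])
    show "S = M" if "compact S" "S \<noteq> {}" "S \<subseteq> M" "P S" for S
      using M(2)[of S] M(1) that by (auto simp: \<A>_def)
  qed (use M(1) in \<open>auto simp: \<A>_def\<close>)
qed

text \<open>This is the Ellis-Numakura lemma. For \<open>u\<close> in a minimal compact subsemigroup
  \<open>M\<close>, the products \<open>x \<cdot> u\<close> form a compact subsemigroup, hence all
  of \<open>M\<close>, so \<open>v \<cdot> u = u\<close> for some \<open>v\<close>. The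
  \<open>x\<close> in \<open>M\<close> with \<open>x \<cdot> u = u\<close> are then a nonempty
  compact subsemigroup, again all of \<open>M\<close>, and \<open>u\<close> is among them.\<close>

lemma compact_right_semigroup_idempotent:
  fixes mult :: "'a::topological_space \<Rightarrow> 'a \<Rightarrow> 'a" (infixl "\<cdot>" 70)
  assumes cc: "\<And>S::'a set. compact S \<Longrightarrow> closed S"
    and assoc: "\<And>x y z. (x \<cdot> y) \<cdot> z = x \<cdot> (y \<cdot> z)"
    and cont: "\<And>y. continuous_on UNIV (\<lambda>x. x \<cdot> y)"
    and K: "compact K" "K \<noteq> {}" "\<And>x y. x \<in> K \<Longrightarrow> y \<in> K \<Longrightarrow> x \<cdot> y \<in> K"
  shows "\<exists>e\<in>K. e \<cdot> e = e"
proof -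
  define P where "P S \<longleftrightarrow> (\<forall>x\<in>S. \<forall>y\<in>S. x \<cdot> y \<in> S)" for S
  obtain M where M: "compact M" "M \<noteq> {}" "M \<subseteq> K" "P M"
    "\<And>S. compact S \<Longrightarrow> S \<noteq> {} \<Longrightarrow> S \<subseteq> M \<Longrightarrow> P S \<Longrightarrow> S = M"
    by (rule minimal_compact_set[OF cc K(1,2), of P]) (use K(3) in \<open>auto simp: P_def\<close>)
  obtain u where u: "u \<in> M" using M by auto
  have "(\<lambda>x. x \<cdot> u) ` M = M"
  proof (rule M(5))
    show "compact ((\<lambda>x. x \<cdot> u) ` M)"
      using M(1) cont continuous_on_subset by (blast intro: compact_continuous_image)
    show "(\<lambda>x. x \<cdot> u) ` M \<subseteq> M" using M(4) u by (auto simp: P_def)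
    show "P ((\<lambda>x. x \<cdot> u) ` M)"
      unfolding P_def
    proof safe
      fix x y assume "x \<in> M" "y \<in> M"
      then have "x \<cdot> u \<cdot> y \<in> M" using M(4) u by (auto simp: P_def)
      then show "x \<cdot> u \<cdot> (y \<cdot> u) \<in> (\<lambda>x. x \<cdot> u) ` M" by (metis assoc image_eqI)
    qed
  qed (use M in auto)
  then obtain v where v: "v \<in> M" "v \<cdot> u = u" using u by (metis imageE)
  have "{x \<in> M. x \<cdot> u = u} = M"
  proof (rule M(5))
    have "closed ((\<lambda>x. x \<cdot> u) -` {u})"
      using cc[of "{u}"] cont[of u] continuous_closed_vimage[of "{u}"]
      by (metis closed_vimage compact_sing)
    then have "compact (M \<inter> (\<lambda>x. x \<cdot> u) -` {u})" using M(1) by blast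
    then show "compact {x \<in> M. x \<cdot> u = u}" by (simp add: Int_def vimage_def)
    show "P {x \<in> M. x \<cdot> u = u}" using M(4) by (auto simp: P_def assoc)
  qed (use v in auto)
  then show ?thesis using u M(3) by auto
qed

section \<open>Set functions as a compact Hausdorff space, and the ultrafilters in it\<close>

lemma compact_imp_closed_set_functions:
  fixes S :: "('a \<Rightarrow> bool) set"
  assumes "compact S" shows "closed S"
proof -
  have "Hausdorff_space (euclidean :: ('a \<Rightarrow> bool) topology)"
    unfolding euclidean_product_topology[symmetric]
    unfolding Hausdorff_space_product_topology
    by (intro disjI2 ballI) (use hausdorff[where 'a=bool] in \<open>auto simp: Hausdorff_space_def disjnt_def\<close>)
  then show ?thesis
    using assms compactin_imp_closedin[of euclidean S] by simp
qed

lemma compact_UNIV_set_functions: "compact (UNIV :: ('a \<Rightarrow> bool) set)"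
proof -
  have b: "compact_space (euclidean :: bool topology)"
    by (simp add: compact_space_def finite_imp_compact)
  have "compact_space (product_topology (\<lambda>_::'a. euclidean :: bool topology) UNIV)"
    unfolding compact_space_product_topology using b by auto
  then have "compact_space (euclidean :: ('a \<Rightarrow> bool) topology)"
    by (simp only: euclidean_product_topology)
  then show ?thesis by (simp add: compact_space_def)
qed

lemma continuous_on_eval: "continuous_on UNIV (\<lambda>x :: 'a \<Rightarrow> bool. x B)"
  using continuous_on_product_then_coordinatewise[OF continuous_on_id, of UNIV B] by simp

lemma closed_eval: "closed {x :: 'a \<Rightarrow> bool. x B}" "closed {x :: 'a \<Rightarrow> bool. \<not> x B}"
proof -
  have "closed ((\<lambda>x :: 'a \<Rightarrow> bool. x B) -` T)" if "closed T" for T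
    using that by (rule closed_vimage[OF _ continuous_on_eval])
  then have "closed ((\<lambda>x :: 'a \<Rightarrow> bool. x B) -` {True})" "closed ((\<lambda>x :: 'a \<Rightarrow> bool. x B) -` {False})"
    by blast+
  then show "closed {x :: 'a \<Rightarrow> bool. x B}" "closed {x :: 'a \<Rightarrow> bool. \<not> x B}"
    by (simp_all add: vimage_def)
qed

text \<open>Ultrafilters are encoded by their characteristic functions on sets; the extension of
  concatenation to them then makes sense, is associative and right-continuous for arbitrary
  set functions.\<close>

definition uconv :: "('a list set \<Rightarrow> bool) \<Rightarrow> ('a list set \<Rightarrow> bool) \<Rightarrow> 'a list set \<Rightarrow> bool"
  where "uconv x y B = x {s. y {t. s @ t \<in> B}}"

text \<open>Preserving complements and intersections makes \<open>x\<close> a Boolean homomorphism.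
  Each condition concerns finitely many values of \<open>x\<close>, so the ultrafilters containing
  \<open>S\<close> form a closed set.\<close>

definition ultra_on :: "'a set \<Rightarrow> ('a set \<Rightarrow> bool) \<Rightarrow> bool" where
  "ultra_on S x \<longleftrightarrow> x S \<and> (\<forall>B. x (- B) = (\<not> x B)) \<and> (\<forall>B C. x (B \<inter> C) \<longleftrightarrow> x B \<and> x C)"

lemma uconv_assoc: "uconv (uconv x y) z = uconv x (uconv y z)"
  by (rule ext) (simp add: uconv_def)

lemma continuous_on_uconv: "continuous_on UNIV (\<lambda>x. uconv x y)"
  by (rule continuous_on_coordinatewise_then_product) (simp add: uconv_def continuous_on_eval)

lemma ultra_on_mono: "ultra_on S x \<Longrightarrow> x B \<Longrightarrow> B \<subseteq> C \<Longrightarrow> x C"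
  unfolding ultra_on_def by (metis Int_absorb2)

lemma ultra_on_INT:
  assumes "ultra_on S x" "finite J" "\<And>a. a \<in> J \<Longrightarrow> x (F a)"
  shows "x (\<Inter>a\<in>J. F a)"
  using assms(2,3)
proof (induction J)
  case empty
  then show ?case using assms(1) ultra_on_mono[OF assms(1)] by (auto simp: ultra_on_def)
next
  case (insert a J)
  then show ?case using assms(1) by (simp add: ultra_on_def)
qed

text \<open>If every colour class had a large complement, the intersection of finitely many such
  complements would be large, yet it misses \<open>B\<close>.\<close>

lemma ultra_on_colour:
  assumes "ultra_on S x" "x B" "finite (col ` B)"
  shows "\<exists>c. x {b \<in> B. col b = c}"
proof (rule ccontr)
  assume "\<not> ?thesis"
  then have "x (- {b \<in> B. col b = c})" for c using assms(1) by (auto simp: ultra_on_def)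
  then have "x (\<Inter>c\<in>col ` B. - {b \<in> B. col b = c})"
    using ultra_on_INT[OF assms(1,3), of "\<lambda>c. - {b \<in> B. col b = c}"] by auto
  then have "x (- B)" by (rule ultra_on_mono[OF assms(1)]) auto
  then show False using assms by (auto simp: ultra_on_def)
qed

lemma compact_ultra_on: "compact {x. ultra_on S x}"
proof -
  have "{x. ultra_on S x} = {x. x S} \<inter>
      (\<Inter>B. ({x. x (- B)} \<inter> {x. \<not> x B}) \<union> ({x. \<not> x (- B)} \<inter> {x. x B})) \<inter>
      (\<Inter>B. \<Inter>C. ({x. x (B \<inter> C)} \<inter> {x. x B} \<inter> {x. x C}) \<union>
        ({x. \<not> x (B \<inter> C)} \<inter> ({x. \<not> x B} \<union> {x. \<not> x C})))"
    unfolding ultra_on_def by (auto 0 3)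
  moreover have "closed \<dots>"
    by (intro closed_Int closed_INT closed_Un closed_eval ballI)
  ultimately show ?thesis
    using compact_Int_closed[OF compact_UNIV_set_functions] by simp
qed

lemma ultra_on_principal: "s \<in> S \<Longrightarrow> ultra_on S (\<lambda>B. s \<in> B)"
  by (auto simp: ultra_on_def)

lemma ultra_on_uconv:
  assumes x: "ultra_on S x" and y: "ultra_on T y"
    and ST: "\<And>s t. s \<in> S \<Longrightarrow> t \<in> T \<Longrightarrow> s @ t \<in> U"
  shows "ultra_on U (uconv x y)"
proof -
  have "y {t. s @ t \<in> U}" if "s \<in> S" for s
  proof (rule ultra_on_mono[OF y])
    show "y T" using y by (simp add: ultra_on_def)
  qed (use ST that in auto)
  then have "x {s. y {t. s @ t \<in> U}}"
    using x by (auto intro!: ultra_on_mono[OF x, of S, rotated] simp: ultra_on_def)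
  moreover have "y {t. s @ t \<in> - B} = (\<not> y {t. s @ t \<in> B})" for s B
  proof -
    have "{t. s @ t \<in> - B} = - {t. s @ t \<in> B}" by auto
    then show ?thesis using y by (simp add: ultra_on_def)
  qed
  moreover have "x {s. \<not> y {t. s @ t \<in> B}} = (\<not> x {s. y {t. s @ t \<in> B}})" for B
  proof -
    have "{s. \<not> y {t. s @ t \<in> B}} = - {s. y {t. s @ t \<in> B}}" by auto
    then show ?thesis using x by (simp add: ultra_on_def)
  qed
  moreover have "y {t. s @ t \<in> B \<inter> C} = (y {t. s @ t \<in> B} \<and> y {t. s @ t \<in> C})" for s B C
  proof -
    have "{t. s @ t \<in> B \<inter> C} = {t. s @ t \<in> B} \<inter> {t. s @ t \<in> C}" by auto
    then show ?thesis using y by (simp add: ultra_on_def)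
  qed
  moreover have "x {s. y {t. s @ t \<in> B} \<and> y {t. s @ t \<in> C}} = (x {s. y {t. s @ t \<in> B}} \<and> x {s. y {t. s @ t \<in> C}})" for B C
  proof -
    have "{s. y {t. s @ t \<in> B} \<and> y {t. s @ t \<in> C}} = {s. y {t. s @ t \<in> B}} \<inter> {s. y {t. s @ t \<in> C}}" by auto
    then show ?thesis using x by (simp add: ultra_on_def)
  qed
  ultimately show ?thesis by (simp add: ultra_on_def uconv_def)
qed

text \<open>The variable is encoded by \<^const>\<open>None\<close>.\<close>

definition variable_words :: "'a set \<Rightarrow> 'a option list set" where
  "variable_words A = {w \<in> lists (insert None (Some ` A)). None \<in> set w}"

definition subst_var :: "'a \<Rightarrow> 'a option list \<Rightarrow> 'a option list" where
  "subst_var a = map (\<lambda>b. case b of None \<Rightarrow> Some a | Some b \<Rightarrow> Some b)"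

lemma subst_var_append: "subst_var a (s @ t) = subst_var a s @ subst_var a t"
  by (simp add: subst_var_def)

lemma subst_var_in: "a \<in> A \<Longrightarrow> w \<in> lists (insert None (Some ` A)) \<Longrightarrow> subst_var a w \<in> lists (Some ` A)"
  by (force simp: subst_var_def split: option.splits)

lemma subst_var_constant: "w \<in> lists (Some ` A) \<Longrightarrow> subst_var a w = w"
  unfolding subst_var_def by (induction w) auto

lemma uconv_vimage_subst_var:
  "uconv x y (subst_var a -` B) = uconv (\<lambda>B. x (subst_var a -` B)) (\<lambda>B. y (subst_var a -` B)) B"
  by (simp add: uconv_def vimage_def subst_var_append)

text \<open>The ultrafilter \<open>w\<close> is an idempotent below a minimal idempotent \<open>u\<close> of the constant words: then
  substituting a letter into \<open>w\<close> gives an idempotent below \<open>u\<close>, hence \<open>u\<close> itself.\<close>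

lemma variable_word_ultrafilter:
  assumes "A \<noteq> {}"
  obtains w where "ultra_on (variable_words A) w"
    "\<And>a. a \<in> A \<Longrightarrow> uconv (\<lambda>B. w (subst_var a -` B)) w = w"
proof -
  let ?S = "lists (insert None (Some ` A))" and ?R = "lists (Some ` A)" and ?L = "variable_words A"
  define R where "R = {x. ultra_on ?R x}"
  define L where "L = {x. ultra_on ?L x}"
  note cc = compact_imp_closed_set_functions
  have RR: "uconv x y \<in> R" if "x \<in> R" "y \<in> R" for x y
    using that unfolding R_def mem_Collect_eq
    by (rule ultra_on_uconv) auto
  have LR: "uconv x y \<in> L" if "x \<in> L" "y \<in> R" for x y
    using that unfolding R_def L_def mem_Collect_eq
    by (rule ultra_on_uconv) (auto simp: variable_words_def)
  have RL: "uconv x y \<in> L" if "x \<in> R" "y \<in> L" for x y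
    using that unfolding R_def L_def mem_Collect_eq
    by (rule ultra_on_uconv) (auto simp: variable_words_def)
  have LL: "uconv x y \<in> L" if "x \<in> L" "y \<in> L" for x y
    using that unfolding R_def L_def mem_Collect_eq
    by (rule ultra_on_uconv) (auto simp: variable_words_def)
  have cR: "compact R" "R \<noteq> {}" and cL: "compact L" "L \<noteq> {}"
  proof -
    show "R \<noteq> {}" using ultra_on_principal[of "[]" ?R] by (auto simp: R_def)
    show "L \<noteq> {}" using ultra_on_principal[of "[None]" ?L] by (auto simp: L_def variable_words_def)
  qed (simp_all add: R_def L_def compact_ultra_on)
  have image: "compact ((\<lambda>x. uconv x u) ` K)" if "compact K" for u and K :: "('a option list set \<Rightarrow> bool) set"
    using that continuous_on_uconv continuous_on_subset by (blast intro: compact_continuous_image)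
  \<comment> \<open>\<open>P\<close> describes the left ideals of \<open>R\<close>. An idempotent in
    a minimal compact left ideal serves as the minimal idempotent.\<close>
  define P where "P I \<longleftrightarrow> (\<forall>x\<in>R. \<forall>y\<in>I. uconv x y \<in> I)" for I
  obtain I where I: "compact I" "I \<noteq> {}" "I \<subseteq> R" "P I"
    "\<And>S. compact S \<Longrightarrow> S \<noteq> {} \<Longrightarrow> S \<subseteq> I \<Longrightarrow> P S \<Longrightarrow> S = I"
    by (rule minimal_compact_set[OF cc cR, of P]) (use RR in \<open>auto simp: P_def\<close>)
  obtain u where u: "u \<in> I" "uconv u u = u"
    using compact_right_semigroup_idempotent[OF cc uconv_assoc continuous_on_uconv I(1,2)] I(3,4)
    unfolding P_def by blast
  have uR: "u \<in> R" using u I by auto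
  \<comment> \<open>The left ideal generated by \<open>q\<close> is compact and contained in
    \<open>I\<close>, hence equal to \<open>I\<close>, and so it contains \<open>u\<close>.\<close>
  have min: "\<exists>z\<in>R. uconv z q = u" if "q \<in> I" for q
  proof -
    have "(\<lambda>x. uconv x q) ` R = I"
    proof (rule I(5))
      show "P ((\<lambda>x. uconv x q) ` R)"
        unfolding P_def
      proof safe
        fix x y assume "x \<in> R" "y \<in> R"
        then show "uconv x (uconv y q) \<in> (\<lambda>x. uconv x q) ` R"
          by (metis uconv_assoc RR image_eqI)
      qed
    qed (use that I(4) cR image in \<open>auto simp: P_def\<close>)
    then show ?thesis using u(1) by (metis imageE)
  qed
  \<comment> \<open>The right multiples by \<open>u\<close> of the ultrafilters in \<open>L\<close>
    form a compact semigroup, and an idempotent \<open>e\<close> there absorbs \<open>u\<close> on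
    the right. Multiplying \<open>e\<close> by \<open>u\<close> on the left gives an idempotent that
    absorbs \<open>u\<close> on both sides.\<close>
  have "\<exists>e\<in>(\<lambda>x. uconv x u) ` L. uconv e e = e"
  proof (rule compact_right_semigroup_idempotent[OF cc uconv_assoc continuous_on_uconv])
    fix x y assume "x \<in> (\<lambda>x. uconv x u) ` L" "y \<in> (\<lambda>x. uconv x u) ` L"
    then obtain x' y' where "x' \<in> L" "y' \<in> L" and xy: "x = uconv x' u" "y = uconv y' u" by auto
    then have "uconv (uconv x' u) y' \<in> L" using LL LR uR by blast
    moreover have "uconv x y = uconv (uconv (uconv x' u) y') u" by (simp add: xy uconv_assoc)
    ultimately show "uconv x y \<in> (\<lambda>x. uconv x u) ` L" by blast
  qed (use cL image in auto)
  then obtain f where f: "f \<in> L" "uconv (uconv f u) (uconv f u) = uconv f u" by (metis imageE)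
  define e where "e = uconv f u"
  have e: "e \<in> L" "uconv e e = e" "uconv e u = e"
    using f LR uR u(2) by (auto simp: e_def uconv_assoc)
  define w where "w = uconv u e"
  have uw: "uconv u w = w" unfolding w_def by (simp add: uconv_assoc[symmetric] u)
  have wu: "uconv w u = w" unfolding w_def by (simp add: uconv_assoc e)
  have ww: "uconv w w = w"
  proof -
    have "uconv w w = uconv (uconv w u) e" by (simp add: w_def uconv_assoc)
    also have "\<dots> = uconv u (uconv e e)" by (simp only: wu) (simp add: w_def uconv_assoc)
    finally show ?thesis by (simp add: e w_def)
  qed
  show thesis
  proof (rule that)
    show "ultra_on ?L w" using RL[OF uR e(1)] by (simp add: w_def L_def)
    fix a assume a: "a \<in> A"
    \<comment> \<open>\<open>\<sigma>\<close> pushes an ultrafilter forward along the substitution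
      of \<open>a\<close>. It respects \<open>uconv\<close> and fixes \<open>u\<close>, since
      \<open>u\<close> lives on constant words, which the substitution leaves alone.\<close>
    define \<sigma> where "\<sigma> x = (\<lambda>B. x (subst_var a -` B))" for x :: "'a option list set \<Rightarrow> bool"
    have hom: "\<sigma> (uconv x y) = uconv (\<sigma> x) (\<sigma> y)" for x y
      by (rule ext) (simp add: \<sigma>_def uconv_vimage_subst_var)
    have \<sigma>u: "\<sigma> u = u"
    proof (rule ext)
      fix B
      have ur: "ultra_on ?R u" using uR by (simp add: R_def)
      have r: "u B' \<longleftrightarrow> u (B' \<inter> ?R)" for B' using ur by (simp add: ultra_on_def)
      have "subst_var a -` B \<inter> ?R = B \<inter> ?R" using subst_var_constant by fastforce
      then show "\<sigma> u B = u B" unfolding \<sigma>_def using r by metis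
    qed
    define q where "q = \<sigma> w"
    have "ultra_on ?L w" by fact
    then have "ultra_on ?R q"
    proof -
      assume w: "ultra_on ?L w"
      have "w (subst_var a -` ?R)"
        by (rule ultra_on_mono[OF w, of ?L])
          (use w subst_var_in[OF a] in \<open>auto simp: ultra_on_def variable_words_def simp del: in_lists_conv_set\<close>)
      then show ?thesis using w by (simp add: ultra_on_def q_def \<sigma>_def vimage_Compl)
    qed
    then have qR: "q \<in> R" by (simp add: R_def)
    have qu: "uconv q u = q" "uconv u q = q" "uconv q q = q"
      unfolding q_def using hom[of w u] hom[of u w] hom[of w w] wu uw ww \<sigma>u by simp_all
    \<comment> \<open>Writing products for \<open>uconv\<close>: \<open>q = q u\<close> lies in the
      left ideal \<open>I\<close>, so \<open>z q = u\<close> for some \<open>z\<close>. With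
      \<open>q q = q\<close> this gives \<open>u q = z q q = z q = u\<close>, whereas
      \<open>u q = q\<close>.\<close>
    then have "q \<in> I" using I(4) qR u(1) unfolding P_def by metis
    then obtain z where "z \<in> R" "uconv z q = u" using min by blast
    then have "uconv u q = u" using qu(3) uconv_assoc[of z q q] by simp
    then have "q = u" using qu(2) by simp
    then show "uconv (\<lambda>B. w (subst_var a -` B)) w = w"
      using uw by (simp add: q_def \<sigma>_def)
  qed
qed

text \<open>This is the infinite form of the Hales-Jewett theorem due to Carlson and to Furstenberg and
  Katznelson, for the chains only.\<close>

lemma variable_word_chain:
  fixes col :: "'a option list \<Rightarrow> 'c"
  assumes "finite A" "A \<noteq> {}" "finite (col ` variable_words A)"
  obtains W c where "\<And>n. W n \<in> variable_words A"
    "\<And>a n. (\<And>m. a m \<in> A) \<Longrightarrow> col (concat (map (\<lambda>m. subst_var (a m) (W m)) [0..<n]) @ W n) = c"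
proof -
  obtain w where w: "ultra_on (variable_words A) w"
    and inv: "\<And>a. a \<in> A \<Longrightarrow> uconv (\<lambda>B. w (subst_var a -` B)) w = w"
    using variable_word_ultrafilter[OF assms(2)] by blast
  have wL: "w (variable_words A)" using w by (simp add: ultra_on_def)
  obtain c where c: "w {b \<in> variable_words A. col b = c}"
    using ultra_on_colour[OF w wL assms(3)] by blast
  \<comment> \<open>\<open>nxt B s\<close> collects the continuations that stay in \<open>B\<close>
    whichever letter is substituted into \<open>s\<close>. The invariance of \<open>w\<close> says,
    for one letter, that a large \<open>B\<close> leaves a large set of continuations for
    \<open>w\<close>-many \<open>s\<close>; finiteness of \<open>A\<close> allows all letters at
    once.\<close>
  define nxt where "nxt B s = (\<Inter>a\<in>A. {t. subst_var a s @ t \<in> B})" for B s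
  have step: "\<exists>s\<in>B \<inter> variable_words A. w (nxt B s)" if B: "w B" for B
  proof -
    have "w {s. w {t. subst_var a s @ t \<in> B}}" if "a \<in> A" for a
    proof -
      have "uconv (\<lambda>B. w (subst_var a -` B)) w B" using inv[OF that] B by simp
      then show ?thesis by (simp add: uconv_def vimage_def)
    qed
    then have "w (\<Inter>a\<in>A. {s. w {t. subst_var a s @ t \<in> B}})"
      by (rule ultra_on_INT[OF w assms(1)])
    then have "w (B \<inter> variable_words A \<inter> (\<Inter>a\<in>A. {s. w {t. subst_var a s @ t \<in> B}}))"
      using w B wL unfolding ultra_on_def by metis
    moreover have "\<not> w {}" 
    proof -
      have "w (B \<inter> - B) = (w B \<and> w (- B))" "w (- B) = (\<not> w B)" using w by (simp_all only: ultra_on_def)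
      then show ?thesis by simp
    qed
    ultimately have "B \<inter> variable_words A \<inter> (\<Inter>a\<in>A. {s. w {t. subst_var a s @ t \<in> B}}) \<noteq> {}"
      by force
    then obtain s where s: "s \<in> B \<inter> variable_words A" "\<And>a. a \<in> A \<Longrightarrow> w {t. subst_var a s @ t \<in> B}"
      by blast
    then have "w (nxt B s)" unfolding nxt_def by (intro ultra_on_INT[OF w assms(1)])
    then show ?thesis using s by blast
  qed
  define pick where "pick B = (SOME s. s \<in> B \<inter> variable_words A \<and> w (nxt B s))" for B
  have pick: "pick B \<in> B \<inter> variable_words A \<and> w (nxt B (pick B))" if "w B" for B
    unfolding pick_def by (rule someI_ex) (use step[OF that] in blast)
  define Bs where "Bs = rec_nat {b \<in> variable_words A. col b = c} (\<lambda>_ B. nxt B (pick B))"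
  have Bs: "Bs 0 = {b \<in> variable_words A. col b = c}" "Bs (Suc n) = nxt (Bs n) (pick (Bs n))" for n
    by (simp_all add: Bs_def)
  have wB: "w (Bs n)" for n by (induction n) (use c pick Bs in auto)
  define W where "W n = pick (Bs n)" for n
  have WB: "W n \<in> Bs n" "W n \<in> variable_words A" for n using pick[OF wB] by (auto simp: W_def)
  show thesis
  proof (rule that[of W c])
    fix a :: "nat \<Rightarrow> 'a" and n assume a: "\<And>m. a m \<in> A"
    \<comment> \<open>The tail \<open>t\<close> has to vary: absorbing the last block turns a tail
      in \<open>Bs (Suc n)\<close> into a longer tail in \<open>Bs n\<close>.\<close>
    have "concat (map (\<lambda>m. subst_var (a m) (W m)) [0..<n]) @ t \<in> Bs 0" if "t \<in> Bs n" for t n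
      using that
    proof (induction n arbitrary: t)
      case (Suc n)
      then have "subst_var (a n) (W n) @ t \<in> Bs n" using a by (auto simp: Bs nxt_def W_def)
      then show ?case using Suc.IH by simp
    qed simp
    then show "col (concat (map (\<lambda>m. subst_var (a m) (W m)) [0..<n]) @ W n) = c"
      using WB(1) Bs(1) by blast
  qed (rule WB(2))
qed

section \<open>Perfect sets as images of tree embeddings\<close>

definition stem :: "nat \<Rightarrow> cantor \<Rightarrow> bool list" where
  "stem n x = map x [0..<n]"

definition cyl :: "bool list \<Rightarrow> cantor set" where
  "cyl t = {x. stem (length t) x = t}"

definition prepend :: "bool list \<Rightarrow> cantor \<Rightarrow> cantor" where
  "prepend t x = (\<lambda>j. if j < length t then t ! j else x (j - length t))"

lemma stem_eq_iff: "stem n x = stem n y \<longleftrightarrow> (\<forall>i<n. x i = y i)"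
  by (auto simp: stem_def)

lemma length_stem [simp]: "length (stem n x) = n"
  by (simp add: stem_def)

lemma stem_0 [simp]: "stem 0 x = []"
  by (simp add: stem_def)

lemma stem_Suc: "stem (Suc n) x = stem n x @ [x n]"
  by (simp add: stem_def)

lemma stem_eq_mono: "stem n x = stem n y \<Longrightarrow> m \<le> n \<Longrightarrow> stem m x = stem m y"
  by (auto simp: stem_eq_iff)

lemma eq_if_stems_eq:
  assumes "\<And>n. stem n x = stem n y" shows "x = y"
proof
  fix i show "x i = y i" using assms[of "Suc i"] by (simp add: stem_eq_iff)
qed

lemma in_cyl_stem [simp]: "x \<in> cyl (stem n x)"
  by (simp add: cyl_def)

lemma stem_cyl: "x \<in> cyl t \<Longrightarrow> stem (length t) x = t"
  by (simp add: cyl_def)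

lemma cyl_Nil [simp]: "cyl [] = UNIV"
  by (auto simp: cyl_def)

lemma stem_prepend: "stem (length t) (prepend t x) = t"
  by (rule nth_equalityI) (simp_all add: stem_def prepend_def)

lemma prepend_in_cyl: "prepend t x \<in> cyl t"
  by (simp add: cyl_def stem_prepend)

lemma nth_stem: "i < n \<Longrightarrow> stem n x ! i = x i"
  by (simp add: stem_def)

lemma prepend_shift:
  assumes "x \<in> cyl t" shows "prepend t (\<lambda>j. x (j + length t)) = x"
proof
  fix i show "prepend t (\<lambda>j. x (j + length t)) i = x i"
    using nth_stem[of i "length t" x] stem_cyl[OF assms] by (simp add: prepend_def)
qed

lemma range_prepend: "range (prepend t) = cyl t"
proof (intro subset_antisym subsetI)
  fix x assume "x \<in> cyl t"
  from prepend_shift[OF this] show "x \<in> range (prepend t)" by (metis rangeI)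
qed (auto simp: prepend_in_cyl)

lemma stem_take: "m \<le> n \<Longrightarrow> take m (stem n x) = stem m x"
  by (simp add: stem_def take_map)

lemma cyl_append_subset: "cyl (t @ s) \<subseteq> cyl t"
proof
  fix x assume "x \<in> cyl (t @ s)"
  then have "stem (length t + length s) x = t @ s" by (simp add: cyl_def)
  then have "take (length t) (stem (length t + length s) x) = t" by simp
  then show "x \<in> cyl t" by (simp add: stem_take cyl_def)
qed

lemma stem_inj_mono: "inj_on (stem m) G \<Longrightarrow> m \<le> n \<Longrightarrow> inj_on (stem n) G"
  unfolding inj_on_def using stem_eq_mono by blast

lemma finite_separated:
  assumes "finite G"
  shows "\<exists>n\<ge>m. inj_on (stem n) G"
proof -
  have "\<exists>n. inj_on (stem n) G"
    using assms
  proof (induction G)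
    case (insert x G)
    then obtain n where n: "inj_on (stem n) G" by blast
    have "\<forall>y\<in>G. \<exists>k. stem k x \<noteq> stem k y" using insert.hyps(2) eq_if_stems_eq by metis
    then obtain k where k: "\<And>y. y \<in> G \<Longrightarrow> stem (k y) x \<noteq> stem (k y) y" by metis
    define N where "N = Max (insert n (k ` G))"
    have N: "n \<le> N" "\<And>y. y \<in> G \<Longrightarrow> k y \<le> N" using insert.hyps(1) by (auto simp: N_def)
    have "stem N x \<noteq> stem N y" if "y \<in> G" for y
      using k[OF that] N(2)[OF that] stem_eq_mono[of N x y "k y"] by blast
    then have "inj_on (stem N) (insert x G)"
      using stem_inj_mono[OF n N(1)] by auto
    then show ?case by blast
  qed simp
  then obtain n where "inj_on (stem n) G" by blast
  then have "inj_on (stem (max m n)) G" by (rule stem_inj_mono) simp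
  then show ?thesis by (intro exI[of _ "max m n"]) simp
qed

text \<open>Level \<open>L n\<close> of the image separates exactly the points that are separated at level \<open>n\<close>. In
  particular such maps are continuous and injective and preserve the order of splitting levels.\<close>

definition tree_emb :: "(cantor \<Rightarrow> cantor) \<Rightarrow> bool" where
  "tree_emb \<Phi> \<longleftrightarrow> (\<exists>L. \<forall>n x y. stem (L n) (\<Phi> x) = stem (L n) (\<Phi> y) \<longleftrightarrow> stem n x = stem n y)"

text \<open>The zero sequence and the indicator of \<open>n\<close> agree on \<open>n\<close> bits
  but not on \<open>n + 1\<close>, so level \<open>L (Suc n)\<close> cannot lie at or below level
  \<open>L n\<close>.\<close>

lemma tree_emb_level_mono:
  fixes L :: "nat \<Rightarrow> nat"
  assumes "\<And>n x y. stem (L n) (\<Phi> x) = stem (L n) (\<Phi> y) \<longleftrightarrow> stem n x = stem n y"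
  shows "strict_mono L"
proof (rule strict_monoI_Suc, rule ccontr)
  fix n :: nat
  define x y :: cantor where "x = (\<lambda>i. False)" and "y = (\<lambda>i. i = n)"
  assume "\<not> L n < L (Suc n)"
  moreover have "stem (L n) (\<Phi> x) = stem (L n) (\<Phi> y)"
    by (rule iffD2[OF assms]) (simp add: x_def y_def stem_eq_iff)
  ultimately have "stem (L (Suc n)) (\<Phi> x) = stem (L (Suc n)) (\<Phi> y)"
    using stem_eq_mono[of "L n" "\<Phi> x" "\<Phi> y" "L (Suc n)"] by simp
  then have "stem (Suc n) x = stem (Suc n) y" by (rule iffD1[OF assms])
  then show False unfolding stem_eq_iff x_def y_def by blast
qed

lemma tree_embE:
  assumes "tree_emb \<Phi>"
  obtains L where "\<And>n x y. stem (L n) (\<Phi> x) = stem (L n) (\<Phi> y) \<longleftrightarrow> stem n x = stem n y" "\<And>n::nat. n \<le> L n"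
proof -
  obtain L where L: "\<And>n x y. stem (L n) (\<Phi> x) = stem (L n) (\<Phi> y) \<longleftrightarrow> stem n x = stem n y"
    using assms unfolding tree_emb_def by blast
  then have "n \<le> L n" for n using tree_emb_level_mono[of L \<Phi>] by (blast intro: strict_mono_imp_increasing)
  then show thesis using that L by blast
qed

lemma tree_emb_inj: "tree_emb \<Phi> \<Longrightarrow> inj \<Phi>"
proof (rule injI)
  fix x y assume "tree_emb \<Phi>" and eq: "\<Phi> x = \<Phi> y"
  then obtain L where L: "\<And>n x y. stem (L n) (\<Phi> x) = stem (L n) (\<Phi> y) \<longleftrightarrow> stem n x = stem n y"
    using tree_embE by metis
  show "x = y" by (rule eq_if_stems_eq) (use L[of _ x y] eq in simp)
qed

lemma tree_emb_cont: "tree_emb \<Phi> \<Longrightarrow> stem n x = stem n y \<Longrightarrow> stem n (\<Phi> x) = stem n (\<Phi> y)"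
proof -
  assume "tree_emb \<Phi>" and eq: "stem n x = stem n y"
  then obtain L where L: "stem (L n) (\<Phi> x) = stem (L n) (\<Phi> y) \<longleftrightarrow> stem n x = stem n y" "n \<le> L n"
    using tree_embE by metis
  show ?thesis using stem_eq_mono[of "L n" "\<Phi> x" "\<Phi> y" n] L eq by simp
qed

lemma tree_emb_comp: "tree_emb \<Phi> \<Longrightarrow> tree_emb \<Psi> \<Longrightarrow> tree_emb (\<lambda>x. \<Phi> (\<Psi> x))"
proof -
  assume "tree_emb \<Phi>" "tree_emb \<Psi>"
  then obtain L M where
    "\<And>n x y. stem (L n) (\<Phi> x) = stem (L n) (\<Phi> y) \<longleftrightarrow> stem n x = stem n y"
    "\<And>n x y. stem (M n) (\<Psi> x) = stem (M n) (\<Psi> y) \<longleftrightarrow> stem n x = stem n y"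
    unfolding tree_emb_def by blast
  then show ?thesis unfolding tree_emb_def by (intro exI[of _ "\<lambda>n. L (M n)"]) simp
qed

lemma tree_emb_id: "tree_emb (\<lambda>x. x)"
  unfolding tree_emb_def by (rule exI[of _ "\<lambda>n. n"]) simp

lemma tree_emb_prepend: "tree_emb (prepend t)"
  unfolding tree_emb_def
proof (intro exI[of _ "\<lambda>n. length t + n"] allI)
  fix n x y
  have "(\<forall>i<length t + n. prepend t x i = prepend t y i) \<longleftrightarrow> (\<forall>i<n. x i = y i)"
  proof
    assume *: "\<forall>i<length t + n. prepend t x i = prepend t y i"
    show "\<forall>i<n. x i = y i"
    proof (intro allI impI)
      fix i assume "i < n" then show "x i = y i"
        using *[rule_format, of "length t + i"] by (simp add: prepend_def)
    qed
  qed (auto simp: prepend_def)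
  then show "(stem (length t + n) (prepend t x) = stem (length t + n) (prepend t y)) = (stem n x = stem n y)"
    by (simp add: stem_eq_iff)
qed

text \<open>The working notion of perfect set: one with a parametrization that respects levels.
  \<open>perfect_if_tree_perfect\<close> leads back to the topological notion.\<close>

definition tree_perfect :: "cantor set \<Rightarrow> bool" where
  "tree_perfect X \<longleftrightarrow> (\<exists>\<Phi>. tree_emb \<Phi> \<and> X = range \<Phi>)"

lemma tree_perfect_range: "tree_emb \<Phi> \<Longrightarrow> tree_perfect (range \<Phi>)"
  by (auto simp: tree_perfect_def)

lemma tree_perfect_image_cyl: "tree_emb \<Phi> \<Longrightarrow> tree_perfect (\<Phi> ` cyl t)"
  using tree_perfect_range[OF tree_emb_comp[OF _ tree_emb_prepend], of \<Phi> t]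
  unfolding range_prepend[symmetric] image_image .

lemma tree_perfect_cyl: "tree_perfect (cyl t)"
  using tree_perfect_image_cyl[OF tree_emb_id, of t] by simp

text \<open>Level \<open>L n\<close> of the image determines the first \<open>n\<close> bits of the
  preimage. Preimages of ever better approximations of \<open>x\<close> therefore agree on ever
  longer stems, and their limit \<open>y\<close> is mapped to \<open>x\<close>.\<close>

lemma tree_perfect_closed:
  assumes "tree_perfect X" "\<And>n. \<exists>y\<in>X. stem n x = stem n y"
  shows "x \<in> X"
proof -
  obtain \<Phi> where \<Phi>: "tree_emb \<Phi>" "X = range \<Phi>" using assms(1) by (auto simp: tree_perfect_def)
  obtain L where L: "\<And>n x y. stem (L n) (\<Phi> x) = stem (L n) (\<Phi> y) \<longleftrightarrow> stem n x = stem n y" "\<And>n::nat. n \<le> L n"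
    using tree_embE[OF \<Phi>(1)] by metis
  have mono: "strict_mono L" using L(1) by (rule tree_emb_level_mono)
  have "\<forall>n. \<exists>y. stem (L n) x = stem (L n) (\<Phi> y)" using assms(2) \<Phi>(2) by auto
  then obtain f where f: "\<And>n. stem (L n) x = stem (L n) (\<Phi> (f n))" by metis
  have coh: "stem n (f n) = stem n (f m)" if "n \<le> m" for n m
  proof -
    have "stem (L n) x = stem (L n) (\<Phi> (f m))"
      using f[of m] that strict_mono_less_eq[OF mono] stem_eq_mono[of "L m" x "\<Phi> (f m)" "L n"] by simp
    then show ?thesis using L(1)[of n "f n" "f m"] f[of n] by simp
  qed
  define y where "y j = f (Suc j) j" for j
  have "stem n y = stem n (f n)" for n
    unfolding stem_eq_iff
  proof (intro allI impI)
    fix i assume "i < n"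
    then have "stem (Suc i) (f (Suc i)) = stem (Suc i) (f n)" using coh by simp
    then show "y i = f n i" by (simp add: y_def stem_eq_iff)
  qed
  then have "stem (L n) (\<Phi> y) = stem (L n) x" for n using L(1)[of n y "f n"] f[of n] by simp
  then have "stem n (\<Phi> y) = stem n x" for n using L(2)[of n] stem_eq_mono[of "L n" "\<Phi> y" x n] by simp
  then have "\<Phi> y = x" by (rule eq_if_stems_eq)
  then show ?thesis using \<Phi>(2) by blast
qed

lemma tree_perfect_shrink:
  assumes "tree_perfect X" "x \<in> X"
  shows "\<exists>Y\<subseteq>X. tree_perfect Y \<and> x \<in> Y \<and> (\<forall>y\<in>Y. stem n y = stem n x)"
proof -
  obtain \<Phi> z where \<Phi>: "tree_emb \<Phi>" "X = range \<Phi>" "x = \<Phi> z" using assms by (auto simp: tree_perfect_def)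
  have eq: "stem n y = stem n x" if y: "y \<in> \<Phi> ` cyl (stem n z)" for y
  proof -
    obtain v where v: "y = \<Phi> v" "v \<in> cyl (stem n z)" using y by blast
    then show ?thesis using tree_emb_cont[OF \<Phi>(1), of n v z] by (simp add: \<Phi>(3) cyl_def)
  qed
  show ?thesis
  proof (intro exI[of _ "\<Phi> ` cyl (stem n z)"] conjI ballI)
    show "x \<in> \<Phi> ` cyl (stem n z)" unfolding \<Phi>(3) by (rule imageI) simp
    show "\<Phi> ` cyl (stem n z) \<subseteq> X" unfolding \<Phi>(2) by (rule image_mono) simp
    show "tree_perfect (\<Phi> ` cyl (stem n z))" by (rule tree_perfect_image_cyl[OF \<Phi>(1)])
    show "stem n y = stem n x" if "y \<in> \<Phi> ` cyl (stem n z)" for y using that by (rule eq)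
  qed
qed

lemma tree_perfect_split:
  assumes "tree_perfect X"
  shows "\<exists>Y :: bool \<Rightarrow> cantor set. \<exists>l. (\<forall>b. tree_perfect (Y b) \<and> Y b \<subseteq> X) \<and>
    (\<forall>x\<in>Y False. \<forall>y\<in>Y True. stem l x \<noteq> stem l y)"
proof -
  obtain \<Phi> where \<Phi>: "tree_emb \<Phi>" "X = range \<Phi>" using assms by (auto simp: tree_perfect_def)
  obtain L where L: "\<And>n x y. stem (L n) (\<Phi> x) = stem (L n) (\<Phi> y) \<longleftrightarrow> stem n x = stem n y"
    using tree_embE[OF \<Phi>(1)] by metis
  have "stem (L 1) x \<noteq> stem (L 1) y" if "x \<in> \<Phi> ` cyl [False]" "y \<in> \<Phi> ` cyl [True]" for x y
  proof -
    obtain x' y' where "x = \<Phi> x'" "y = \<Phi> y'" "stem 1 x' = [False]" "stem 1 y' = [True]"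
      using \<open>x \<in> _\<close> \<open>y \<in> _\<close> by (auto simp: cyl_def)
    then show ?thesis using L[of 1 x' y'] by simp
  qed
  then show ?thesis
    using tree_perfect_image_cyl[OF \<Phi>(1)] \<Phi>(2)
    by (intro exI[of _ "\<lambda>b. \<Phi> ` cyl [b]"] exI[of _ "L 1"]) auto
qed

section \<open>Fusion\<close>

text \<open>Fusion is needed both inside arbitrary perfect sets and, for Baire category arguments,
  inside basic open sets only; hence the parameter \<open>\<P>\<close>.\<close>

definition fusion_class :: "cantor set set \<Rightarrow> bool" where
  "fusion_class \<P> \<longleftrightarrow> (\<forall>X\<in>\<P>. tree_perfect X) \<and>
    (\<forall>X\<in>\<P>. \<exists>Y l. (\<forall>b::bool. Y b \<in> \<P> \<and> Y b \<subseteq> X) \<and> (\<forall>x\<in>Y False. \<forall>y\<in>Y True. stem l x \<noteq> stem l y)) \<and>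
    (\<forall>X\<in>\<P>. \<forall>x\<in>X. \<forall>n. \<exists>Y\<in>\<P>. Y \<subseteq> X \<and> x \<in> Y \<and> (\<forall>y\<in>Y. stem n y = stem n x))"

lemma fusion_class_perfect: "fusion_class \<P> \<Longrightarrow> X \<in> \<P> \<Longrightarrow> tree_perfect X"
  by (simp add: fusion_class_def)

lemma fusion_class_shrink:
  assumes "fusion_class \<P>" "X \<in> \<P>" "x \<in> X"
  obtains Y where "Y \<in> \<P>" "Y \<subseteq> X" "x \<in> Y" "\<And>y. y \<in> Y \<Longrightarrow> stem n y = stem n x"
proof -
  have "\<exists>Y\<in>\<P>. Y \<subseteq> X \<and> x \<in> Y \<and> (\<forall>y\<in>Y. stem n y = stem n x)"
    using assms(1)[unfolded fusion_class_def, THEN conjunct2, THEN conjunct2,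
      THEN bspec, OF assms(2), THEN bspec, OF assms(3), THEN spec] .
  then show thesis by (elim bexE conjE) (rule that, assumption+, erule bspec)
qed

lemma fusion_class_tree_perfect: "fusion_class {X. tree_perfect X}"
  unfolding fusion_class_def
proof (intro conjI ballI allI)
  fix X x n assume "X \<in> {X. tree_perfect X}" "x \<in> X"
  then have "tree_perfect X" by simp
  then obtain Y where "Y \<subseteq> X" "tree_perfect Y" "x \<in> Y" "\<forall>y\<in>Y. stem n y = stem n x"
    using tree_perfect_shrink[OF _ \<open>x \<in> X\<close>, of n] by metis
  then show "\<exists>Y\<in>{X. tree_perfect X}. Y \<subseteq> X \<and> x \<in> Y \<and> (\<forall>y\<in>Y. stem n y = stem n x)"
    by (intro bexI[of _ Y] conjI) (assumption | rule CollectI)+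
next
  fix X assume "X \<in> {X. tree_perfect X}"
  then have "tree_perfect X" by simp
  then show "\<exists>Y l. (\<forall>b::bool. Y b \<in> {X. tree_perfect X} \<and> Y b \<subseteq> X) \<and>
    (\<forall>x\<in>Y False. \<forall>y\<in>Y True. stem l x \<noteq> stem l y)"
    unfolding mem_Collect_eq by (rule tree_perfect_split)
qed simp

lemma fusion_class_cylinders: "fusion_class (range cyl)"
  unfolding fusion_class_def
proof (intro conjI ballI allI)
  fix X assume X: "X \<in> range cyl"
  then show "tree_perfect X" by (auto simp: tree_perfect_cyl)
  obtain t where t: "X = cyl t" using X by auto
  show "\<exists>Y l. (\<forall>b::bool. Y b \<in> range cyl \<and> Y b \<subseteq> X) \<and> (\<forall>x\<in>Y False. \<forall>y\<in>Y True. stem l x \<noteq> stem l y)"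
  proof (intro exI[of _ "\<lambda>b. cyl (t @ [b])"] exI[of _ "Suc (length t)"] conjI allI ballI)
    show "cyl (t @ [b]) \<subseteq> X" for b unfolding t by (rule cyl_append_subset)
    fix x y assume "x \<in> cyl (t @ [False])" "y \<in> cyl (t @ [True])"
    then show "stem (Suc (length t)) x \<noteq> stem (Suc (length t)) y" by (simp add: cyl_def)
  qed simp
  fix x n assume x: "x \<in> X"
  have "cyl (stem (max n (length t)) x) \<subseteq> X"
  proof
    fix y assume "y \<in> cyl (stem (max n (length t)) x)"
    then have "stem (length t) y = stem (length t) x"
      using stem_eq_mono[of "max n (length t)" y x "length t"] by (simp add: cyl_def)
    then show "y \<in> X" using x by (simp add: t cyl_def)
  qed
  moreover have "\<forall>y\<in>cyl (stem (max n (length t)) x). stem n y = stem n x"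
  proof
    fix y assume "y \<in> cyl (stem (max n (length t)) x)"
    then show "stem n y = stem n x"
      using stem_eq_mono[of "max n (length t)" y x n] by (simp add: cyl_def)
  qed
  ultimately show "\<exists>Y\<in>range cyl. Y \<subseteq> X \<and> x \<in> Y \<and> (\<forall>y\<in>Y. stem n y = stem n x)"
    by (intro bexI[of _ "cyl (stem (max n (length t)) x)"] conjI)
      (assumption | rule in_cyl_stem rangeI)+
qed

lemma tree_perfect_nonempty: "tree_perfect X \<Longrightarrow> X \<noteq> {}"
  by (auto simp: tree_perfect_def)

text \<open>The requirement \<open>Q n\<close> concerns the pieces of level \<open>n\<close> for all
  indices at once and is inherited by smaller pieces, so meeting it once at stage \<open>n\<close>
  secures it for the limit. All pieces of a level are kept disjoint, across indices too, so that a
  choice of one point from each of \<open>m\<close> pieces is a set of exactly \<open>m\<close>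
  points.\<close>

lemma fusion:
  fixes X :: "'i \<Rightarrow> cantor set" and Q :: "nat \<Rightarrow> ('i \<Rightarrow> bool list \<Rightarrow> cantor set) \<Rightarrow> bool"
  assumes P: "fusion_class \<P>"
    and X: "\<And>i. i \<in> I \<Longrightarrow> X i \<in> \<P>" "disjoint_family_on X I"
    and hered: "\<And>n Y Z. Q n Y \<Longrightarrow> (\<And>i t. i \<in> I \<Longrightarrow> length t = n \<Longrightarrow> Z i t \<subseteq> Y i t) \<Longrightarrow> Q n Z"
    and dense: "\<And>n Y. (\<And>i t. i \<in> I \<Longrightarrow> length t = n \<Longrightarrow> Y i t \<in> \<P>) \<Longrightarrow>
      disjoint_family_on (\<lambda>(i, t). Y i t) (I \<times> {t. length t = n}) \<Longrightarrow>
      \<exists>Z. Q n Z \<and> (\<forall>i\<in>I. \<forall>t. length t = n \<longrightarrow> Z i t \<in> \<P> \<and> Z i t \<subseteq> Y i t)"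
  obtains \<Phi> where "\<And>i. i \<in> I \<Longrightarrow> tree_emb (\<Phi> i)" "\<And>i. i \<in> I \<Longrightarrow> range (\<Phi> i) \<subseteq> X i"
    "\<And>n. Q n (\<lambda>i t. \<Phi> i ` cyl t)"
proof -
  \<comment> \<open>Apart from distinguishing pieces, \<open>sep\<close> demands that the stem of
    length \<open>l\<close> be constant on each piece. The two halves become the two directions of
    the equivalence in \<open>tree_emb\<close>, with \<open>l\<close> as the level
    \<open>L n\<close>.\<close>
  define sep where "sep n Z l \<longleftrightarrow> (\<forall>t t'. length t = n \<longrightarrow> length t' = n \<longrightarrow>
    (\<forall>x\<in>Z t. \<forall>y\<in>Z t'. stem l x = stem l y \<longleftrightarrow> t = t'))" for n l :: nat and Z :: "bool list \<Rightarrow> cantor set"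
  define St where "St n Z \<longleftrightarrow> (\<forall>i\<in>I. \<forall>t. length t = n \<longrightarrow> Z i t \<in> \<P>) \<and>
    disjoint_family_on (\<lambda>(i, t). Z i t) (I \<times> {t. length t = n}) \<and> Q n Z \<and> (\<forall>i\<in>I. \<exists>l. sep n (Z i) l)" for n Z
  have refine: "\<exists>Z. St n Z \<and> (\<forall>i\<in>I. \<forall>t. length t = n \<longrightarrow> Z i t \<subseteq> Y i t)"
    if Y: "\<And>i t. i \<in> I \<Longrightarrow> length t = n \<Longrightarrow> Y i t \<in> \<P>"
      "disjoint_family_on (\<lambda>(i, t). Y i t) (I \<times> {t. length t = n})" "\<And>i. i \<in> I \<Longrightarrow> \<exists>l. sep n (Y i) l"
    for n Y
  proof -
    obtain Z where Z: "Q n Z" "\<And>i t. i \<in> I \<Longrightarrow> length t = n \<Longrightarrow> Z i t \<in> \<P> \<and> Z i t \<subseteq> Y i t"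
      using dense[of n Y, OF Y(1,2)] by auto
    have "\<exists>l. sep n (Z i) l" if i: "i \<in> I" for i
    proof -
      obtain l where "sep n (Y i) l" using Y(3)[OF i] by blast
      then have "sep n (Z i) l" using Z(2)[OF i] unfolding sep_def by (intro allI impI ballI) blast
      then show ?thesis by blast
    qed
    moreover have "disjoint_family_on (\<lambda>(i, t). Z i t) (I \<times> {t. length t = n})"
      by (rule disjoint_family_on_bisimulation[OF Y(2)]) (use Z(2) in blast)
    moreover have "\<forall>i\<in>I. \<forall>t. length t = n \<longrightarrow> Z i t \<in> \<P>" using Z(2) by blast
    ultimately have "St n Z" using Z(1) unfolding St_def by blast
    then show ?thesis using Z(2) by blast
  qed
  have "\<exists>Z. St 0 Z \<and> (\<forall>i\<in>I. \<forall>t. length t = 0 \<longrightarrow> Z i t \<subseteq> X i)"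
  proof (rule refine)
    show "\<exists>l. sep 0 (\<lambda>_. X i) l" for i by (rule exI[of _ 0]) (simp add: sep_def)
  qed (use X in \<open>auto simp: disjoint_family_on_def\<close>)
  then obtain Z0 where Z0: "St 0 Z0" "\<And>i. i \<in> I \<Longrightarrow> Z0 i [] \<subseteq> X i" by auto
  have step: "\<exists>Z'. St (Suc n) Z' \<and> (\<forall>i\<in>I. \<forall>t b. length t = n \<longrightarrow> Z' i (t @ [b]) \<subseteq> Z i t)" if stZ: "St n Z" for n Z
  proof -
    have "\<forall>i\<in>I. \<forall>t. \<exists>Y l. length t = n \<longrightarrow> (\<forall>b::bool. Y b \<in> \<P> \<and> Y b \<subseteq> Z i t) \<and>
      (\<forall>x\<in>Y False. \<forall>y\<in>Y True. stem l x \<noteq> stem l y)"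
      using P stZ unfolding fusion_class_def St_def by meson
    then obtain Y l where Y: "\<And>i t b. i \<in> I \<Longrightarrow> length t = n \<Longrightarrow> Y i t b \<in> \<P> \<and> Y i t b \<subseteq> Z i t"
      "\<And>i t x y. i \<in> I \<Longrightarrow> length t = n \<Longrightarrow> x \<in> Y i t False \<Longrightarrow> y \<in> Y i t True \<Longrightarrow> stem (l i t) x \<noteq> stem (l i t) y"
      by metis
    obtain k where k: "\<And>i. i \<in> I \<Longrightarrow> sep n (Z i) (k i)" using stZ unfolding St_def by metis
    \<comment> \<open>Stems of length \<open>m i\<close> distinguish pieces over different nodes as
      well as the two halves of a piece. Once the halves are shrunk so that this stem is constant on
      each, \<open>m i\<close> witnesses \<open>sep\<close> for the next level.\<close>
    define m where "m i = Max (insert (k i) (l i ` {t. length t = n}))" for i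
    have fin: "finite {t :: bool list. length t = n}"
      using finite_lists_length_eq[of "UNIV :: bool set" n] by simp
    have m: "k i \<le> m i" "\<And>t. length t = n \<Longrightarrow> l i t \<le> m i" for i
      unfolding m_def using fin by auto
    have "\<forall>i\<in>I. \<forall>t b. \<exists>V. length t = n \<longrightarrow> V \<in> \<P> \<and> V \<subseteq> Y i t b \<and> (\<forall>x\<in>V. \<forall>y\<in>V. stem (m i) x = stem (m i) y)"
    proof (intro ballI allI)
      fix i t b assume i: "i \<in> I"
      show "\<exists>V. length t = n \<longrightarrow> V \<in> \<P> \<and> V \<subseteq> Y i t b \<and> (\<forall>x\<in>V. \<forall>y\<in>V. stem (m i) x = stem (m i) y)"
      proof (cases "length t = n")
        case True
        then have "Y i t b \<in> \<P>" using Y(1) i by blast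
        moreover from this obtain x where "x \<in> Y i t b"
          using tree_perfect_nonempty[OF fusion_class_perfect[OF P]] by auto
        ultimately obtain V where V: "V \<in> \<P>" "V \<subseteq> Y i t b" "\<And>y. y \<in> V \<Longrightarrow> stem (m i) y = stem (m i) x"
          using fusion_class_shrink[OF P] by metis
        have "stem (m i) y = stem (m i) z" if "y \<in> V" "z \<in> V" for y z
          using V(3)[OF that(1)] V(3)[OF that(2)] by simp
        then show ?thesis using V(1,2) by (intro exI[of _ V] impI conjI ballI)
      qed simp
    qed
    then obtain V where V: "\<And>i t b. i \<in> I \<Longrightarrow> length t = n \<Longrightarrow> V i t b \<in> \<P> \<and> V i t b \<subseteq> Y i t b \<and>
      (\<forall>x\<in>V i t b. \<forall>y\<in>V i t b. stem (m i) x = stem (m i) y)" by metis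
    have VP: "V i t b \<in> \<P>" and VY: "V i t b \<subseteq> Y i t b" if "i \<in> I" "length t = n" for i t b
      using V[OF that, of b] by simp_all
    have VZ: "V i t b \<subseteq> Z i t" if "i \<in> I" "length t = n" for i t b
      by (rule order_trans[OF VY[OF that] conjunct2[OF Y(1)[OF that]]])
    define W where "W i t = V i (butlast t) (last t)" for i t
    have diff: "stem (m i) x \<noteq> stem (m i) y" if "i \<in> I" "length s = n" "length t = n" "(s, b) \<noteq> (t, c)"
      "x \<in> V i s b" "y \<in> V i t c" for i s t b c x y
    proof (cases "s = t")
      have xY: "x \<in> Y i s b" "y \<in> Y i t c"
        using subsetD[OF VY that(5)] subsetD[OF VY that(6)] that(1-3) by blast+
      case True
      then have "b \<noteq> c" using that by auto
      then have "stem (l i s) x \<noteq> stem (l i s) y"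
        using Y(2)[OF that(1,2), of x y] Y(2)[OF that(1,2), of y x] xY True by (cases b; cases c) auto
      then show ?thesis using m(2)[OF that(2), of i] stem_eq_mono[of "m i" x y "l i s"] by blast
    next
      case False
      have "x \<in> Z i s" "y \<in> Z i t"
        using subsetD[OF VZ that(5)] subsetD[OF VZ that(6)] that(1-3) by blast+
      then have "stem (k i) x \<noteq> stem (k i) y" using k[OF that(1)] False that(2,3) unfolding sep_def by blast
      then show ?thesis using m(1)[of i] stem_eq_mono[of "m i" x y "k i"] by blast
    qed
    have sepW: "sep (Suc n) (W i) (m i)" if i: "i \<in> I" for i
      unfolding sep_def
    proof (intro allI impI ballI)
      fix t t' x y assume t: "length t = Suc n" "length t' = Suc n" and xy: "x \<in> W i t" "y \<in> W i t'"
      have bl: "length (butlast t) = n" "length (butlast t') = n" using t by auto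
      have "t = t' \<longleftrightarrow> (butlast t, last t) = (butlast t', last t')"
        using t append_butlast_last_id by (metis Pair_inject Zero_not_Suc length_0_conv)
      then show "stem (m i) x = stem (m i) y \<longleftrightarrow> t = t'"
        using diff[OF i bl, of "last t" "last t'" x y] V[OF i bl(1), of "last t"] xy unfolding W_def by metis
    qed
    have disj: "W i t \<inter> W j s = {}"
      if i: "i \<in> I" "j \<in> I" and t: "length t = Suc n" "length s = Suc n" and neq: "(i, t) \<noteq> (j, s)" for i j t s
    proof (cases "i = j")
      case True
      show ?thesis
      proof (rule ccontr)
        assume "W i t \<inter> W j s \<noteq> {}"
        then obtain x where "x \<in> W i t" "x \<in> W i s" using True by blast
        then have "t = s" using sepW[OF i(1)] t unfolding sep_def by blast
        then show False using neq True by simp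
      qed
    next
      case False
      have bl: "length (butlast t) = n" "length (butlast s) = n" using t by auto
      have "W i t \<subseteq> Z i (butlast t)" "W j s \<subseteq> Z j (butlast s)"
        using VZ[OF i(1) bl(1)] VZ[OF i(2) bl(2)] by (simp_all add: W_def)
      moreover have "Z i (butlast t) \<inter> Z j (butlast s) = {}"
        using disjoint_family_onD[of "\<lambda>(i, t). Z i t" "I \<times> {t. length t = n}" "(i, butlast t)" "(j, butlast s)"]
          stZ False i bl unfolding St_def by simp
      ultimately show ?thesis by blast
    qed
    have "\<exists>Z'. St (Suc n) Z' \<and> (\<forall>i\<in>I. \<forall>t. length t = Suc n \<longrightarrow> Z' i t \<subseteq> W i t)"
    proof (rule refine)
      show "W i t \<in> \<P>" if "i \<in> I" "length t = Suc n" for i t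
        using VP[of i "butlast t"] that by (simp add: W_def)
      show "disjoint_family_on (\<lambda>(i, t). W i t) (I \<times> {t. length t = Suc n})"
        unfolding disjoint_family_on_def
      proof (intro ballI impI)
        fix p q :: "'i \<times> bool list" assume p: "p \<in> I \<times> {t. length t = Suc n}" "q \<in> I \<times> {t. length t = Suc n}" "p \<noteq> q"
        obtain i t j s where pq: "p = (i, t)" "q = (j, s)" by (cases p, cases q)
        show "(case p of (i, t) \<Rightarrow> W i t) \<inter> (case q of (i, t) \<Rightarrow> W i t) = {}"
          using disj[of i j t s] p pq by auto
      qed
    qed (use sepW in blast)
    then obtain Z' where Z': "St (Suc n) Z'" "\<And>i t. i \<in> I \<Longrightarrow> length t = Suc n \<Longrightarrow> Z' i t \<subseteq> W i t" by blast
    have "Z' i (t @ [b]) \<subseteq> Z i t" if "i \<in> I" "length t = n" for i t b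
      using Z'(2)[OF that(1), of "t @ [b]"] VZ[OF that, of b] that(2)
      by (simp add: W_def)
    then show ?thesis using Z'(1) by blast
  qed
  obtain Z where Z: "Z 0 = Z0" "\<And>n. St n (Z n)"
    "\<And>n. \<forall>i\<in>I. \<forall>t b. length t = n \<longrightarrow> Z (Suc n) i (t @ [b]) \<subseteq> Z n i t"
  proof -
    have "\<exists>f. \<forall>n. (St n (f n) \<and> (n = 0 \<longrightarrow> f n = Z0)) \<and>
      (\<forall>i\<in>I. \<forall>t b. length t = n \<longrightarrow> f (Suc n) i (t @ [b]) \<subseteq> f n i t)"
    proof (rule dependent_nat_choice)
      show "\<exists>Z. St 0 Z \<and> (0 = (0::nat) \<longrightarrow> Z = Z0)" using Z0(1) by blast
      show "\<exists>Z'. (St (Suc n) Z' \<and> (Suc n = 0 \<longrightarrow> Z' = Z0)) \<and>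
          (\<forall>i\<in>I. \<forall>t b. length t = n \<longrightarrow> Z' i (t @ [b]) \<subseteq> Z i t)"
        if "St n Z \<and> (n = 0 \<longrightarrow> Z = Z0)" for Z n
        using step[of n Z] that by simp
    qed
    then obtain f where "\<And>n. St n (f n)" "f 0 = Z0"
      "\<And>n. \<forall>i\<in>I. \<forall>t b. length t = n \<longrightarrow> f (Suc n) i (t @ [b]) \<subseteq> f n i t"
      by blast
    then show thesis by (intro that)
  qed
  have Zmem: "Z n i t \<in> \<P>" if "i \<in> I" "length t = n" for n i t
    using Z(2) that unfolding St_def by blast
  have perf: "tree_perfect (Z n i t)" if "i \<in> I" "length t = n" for n i t
    by (rule fusion_class_perfect[OF P Zmem[OF that]])
  have mono: "Z n i (stem n x) \<subseteq> Z m i (stem m x)" if "i \<in> I" "m \<le> n" for i m n x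
    using that(2)
  proof (induction rule: dec_induct)
    case (step n)
    have "Z (Suc n) i (stem n x @ [x n]) \<subseteq> Z n i (stem n x)" using Z(3)[of n] that(1) by simp
    then show ?case using step.IH by (simp add: stem_Suc)
  qed simp
  have "\<exists>\<Phi>. tree_emb \<Phi> \<and> (\<forall>n x. \<Phi> x \<in> Z n i (stem n x))" if i: "i \<in> I" for i
  proof -
    have "\<forall>n. \<exists>l. sep n (Z n i) l" using Z(2) i unfolding St_def by blast
    then obtain L where L: "\<And>n. sep n (Z n i) (L n)" by metis
    have sepL: "stem (L n) x = stem (L n) y \<longleftrightarrow> s = t"
      if "x \<in> Z n i s" "y \<in> Z n i t" "length s = n" "length t = n" for n s t x y
      using L[of n, unfolded sep_def, rule_format, OF that(3,4,1,2)] .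
    have inc: "strict_mono L"
    proof (rule strict_monoI_Suc)
      fix n
      let ?t = "replicate n False"
      obtain x y where xy: "x \<in> Z (Suc n) i (?t @ [False])" "y \<in> Z (Suc n) i (?t @ [True])"
        using tree_perfect_nonempty perf[OF i] by (metis all_not_in_conv length_append_singleton length_replicate)
      then have "stem (L (Suc n)) x \<noteq> stem (L (Suc n)) y"
        using sepL[OF xy] by simp
      moreover have "stem (L n) x = stem (L n) y"
      proof -
        have "x \<in> Z n i ?t" "y \<in> Z n i ?t" using xy Z(3)[of n] i by (meson length_replicate subsetD)+
        then show ?thesis using sepL by (metis length_replicate)
      qed
      ultimately show "L n < L (Suc n)" using stem_eq_mono[of "L n" x y "L (Suc n)"] by (rule_tac ccontr) simp
    qed
    then have Ln: "n \<le> L n" for n by (rule strict_mono_imp_increasing)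
    define p where "p n t = (SOME y. y \<in> Z n i t)" for n t
    have p: "p n t \<in> Z n i t" if "length t = n" for n t
      unfolding p_def using tree_perfect_nonempty[OF perf[OF i that]] by (simp add: some_in_eq)
    \<comment> \<open>On a piece of level \<open>Suc j\<close> the first \<open>Suc j\<close> bits
      are constant because \<open>Suc j \<le> L (Suc j)\<close>, so bit \<open>j\<close> does not
      depend on the point chosen by \<open>p\<close>.\<close>
    define \<Phi> where "\<Phi> x j = p (Suc j) (stem (Suc j) x) j" for x j
    have \<Phi>: "\<Phi> x \<in> Z n i (stem n x)" for n x
    proof (rule tree_perfect_closed[OF perf[OF i]])
      fix m
      let ?k = "max n m"
      let ?y = "p ?k (stem ?k x)"
      have y: "?y \<in> Z ?k i (stem ?k x)" by (rule p) simp
      have "\<Phi> x j = ?y j" if "j < m" for j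
      proof -
        have "?y \<in> Z (Suc j) i (stem (Suc j) x)" 
          by (rule subsetD[OF mono[OF i] y]) (use that in simp)
        then have "stem (L (Suc j)) ?y = stem (L (Suc j)) (p (Suc j) (stem (Suc j) x))"
          by (rule iffD2[OF sepL[OF _ p] refl]) simp_all
        then show ?thesis using Ln[of "Suc j"] unfolding \<Phi>_def stem_eq_iff by simp
      qed
      then show "\<exists>y\<in>Z n i (stem n x). stem m (\<Phi> x) = stem m y"
        using subsetD[OF mono[OF i] y, of n] by (intro bexI[of _ ?y]) (simp_all add: stem_eq_iff)
    qed simp
    have "tree_emb \<Phi>"
      unfolding tree_emb_def
    proof (intro exI[of _ L] allI)
      fix n x y
      show "(stem (L n) (\<Phi> x) = stem (L n) (\<Phi> y)) = (stem n x = stem n y)"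
        by (rule sepL[OF \<Phi> \<Phi>]) simp_all
    qed
    then show ?thesis using \<Phi> by blast
  qed
  then obtain \<Phi> where \<Phi>: "\<And>i. i \<in> I \<Longrightarrow> tree_emb (\<Phi> i)" "\<And>i n x. i \<in> I \<Longrightarrow> \<Phi> i x \<in> Z n i (stem n x)"
    by metis
  show thesis
  proof (rule that[of \<Phi>])
    show "range (\<Phi> i) \<subseteq> X i" if "i \<in> I" for i
      using \<Phi>(2)[OF that, of _ 0] Z(1) Z0(2)[OF that] by auto
    show "Q n (\<lambda>i t. \<Phi> i ` cyl t)" for n
    proof (rule hered)
      show "Q n (Z n)" using Z(2) unfolding St_def by blast
      show "\<Phi> i ` cyl t \<subseteq> Z n i t" if it: "i \<in> I" "length t = n" for i t
      proof
        fix y assume "y \<in> \<Phi> i ` cyl t"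
        then obtain x where x: "y = \<Phi> i x" "stem n x = t" using it(2) by (auto simp: cyl_def)
        then show "y \<in> Z n i t" using \<Phi>(2)[OF it(1), of x n] by simp
      qed
    qed
  qed (rule \<Phi>(1))
qed

section \<open>Continuous colourings and splitting\<close>

text \<open>Local constancy on the sets of size \<open>k\<close>, expressed by stems; the values on
  sets of other sizes are left free.\<close>

definition continuous_colouring :: "nat \<Rightarrow> (cantor set \<Rightarrow> bool) \<Rightarrow> bool" where
  "continuous_colouring k c \<longleftrightarrow> (\<forall>G\<in>[UNIV]\<^bsup>k\<^esup>. \<exists>n. inj_on (stem n) G \<and>
     (\<forall>G'\<in>[UNIV]\<^bsup>k\<^esup>. stem n ` G' = stem n ` G \<longrightarrow> c G' = c G))"

lemma in_nsets_UNIV: "G \<in> [UNIV]\<^bsup>k\<^esup> \<longleftrightarrow> finite G \<and> card G = k"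
  by (simp add: nsets_def)

lemma transversal_inj:
  assumes "disjoint_family_on V K" "\<And>a. a \<in> K \<Longrightarrow> g a \<in> V a"
  shows "inj_on g K"
proof (rule inj_onI)
  fix a b assume "a \<in> K" "b \<in> K" "g a = g b"
  then show "a = b" using assms(2)[of a] assms(2)[of b] disjoint_family_onD[OF assms(1), of a b] by auto
qed

lemma transversal_nsets:
  assumes "disjoint_family_on V K" "\<And>a. a \<in> K \<Longrightarrow> g a \<in> V a" "finite K"
  shows "g ` K \<in> [UNIV]\<^bsup>card K\<^esup>"
  using assms(3) card_image[OF transversal_inj[OF assms(1,2)]] by (simp add: in_nsets_UNIV)

text \<open>The requirements are met one at a time; heredity preserves the earlier ones, and
  disjointness passes to smaller sets.\<close>

lemma shrink_finitely_often:
  fixes V :: "'a \<Rightarrow> 'b set"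
  assumes "finite T" "\<And>a. a \<in> J \<Longrightarrow> V a \<in> \<P>" "disjoint_family_on V J"
    and hered: "\<And>\<tau> U V. \<tau> \<in> T \<Longrightarrow> R \<tau> V \<Longrightarrow> (\<And>a. a \<in> J \<Longrightarrow> U a \<subseteq> V a) \<Longrightarrow> R \<tau> U"
    and dense: "\<And>\<tau> V. \<tau> \<in> T \<Longrightarrow> (\<And>a. a \<in> J \<Longrightarrow> V a \<in> \<P>) \<Longrightarrow> disjoint_family_on V J \<Longrightarrow>
      \<exists>U. (\<forall>a\<in>J. U a \<in> \<P> \<and> U a \<subseteq> V a) \<and> R \<tau> U"
  shows "\<exists>U. (\<forall>a\<in>J. U a \<in> \<P> \<and> U a \<subseteq> V a) \<and> (\<forall>\<tau>\<in>T. R \<tau> U)"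
  using assms(1) hered dense
proof (induction T)
  case empty
  then show ?case using assms(2) by (intro exI[of _ V]) simp
next
  case (insert \<tau> T)
  have "\<exists>U. (\<forall>a\<in>J. U a \<in> \<P> \<and> U a \<subseteq> V a) \<and> (\<forall>\<tau>\<in>T. R \<tau> U)"
    by (rule insert.IH) (use insert.prems in \<open>blast+\<close>)
  then obtain U where U: "\<And>a. a \<in> J \<Longrightarrow> U a \<in> \<P>" "\<And>a. a \<in> J \<Longrightarrow> U a \<subseteq> V a" "\<And>\<tau>. \<tau> \<in> T \<Longrightarrow> R \<tau> U"
    by blast
  have "disjoint_family_on U J"
    by (rule disjoint_family_on_bisimulation[OF assms(3)]) (use U(2) in blast)
  then obtain U' where U': "\<And>a. a \<in> J \<Longrightarrow> U' a \<in> \<P>" "\<And>a. a \<in> J \<Longrightarrow> U' a \<subseteq> U a" "R \<tau> U'"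
    using insert.prems(2)[of \<tau> U] U(1) by blast
  have "R \<sigma> U'" if "\<sigma> \<in> T" for \<sigma>
    by (rule insert.prems(1)[OF _ U(3)[OF that] U'(2)]) (use that in simp_all)
  moreover have "U' a \<subseteq> V a" if "a \<in> J" for a using U'(2)[OF that] U(2)[OF that] by (rule order_trans)
  ultimately show ?case using U'(1,3) by (intro exI[of _ U']) simp
qed

definition decided :: "(cantor set \<Rightarrow> bool) \<Rightarrow> 'a set \<Rightarrow> ('a \<Rightarrow> cantor set) \<Rightarrow> bool" where
  "decided c K V \<longleftrightarrow> (\<exists>\<epsilon>. \<forall>g. (\<forall>a\<in>K. g a \<in> V a) \<longrightarrow> c (g ` K) = \<epsilon>)"

lemma decided_mono:
  assumes "decided c K V" "\<And>a. a \<in> K \<Longrightarrow> U a \<subseteq> V a"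
  shows "decided c K U"
proof -
  obtain \<epsilon> where \<epsilon>: "\<forall>g. (\<forall>a\<in>K. g a \<in> V a) \<longrightarrow> c (g ` K) = \<epsilon>"
    using assms(1) unfolding decided_def by blast
  have "c (g ` K) = \<epsilon>" if "\<forall>a\<in>K. g a \<in> U a" for g
    by (rule \<epsilon>[rule_format]) (use that assms(2) in blast)
  then show ?thesis unfolding decided_def by blast
qed

lemma decidedD:
  assumes "decided c K V" "\<And>a. a \<in> K \<Longrightarrow> g a \<in> V a" "\<And>a. a \<in> K \<Longrightarrow> h a \<in> V a"
  shows "c (g ` K) = c (h ` K)"
proof -
  obtain \<epsilon> where \<epsilon>: "\<forall>g. (\<forall>a\<in>K. g a \<in> V a) \<longrightarrow> c (g ` K) = \<epsilon>"
    using assms(1) unfolding decided_def by blast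
  have "c (g ` K) = \<epsilon>" "c (h ` K) = \<epsilon>" by (rule \<epsilon>[rule_format], rule assms, assumption)+
  then show ?thesis by simp
qed

text \<open>Continuity at one chosen transversal \<open>x\<close> gives a level \<open>n\<close>;
  shrinking each set to points that agree with \<open>x\<close> up to \<open>n\<close> leaves only
  transversals of the same colour.\<close>

lemma decided_shrink:
  assumes P: "fusion_class \<P>" and c: "continuous_colouring (card K) c" and K: "finite K" "K \<subseteq> J"
    and V: "\<And>a. a \<in> J \<Longrightarrow> V a \<in> \<P>" "disjoint_family_on V J"
  shows "\<exists>U. (\<forall>a\<in>J. U a \<in> \<P> \<and> U a \<subseteq> V a) \<and> decided c K U"
proof -
  have "\<forall>a\<in>J. \<exists>x. x \<in> V a" using tree_perfect_nonempty[OF fusion_class_perfect[OF P V(1)]] by blast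
  then obtain x where x: "\<And>a. a \<in> J \<Longrightarrow> x a \<in> V a" by metis
  have disj: "disjoint_family_on V K" using V(2) K(2) disjoint_family_on_mono by blast
  have ns: "x ` K \<in> [UNIV]\<^bsup>card K\<^esup>"
    using disj x K by (intro transversal_nsets) auto
  obtain n where "\<forall>G\<in>[UNIV]\<^bsup>card K\<^esup>. stem n ` G = stem n ` x ` K \<longrightarrow> c G = c (x ` K)"
    using c[unfolded continuous_colouring_def, THEN bspec, OF ns] by (elim exE conjE) (rule that)
  note n = this[rule_format]
  have "\<forall>a\<in>J. \<exists>U. U \<in> \<P> \<and> U \<subseteq> V a \<and> (\<forall>y\<in>U. stem n y = stem n (x a))"
  proof
    fix a assume "a \<in> J"
    then obtain U where "U \<in> \<P>" "U \<subseteq> V a" "\<And>y. y \<in> U \<Longrightarrow> stem n y = stem n (x a)"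
      using fusion_class_shrink[OF P V(1) x] by metis
    then show "\<exists>U. U \<in> \<P> \<and> U \<subseteq> V a \<and> (\<forall>y\<in>U. stem n y = stem n (x a))"
      by (intro exI[of _ U] conjI ballI)
  qed
  then obtain U where U: "\<And>a. a \<in> J \<Longrightarrow> U a \<in> \<P>" "\<And>a. a \<in> J \<Longrightarrow> U a \<subseteq> V a"
    "\<And>a y. a \<in> J \<Longrightarrow> y \<in> U a \<Longrightarrow> stem n y = stem n (x a)" by metis
  have "c (g ` K) = c (x ` K)" if g: "\<forall>a\<in>K. g a \<in> U a" for g
  proof (rule n)
    show "g ` K \<in> [UNIV]\<^bsup>card K\<^esup>"
      by (rule transversal_nsets[OF disj]) (use g U(2) K in blast)+
    have "stem n (g a) = stem n (x a)" if "a \<in> K" for a by (rule U(3)) (use that K g in blast)+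
    then show "stem n ` g ` K = stem n ` x ` K" unfolding image_image by (intro image_cong) auto
  qed
  then have "decided c K U" unfolding decided_def by blast
  then show ?thesis using U(1,2) by blast
qed

lemma decided_shrink_all:
  assumes P: "fusion_class \<P>" and c: "continuous_colouring k c" and J: "finite J"
    and V: "\<And>a. a \<in> J \<Longrightarrow> V a \<in> \<P>" "disjoint_family_on V J"
  shows "\<exists>U. (\<forall>a\<in>J. U a \<in> \<P> \<and> U a \<subseteq> V a) \<and> (\<forall>K\<in>[J]\<^bsup>k\<^esup>. decided c K U)"
proof -
  have hered: "decided c K U"
    if "K \<in> [J]\<^bsup>k\<^esup>" "decided c K V" "\<And>a. a \<in> J \<Longrightarrow> U a \<subseteq> V a" for K U V
    using that(2) by (rule decided_mono) (use that in \<open>auto simp: nsets_def\<close>)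
  have dense: "\<exists>U. (\<forall>a\<in>J. U a \<in> \<P> \<and> U a \<subseteq> V a) \<and> decided c K U"
    if "K \<in> [J]\<^bsup>k\<^esup>" "\<And>a. a \<in> J \<Longrightarrow> V a \<in> \<P>" "disjoint_family_on V J" for K V
    using that c by (intro decided_shrink[OF P]) (auto simp: nsets_def)
  show ?thesis
    by (rule shrink_finitely_often[where R = "decided c", OF finite_imp_finite_nsets[OF J] V hered dense])
qed

lemma finite_lists_length: "finite {t :: bool list. length t = n}"
  using finite_lists_length_eq[of "UNIV :: bool set" n] by simp

text \<open>Bit \<open>i\<close> of the argument sits at position \<open>2 * i + r\<close> and all
  positions of the other parity hold \<open>False\<close>, so \<open>2 * n\<close> bits of the image
  show exactly \<open>n\<close> bits of the argument.\<close>

lemma tree_emb_even_odd: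
  assumes "r < 2"
  shows "tree_emb (\<lambda>y n. n mod 2 = r \<and> y (n div 2))"
  unfolding tree_emb_def
proof (intro exI[of _ "\<lambda>n. 2 * n"] allI)
  fix n and x y :: cantor
  have "(\<forall>i<2 * n. (i mod 2 = r \<and> x (i div 2)) = (i mod 2 = r \<and> y (i div 2))) \<longleftrightarrow> (\<forall>i<n. x i = y i)"
  proof (rule iffI; intro allI impI)
    fix i assume *: "\<forall>i<2 * n. (i mod 2 = r \<and> x (i div 2)) = (i mod 2 = r \<and> y (i div 2))" and "i < n"
    then have "2 * i + r < 2 * n" using assms by simp
    from *[rule_format, OF this] show "x i = y i" using assms by simp
  next
    fix i assume *: "\<forall>i<n. x i = y i" and "i < 2 * n"
    then have "i div 2 < n" by simp
    from *[rule_format, OF this] show "(i mod 2 = r \<and> x (i div 2)) = (i mod 2 = r \<and> y (i div 2))" by simp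
  qed
  then show "stem (2 * n) (\<lambda>i. i mod 2 = r \<and> x (i div 2)) = stem (2 * n) (\<lambda>i. i mod 2 = r \<and> y (i div 2))
    \<longleftrightarrow> stem n x = stem n y" by (simp only: stem_eq_iff)
qed

text \<open>A letter assigns a bit to each index, so that a word is a tuple of nodes of the same level.
  The perfect set with index \<open>i0\<close> uses the variables of the even blocks of the chain and the other
  ones those of the odd blocks, where the sets not using a variable substitute \<^const>\<open>False\<close> for it.
  Hence at a splitting of coordinate \<open>i0\<close> the next bits of the other coordinates are known.\<close>

lemma split_homogeneous:
  fixes X :: "'i \<Rightarrow> cantor set"
  assumes I: "finite I" "i0 \<in> I" and c: "continuous_colouring (Suc (card I)) c"
    and X: "\<And>i. i \<in> I \<Longrightarrow> tree_perfect (X i)" "disjoint_family_on X I"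
  shows "\<exists>Y \<epsilon>. (\<forall>i\<in>I. tree_perfect (Y i) \<and> Y i \<subseteq> X i) \<and>
    (\<forall>x\<in>Y i0. \<forall>y\<in>Y i0. \<forall>g. x \<noteq> y \<longrightarrow> (\<forall>i\<in>I. g i \<in> Y i) \<longrightarrow> c (insert x (insert y (g ` (I - {i0})))) = \<epsilon>)"
proof -
  \<comment> \<open>A preliminary fusion makes colours readable from nodes of a single level. The
    size \<open>Suc (card I)\<close> is that of a configuration with two nodes in coordinate
    \<open>i0\<close> and one in every other coordinate.\<close>
  define Q where "Q n Y \<longleftrightarrow> (\<forall>K\<in>[I \<times> {t. length t = n}]\<^bsup>Suc (card I)\<^esup>. decided c K (\<lambda>(i, t). Y i t))"
    for n and Y :: "'i \<Rightarrow> bool list \<Rightarrow> cantor set"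
  obtain \<Phi> where \<Phi>: "\<And>i. i \<in> I \<Longrightarrow> tree_emb (\<Phi> i)" "\<And>i. i \<in> I \<Longrightarrow> range (\<Phi> i) \<subseteq> X i"
    "\<And>n. Q n (\<lambda>i t. \<Phi> i ` cyl t)"
  proof (rule fusion[OF fusion_class_tree_perfect, of I X Q])
    show "Q n Z" if "Q n Y" "\<And>i t. i \<in> I \<Longrightarrow> length t = n \<Longrightarrow> Z i t \<subseteq> Y i t" for n Y Z
      unfolding Q_def
    proof
      fix K :: "('i \<times> bool list) set" assume K: "K \<in> [I \<times> {t. length t = n}]\<^bsup>Suc (card I)\<^esup>"
      have "decided c K (\<lambda>(i, t). Y i t)" using that(1) K unfolding Q_def by blast
      then show "decided c K (\<lambda>(i, t). Z i t)"
        by (rule decided_mono) (use that(2) K in \<open>auto simp: nsets_def\<close>)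
    qed
    show "\<exists>Z. Q n Z \<and> (\<forall>i\<in>I. \<forall>t. length t = n \<longrightarrow> Z i t \<in> {X. tree_perfect X} \<and> Z i t \<subseteq> Y i t)"
      if Y: "\<And>i t. i \<in> I \<Longrightarrow> length t = n \<Longrightarrow> Y i t \<in> {X. tree_perfect X}"
        "disjoint_family_on (\<lambda>(i, t). Y i t) (I \<times> {t. length t = n})" for n Y
    proof -
      have fin: "finite (I \<times> {t :: bool list. length t = n})" using I finite_lists_length by blast
      obtain U where U: "\<forall>a\<in>I \<times> {t. length t = n}. U a \<in> {X. tree_perfect X} \<and> U a \<subseteq> (case a of (i, t) \<Rightarrow> Y i t)"
        "\<forall>K\<in>[I \<times> {t. length t = n}]\<^bsup>Suc (card I)\<^esup>. decided c K U"
        using decided_shrink_all[OF fusion_class_tree_perfect c fin, of "\<lambda>(i, t). Y i t", OF _ Y(2)] Y(1) by fast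
      have "Q n (curry U)" using U(2) by (simp add: Q_def curry_def)
      then show ?thesis using U(1) by (intro exI[of _ "curry U"]) simp
    qed
  qed (use X in auto)
  \<comment> \<open>Letters vanish outside \<open>I\<close>, which keeps the alphabet
    finite.\<close>
  define A where "A = {a :: 'i \<Rightarrow> bool. \<forall>i. i \<notin> I \<longrightarrow> \<not> a i}"
  have "A \<subseteq> (\<lambda>S i. i \<in> S) ` Pow I"
  proof
    fix a assume "a \<in> A"
    then show "a \<in> (\<lambda>S i. i \<in> S) ` Pow I" by (intro image_eqI[of _ _ "{i. a i}"]) (auto simp: A_def)
  qed
  then have finA: "finite A" using I(1) by (meson finite_Pow_iff finite_imageI finite_subset)
  define bot :: "'i \<Rightarrow> bool" where "bot = (\<lambda>_. False)"
  have bot: "bot \<in> A" by (simp add: A_def bot_def)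
  define coord where "coord i b = map (case_option b (\<lambda>a :: 'i \<Rightarrow> bool. a i))" for i and b :: bool
  define pre where "pre = takeWhile (\<lambda>b :: ('i \<Rightarrow> bool) option. b \<noteq> None)"
  define pt where "pt t = prepend t (\<lambda>_. False)" for t
  have pt: "pt t \<in> cyl t" for t by (simp add: pt_def prepend_in_cyl)
  \<comment> \<open>The colour obtained when, above the tuple of nodes coded by \<open>p\<close>,
    coordinate \<open>i0\<close> splits and every other coordinate \<open>i\<close> continues with
    the bit \<open>e i\<close>. The points are mere representatives, since the nodes decide the
    colour.\<close>
  define val where "val p e = c (insert (\<Phi> i0 (pt (coord i0 False p @ [False]))) (insert (\<Phi> i0 (pt (coord i0 False p @ [True])))
    ((\<lambda>i. \<Phi> i (pt (coord i False p @ [e i]))) ` (I - {i0}))))" for p and e :: "'i \<Rightarrow> bool"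
  \<comment> \<open>A word is cut at its first variable, the place where two branches that differ in
    this block part. Recording the answer for every tuple \<open>e\<close> of next bits still leaves
    finitely many values.\<close>
  define col where "col w = {e \<in> A. val (pre w) e}" for w
  have "finite (col ` variable_words A)"
    by (rule finite_subset[of _ "Pow A"]) (use finA in \<open>auto simp: col_def\<close>)
  then obtain W \<kappa> where W: "\<And>n. W n \<in> variable_words A"
    and \<kappa>: "\<And>a n. (\<And>m. a m \<in> A) \<Longrightarrow> col (concat (map (\<lambda>m. subst_var (a m) (W m)) [0..<n]) @ W n) = \<kappa>"
    using variable_word_chain[of A col] finA bot by blast
  define N where "N n = (\<Sum>m<n. length (W m))" for n
  have "W n \<noteq> []" for n using W[of n] by (auto simp: variable_words_def)
  then have N_Suc: "N n < N (Suc n)" for n by (simp add: N_def)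
  then have Nn: "n \<le> N n" for n by (intro strict_mono_imp_increasing strict_monoI_Suc)
  \<comment> \<open>In coordinate \<open>i\<close>, block \<open>m\<close> is the word
    \<open>W m\<close> read in that coordinate with the bit \<open>y m\<close> in place of the
    variable. The block boundaries \<open>N n\<close> are common to all coordinates.\<close>
  define pref where "pref i y n = concat (map (\<lambda>m. coord i (y m) (W m)) [0..<n])" for i and y :: cantor and n
  have pref_Suc: "pref i y (Suc n) = pref i y n @ coord i (y n) (W n)" for i y n by (simp add: pref_def)
  have len: "length (pref i y n) = N n" for i y n
    by (induction n) (simp_all add: pref_Suc N_def coord_def pref_def)
  have nth: "pref i y n ! j = pref i y m ! j" if "m \<le> n" "j < N m" for i y n m j
    using that(1)
  proof (induction rule: dec_induct)
    case (step n)
    have "N m \<le> N n" using step(1) strict_mono_less_eq[OF strict_monoI_Suc[of N]] N_Suc by blast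
    then have "pref i y (Suc n) ! j = pref i y n ! j" using that(2) by (simp add: pref_Suc nth_append len)
    then show ?case using step.IH by simp
  qed simp
  define \<Psi> where "\<Psi> i y j = pref i y (Suc j) ! j" for i y j
  have stem\<Psi>: "stem (N n) (\<Psi> i y) = pref i y n" for n i y
  proof (rule nth_equalityI)
    fix j assume j: "j < length (stem (N n) (\<Psi> i y))"
    then have "j < N (Suc j)" using Nn[of "Suc j"] by simp
    then have "pref i y (Suc j) ! j = pref i y n ! j"
      using nth[of "Suc j" n j] nth[of n "Suc j" j] j by (cases "n \<le> Suc j") auto
    then show "stem (N n) (\<Psi> i y) ! j = pref i y n ! j" using j by (simp add: nth_stem \<Psi>_def)
  qed (simp add: len)
  have \<Psi>: "tree_emb (\<Psi> i)" for i
    unfolding tree_emb_def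
  proof (intro exI[of _ N] allI)
    fix n x y
    have co: "coord i b (W m) = coord i b' (W m) \<longleftrightarrow> b = b'" for b b' m
    proof
      obtain j where "j < length (W m)" "W m ! j = None"
        using W[of m] by (auto simp: variable_words_def in_set_conv_nth)
      moreover assume "coord i b (W m) = coord i b' (W m)"
      ultimately show "b = b'" unfolding coord_def by (metis nth_map option.simps(4))
    qed simp
    have "pref i x n = pref i y n \<longleftrightarrow> stem n x = stem n y"
    proof (induction n)
      case (Suc n)
      then show ?case by (simp add: pref_Suc stem_Suc co len append_eq_append_conv)
    qed (simp add: pref_def)
    then show "stem (N n) (\<Psi> i x) = stem (N n) (\<Psi> i y) \<longleftrightarrow> stem n x = stem n y" by (simp only: stem\<Psi>)
  qed
  define S where "S i = (\<lambda>y n. n mod 2 = (if i = i0 then 0 else 1 :: nat) \<and> y (n div 2))" for i and y :: cantor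
  have S: "tree_emb (S i)" for i unfolding S_def by (rule tree_emb_even_odd) simp
  define Y where "Y i = range (\<lambda>y. \<Phi> i (\<Psi> i (S i y)))" for i
  have const: "c (insert x (insert y (g ` (I - {i0})))) = (bot \<in> \<kappa>)"
    if xy: "x \<in> Y i0" "y \<in> Y i0" "x \<noteq> y" and g: "\<And>i. i \<in> I \<Longrightarrow> g i \<in> Y i" for x y g
  proof -
    obtain u' v' where uv': "x = \<Phi> i0 (\<Psi> i0 (S i0 u'))" "y = \<Phi> i0 (\<Psi> i0 (S i0 v'))"
      using xy(1,2) unfolding Y_def by blast
    have "S i0 u' \<noteq> S i0 v'" using xy(3) uv' by auto
    then have "\<exists>n. S i0 u' n \<noteq> S i0 v' n" by blast
    then have "\<exists>n. S i0 u' n \<noteq> S i0 v' n \<and> (\<forall>m<n. S i0 u' m = S i0 v' m)"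
      using exists_least_iff[of "\<lambda>n. S i0 u' n \<noteq> S i0 v' n"] by simp
    then obtain n where n: "S i0 u' n \<noteq> S i0 v' n" "\<And>m. m < n \<Longrightarrow> S i0 u' m = S i0 v' m" by blast
    \<comment> \<open>The two points are renamed so that \<open>u\<close> carries
      \<open>False\<close> and \<open>v\<close> carries \<open>True\<close> at their first
      difference \<open>n\<close>.\<close>
    define u v where "u = (if S i0 u' n then v' else u')" and "v = (if S i0 u' n then u' else v')"
    have uv: "insert x (insert y R) = insert (\<Phi> i0 (\<Psi> i0 (S i0 u))) (insert (\<Phi> i0 (\<Psi> i0 (S i0 v))) R)" for R
      unfolding u_def v_def uv' by auto
    have un: "\<not> S i0 u n" "S i0 v n" "\<And>m. m < n \<Longrightarrow> S i0 u m = S i0 v m"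
      using n unfolding u_def v_def by (auto split: if_splits)
    \<comment> \<open>Coordinate \<open>i0\<close> can have the bit \<open>True\<close> only at even
      positions and the others only at odd ones. So all other coordinates have \<open>False\<close>
      at \<open>n\<close>, which is why the colour is read off at \<open>bot\<close>.\<close>
    have evn: "n mod 2 = 0" using un(2) by (simp add: S_def)
    have "\<forall>i\<in>I. \<exists>y. g i = \<Phi> i (\<Psi> i (S i y))" using g unfolding Y_def by blast
    from bchoice[OF this] obtain h where h: "\<And>i. i \<in> I \<Longrightarrow> g i = \<Phi> i (\<Psi> i (S i (h i)))" by blast
    define z where "z i = (if i = i0 then S i0 u else S i (h i))" for i
    have zn: "\<not> z i n" for i using un(1) evn by (simp add: z_def S_def)
    \<comment> \<open>The letters gather the bits of all coordinates, so \<open>w0\<close> describes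
      every branch up to block \<open>n\<close>, and \<open>w0 @ W n\<close> is a word of the
      monochromatic chain.\<close>
    define a where "a m = (\<lambda>i. i \<in> I \<and> z i m)" for m
    have aA: "a m \<in> A" for m by (simp add: a_def A_def)
    define w0 where "w0 = concat (map (\<lambda>m. subst_var (a m) (W m)) [0..<n])"
    have col: "col (w0 @ W n) = \<kappa>" unfolding w0_def by (rule \<kappa>) (rule aA)
    define p where "p = pre (w0 @ W n)"
    have w0: "None \<notin> set w0" by (auto simp: w0_def subst_var_def split: option.splits)
    have p: "p = w0 @ pre (W n)" unfolding p_def pre_def using w0 by (intro takeWhile_append2) metis
    have W_split: "\<exists>r. W n = pre (W n) @ None # r"
    proof -
      have "dropWhile (\<lambda>b. b \<noteq> None) (W n) \<noteq> []" using W[of n] by (auto simp: variable_words_def)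
      then obtain b r where br: "dropWhile (\<lambda>b. b \<noteq> None) (W n) = b # r" by (meson neq_Nil_conv)
      moreover then have "b = None" using hd_dropWhile[of "\<lambda>b. b \<noteq> None" "W n"] by simp
      ultimately show ?thesis unfolding pre_def by (metis takeWhile_dropWhile_id)
    qed
    have "None \<notin> set (pre (W n))" unfolding pre_def by (auto dest: set_takeWhileD)
    then have co_pre: "coord i b (pre (W n)) = coord i False (pre (W n))" for i b
      unfolding coord_def by (auto split: option.splits)
    have co_w0: "coord i b w0 = pref i y n" if "i \<in> I" "\<And>m. m < n \<Longrightarrow> y m = z i m" for i b y
    proof -
      have "coord i b (subst_var (a m) (W m)) = coord i (y m) (W m)" if "m < n" for m
        using \<open>i \<in> I\<close> \<open>\<And>m. m < n \<Longrightarrow> y m = z i m\<close>[OF that]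
        by (auto simp: coord_def subst_var_def a_def split: option.splits)
      then have "map (\<lambda>m. coord i b (subst_var (a m) (W m))) [0..<n] = map (\<lambda>m. coord i (y m) (W m)) [0..<n]"
        by simp
      moreover have "coord i b w0 = concat (map (\<lambda>m. coord i b (subst_var (a m) (W m))) [0..<n])"
        by (simp add: w0_def coord_def map_concat comp_def)
      ultimately show ?thesis unfolding pref_def by (simp only:)
    qed
    \<comment> \<open>Block \<open>n\<close> begins with the part of \<open>W n\<close> before its
      first variable, which is the same for every choice of the bit, and continues with the bit
      \<open>y n\<close> itself.\<close>
    have mem: "\<Psi> i y \<in> cyl (coord i False p @ [y n])" if "i \<in> I" "\<And>m. m < n \<Longrightarrow> y m = z i m" for i y
    proof -
      obtain r where "W n = pre (W n) @ None # r" using W_split by blast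
      then have "coord i (y n) (W n) = coord i (y n) (pre (W n)) @ y n # coord i (y n) r"
        unfolding coord_def by (metis list.simps(9) map_append option.simps(4))
      then have "pref i y (Suc n) = (coord i False p @ [y n]) @ coord i (y n) r"
        using co_w0[OF that, of False] co_pre[of i "y n"] by (simp add: pref_Suc p) (simp add: coord_def)
      then have "\<Psi> i y \<in> cyl ((coord i False p @ [y n]) @ coord i (y n) r)"
        using stem\<Psi>[of "Suc n" i y] in_cyl_stem[of "\<Psi> i y" "N (Suc n)"] by simp
      then show ?thesis using cyl_append_subset by blast
    qed
    define K where "K = insert (i0, coord i0 False p @ [False]) (insert (i0, coord i0 False p @ [True])
      ((\<lambda>i. (i, coord i False p @ [False])) ` (I - {i0})))"
    define l where "l = Suc (length p)"
    have "card K = Suc (card I)"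
    proof -
      have "card ((\<lambda>i. (i, coord i False p @ [False])) ` (I - {i0})) = card I - 1"
        using I by (subst card_image) (auto simp: inj_on_def)
      moreover have "card I > 0" using I card_gt_0_iff by blast
      ultimately show ?thesis using I(1) unfolding K_def by (subst card_insert_disjoint; auto)+
    qed
    then have "K \<in> [I \<times> {t. length t = l}]\<^bsup>Suc (card I)\<^esup>"
      using I unfolding nsets_def K_def l_def by (auto simp: coord_def)
    then have dec: "decided c K (\<lambda>(i, t). \<Phi> i ` cyl t)" using \<Phi>(3)[of l] unfolding Q_def by blast
    \<comment> \<open>\<open>G\<close> and \<open>G'\<close> are two transversals of the same
      decided configuration: the given points, and the representatives used in
      \<open>val\<close>.\<close>
    define G where "G = (\<lambda>(i, t). if i = i0 then (if t = coord i0 False p @ [False] then \<Phi> i0 (\<Psi> i0 (S i0 u)) else \<Phi> i0 (\<Psi> i0 (S i0 v)))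
      else \<Phi> i (\<Psi> i (S i (h i))))"
    define G' where "G' = (\<lambda>(i, t). \<Phi> i (pt t))"
    have "c (G ` K) = c (G' ` K)"
    proof (rule decidedD[OF dec])
      fix a assume a: "a \<in> K"
      then show "G' a \<in> (case a of (i, t) \<Rightarrow> \<Phi> i ` cyl t)" using pt by (auto simp: G'_def)
      have 1: "\<Psi> i0 (S i0 u) \<in> cyl (coord i0 False p @ [False])"
        using mem[OF I(2), of "S i0 u"] un(1) by (simp add: z_def)
      have 2: "\<Psi> i0 (S i0 v) \<in> cyl (coord i0 False p @ [True])"
        using mem[OF I(2), of "S i0 v"] un by (simp add: z_def)
      have 3: "\<Psi> i (S i (h i)) \<in> cyl (coord i False p @ [False])" if "i \<in> I - {i0}" for i
        using mem[of i "S i (h i)"] that zn[of i] by (simp add: z_def)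
      show "G a \<in> (case a of (i, t) \<Rightarrow> \<Phi> i ` cyl t)" using a 1 2 3 by (auto simp: K_def G_def)
    qed
    moreover have "G ` K = insert x (insert y (g ` (I - {i0})))"
    proof -
      have "(\<lambda>i. G (i, coord i False p @ [False])) ` (I - {i0}) = g ` (I - {i0})"
        by (intro image_cong) (auto simp: G_def h)
      then show ?thesis unfolding uv K_def by (simp add: image_image) (simp add: G_def)
    qed
    moreover have "c (G' ` K) = val p bot"
      unfolding K_def val_def by (simp add: image_image G'_def bot_def)
    moreover have "bot \<in> \<kappa> \<longleftrightarrow> val p bot" using bot unfolding col[symmetric] col_def p_def by simp
    ultimately show ?thesis by simp
  qed
  have sub: "tree_perfect (Y i)" "Y i \<subseteq> X i" if "i \<in> I" for i
  proof -
    show "tree_perfect (Y i)" unfolding Y_def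
      by (intro tree_perfect_range tree_emb_comp[OF \<Phi>(1)[OF that]] tree_emb_comp[OF \<Psi> S])
    show "Y i \<subseteq> X i" using \<Phi>(2)[OF that] by (auto simp: Y_def)
  qed
  show ?thesis
  proof (intro exI[of _ Y] exI[of _ "bot \<in> \<kappa>"] conjI ballI allI impI)
    fix x y g assume "x \<in> Y i0" "y \<in> Y i0" "x \<noteq> y" "\<forall>i\<in>I. g i \<in> Y i"
    then show "c (insert x (insert y (g ` (I - {i0})))) = (bot \<in> \<kappa>)" by (intro const) blast+
  qed (rule sub, assumption)+
qed

section \<open>Colourings that depend only on the last splitting node\<close>

lemma continuous_colouring_tree_emb:
  assumes c: "continuous_colouring k c" and \<Phi>: "tree_emb \<Phi>"
  shows "continuous_colouring k (\<lambda>G. c (\<Phi> ` G))"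
  unfolding continuous_colouring_def
proof
  fix G :: "cantor set" assume G: "G \<in> [UNIV]\<^bsup>k\<^esup>"
  have ns: "\<Phi> ` G \<in> [UNIV]\<^bsup>k\<^esup>" if "G \<in> [UNIV]\<^bsup>k\<^esup>" for G
    using that inj_on_subset[OF tree_emb_inj[OF \<Phi>], of G] by (auto simp: in_nsets_UNIV card_image)
  obtain n where n: "inj_on (stem n) (\<Phi> ` G)"
    "\<And>G'. G' \<in> [UNIV]\<^bsup>k\<^esup> \<Longrightarrow> stem n ` G' = stem n ` \<Phi> ` G \<Longrightarrow> c G' = c (\<Phi> ` G)"
    using c ns[OF G] unfolding continuous_colouring_def by meson
  obtain m where m: "n \<le> m" "inj_on (stem m) G" using finite_separated[of G n] G by (auto simp: in_nsets_UNIV)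
  show "\<exists>n. inj_on (stem n) G \<and> (\<forall>G'\<in>[UNIV]\<^bsup>k\<^esup>. stem n ` G' = stem n ` G \<longrightarrow> c (\<Phi> ` G') = c (\<Phi> ` G))"
  proof (intro exI[of _ m] conjI m(2) ballI impI)
    fix G' :: "cantor set" assume G': "G' \<in> [UNIV]\<^bsup>k\<^esup>" and eq: "stem m ` G' = stem m ` G"
    have sub: "stem n ` \<Phi> ` A \<subseteq> stem n ` \<Phi> ` B" if "stem m ` A = stem m ` B" for A B
    proof
      fix t assume "t \<in> stem n ` \<Phi> ` A"
      then obtain x where x: "x \<in> A" "t = stem n (\<Phi> x)" by blast
      then obtain y where y: "y \<in> B" "stem m x = stem m y" using \<open>stem m ` A = stem m ` B\<close> by (metis image_iff)
      have "stem n (\<Phi> x) = stem n (\<Phi> y)"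
        by (rule tree_emb_cont[OF \<Phi> stem_eq_mono[OF y(2) m(1)]])
      then show "t \<in> stem n ` \<Phi> ` B" using x y by blast
    qed
    show "c (\<Phi> ` G') = c (\<Phi> ` G)"
      by (rule n(2)[OF ns[OF G'] subset_antisym[OF sub[OF eq] sub[OF eq[symmetric]]]])
  qed
qed

text \<open>\<open>split_homogeneous\<close> treats one set \<open>T\<close> of nodes with one
  splitting node \<open>t\<close>. Each level has finitely many such pairs, and homogeneity passes
  to smaller pieces, so a fusion achieves it for all levels in a single embedding. The points
  \<open>x\<close> and \<open>y\<close> may part arbitrarily far above \<open>t\<close>.\<close>

lemma end_homogeneous_embedding:
  assumes c: "continuous_colouring (Suc k) c"
  obtains \<Phi> where "tree_emb \<Phi>"
    "\<And>l T t x y g x' y' g'. T \<in> [{t. length t = l}]\<^bsup>k\<^esup> \<Longrightarrow> t \<in> T \<Longrightarrow>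
      x \<in> cyl t \<Longrightarrow> y \<in> cyl t \<Longrightarrow> x \<noteq> y \<Longrightarrow> (\<And>s. s \<in> T \<Longrightarrow> g s \<in> cyl s) \<Longrightarrow>
      x' \<in> cyl t \<Longrightarrow> y' \<in> cyl t \<Longrightarrow> x' \<noteq> y' \<Longrightarrow> (\<And>s. s \<in> T \<Longrightarrow> g' s \<in> cyl s) \<Longrightarrow>
      c (\<Phi> ` insert x (insert y (g ` (T - {t})))) = c (\<Phi> ` insert x' (insert y' (g' ` (T - {t}))))"
proof -
  define R where "R p Y \<longleftrightarrow> (\<exists>\<epsilon>. \<forall>x\<in>Y (snd p). \<forall>y\<in>Y (snd p). \<forall>g. x \<noteq> y \<longrightarrow> (\<forall>s\<in>fst p. g s \<in> Y s) \<longrightarrow>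
      c (insert x (insert y (g ` (fst p - {snd p})))) = \<epsilon>)"
    for p :: "bool list set \<times> bool list" and Y :: "bool list \<Rightarrow> cantor set"
  define \<T> where "\<T> l = Sigma ([{t :: bool list. length t = l}]\<^bsup>k\<^esup>) (\<lambda>T. T)" for l
  have finT: "finite (\<T> l)" for l
    unfolding \<T>_def using finite_imp_finite_nsets[OF finite_lists_length, of l k]
    by (rule finite_SigmaI) (simp add: nsets_def)
  have R_mono: "R p U" if p: "p \<in> \<T> l" and Y: "R p Y" "\<And>t. length t = l \<Longrightarrow> U t \<subseteq> Y t" for p l U Y
  proof -
    have "fst p \<subseteq> {t. length t = l}" using p by (auto simp: \<T>_def nsets_def)
    then have sub: "s \<in> fst p \<Longrightarrow> U s \<subseteq> Y s" for s using Y(2) by blast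
    have sp: "snd p \<in> fst p" using p by (auto simp: \<T>_def)
    obtain \<epsilon> where \<epsilon>: "\<And>x y g. x \<in> Y (snd p) \<Longrightarrow> y \<in> Y (snd p) \<Longrightarrow> x \<noteq> y \<Longrightarrow> (\<forall>s\<in>fst p. g s \<in> Y s) \<Longrightarrow>
      c (insert x (insert y (g ` (fst p - {snd p})))) = \<epsilon>" using Y(1) unfolding R_def by metis
    show ?thesis unfolding R_def
    proof (intro exI[of _ \<epsilon>] ballI allI impI)
      fix x y g assume "x \<in> U (snd p)" "y \<in> U (snd p)" "x \<noteq> y" "\<forall>s\<in>fst p. g s \<in> U s"
      then show "c (insert x (insert y (g ` (fst p - {snd p})))) = \<epsilon>"
        using sub sp by (intro \<epsilon>) blast+
    qed
  qed
  have R_dense: "\<exists>U. (\<forall>t\<in>{t. length t = l}. U t \<in> {X. tree_perfect X} \<and> U t \<subseteq> V t) \<and> R p U"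
    if p: "p \<in> \<T> l" and V: "\<And>t. t \<in> {t. length t = l} \<Longrightarrow> V t \<in> {X. tree_perfect X}" "disjoint_family_on V {t. length t = l}"
    for p l V
  proof -
    obtain T t where Tt: "p = (T, t)" "T \<subseteq> {t. length t = l}" "finite T" "card T = k" "t \<in> T"
      using p by (auto simp: \<T>_def nsets_def)
    have cT: "continuous_colouring (Suc (card T)) c" using c Tt(4) by simp
    obtain Y \<epsilon> where Y: "\<forall>s\<in>T. tree_perfect (Y s) \<and> Y s \<subseteq> V s"
      "\<forall>x\<in>Y t. \<forall>y\<in>Y t. \<forall>g. x \<noteq> y \<longrightarrow> (\<forall>s\<in>T. g s \<in> Y s) \<longrightarrow> c (insert x (insert y (g ` (T - {t})))) = \<epsilon>"
    proof -
      have "\<exists>Y \<epsilon>. (\<forall>s\<in>T. tree_perfect (Y s) \<and> Y s \<subseteq> V s) \<and>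
        (\<forall>x\<in>Y t. \<forall>y\<in>Y t. \<forall>g. x \<noteq> y \<longrightarrow> (\<forall>s\<in>T. g s \<in> Y s) \<longrightarrow> c (insert x (insert y (g ` (T - {t})))) = \<epsilon>)"
        by (rule split_homogeneous[OF Tt(3,5) cT _ disjoint_family_on_mono[OF Tt(2) V(2)]])
          (use V(1) Tt(2) in blast)
      then show thesis by (elim exE conjE) (rule that)
    qed
    define U where "U s = (if s \<in> T then Y s else V s)" for s
    have "R p U" unfolding R_def Tt fst_conv snd_conv using Y(2) Tt(5)
      by (intro exI[of _ \<epsilon>]) (simp add: U_def)
    then show ?thesis using Y(1) V(1) by (intro exI[of _ U]) (simp add: U_def)
  qed
  define Q where "Q l Y \<longleftrightarrow> (\<forall>p\<in>\<T> l. R p (Y ()))" for l and Y :: "unit \<Rightarrow> bool list \<Rightarrow> cantor set"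
  obtain \<Phi> where \<Phi>: "\<And>i. i \<in> UNIV \<Longrightarrow> tree_emb (\<Phi> i)" "\<And>i. i \<in> UNIV \<Longrightarrow> range (\<Phi> i) \<subseteq> UNIV"
    "\<And>n. Q n (\<lambda>i t. \<Phi> i ` cyl t)"
  proof (rule fusion[OF fusion_class_tree_perfect, of UNIV "\<lambda>_ :: unit. UNIV" Q])
    show "Q n Z" if "Q n Y" "\<And>i t. i \<in> UNIV \<Longrightarrow> length t = n \<Longrightarrow> Z i t \<subseteq> Y i t" for n Y Z
      unfolding Q_def
    proof
      fix p assume p: "p \<in> \<T> n"
      show "R p (Z ())"
        by (rule R_mono[OF p, of "Y ()"]) (use that p in \<open>simp_all add: Q_def\<close>)
    qed
    show "\<exists>Z. Q n Z \<and> (\<forall>i\<in>UNIV. \<forall>t. length t = n \<longrightarrow> Z i t \<in> {X. tree_perfect X} \<and> Z i t \<subseteq> Y i t)"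
      if Y: "\<And>i t. i \<in> UNIV \<Longrightarrow> length t = n \<Longrightarrow> Y i t \<in> {X. tree_perfect X}"
        "disjoint_family_on (\<lambda>(i, t). Y i t) (UNIV \<times> {t. length t = n})"
      for n and Y :: "unit \<Rightarrow> bool list \<Rightarrow> cantor set"
    proof -
      have dY: "disjoint_family_on (Y ()) {t. length t = n}"
        using Y(2) by (auto simp: disjoint_family_on_def)
      have "\<exists>U. (\<forall>t\<in>{t. length t = n}. U t \<in> {X. tree_perfect X} \<and> U t \<subseteq> Y () t) \<and> (\<forall>p\<in>\<T> n. R p U)"
      proof (rule shrink_finitely_often[OF finT])
        show "R p U" if "p \<in> \<T> n" "R p V" "\<And>t. t \<in> {t. length t = n} \<Longrightarrow> U t \<subseteq> V t" for p U V
          by (rule R_mono[OF that(1,2)]) (use that(3) in simp)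
      next
        show "Y () t \<in> {X. tree_perfect X}" if "t \<in> {t. length t = n}" for t using Y(1) that by simp
      next
        show "\<exists>U. (\<forall>t\<in>{t. length t = n}. U t \<in> {X. tree_perfect X} \<and> U t \<subseteq> V t) \<and> R p U"
          if "p \<in> \<T> n" "\<And>t. t \<in> {t. length t = n} \<Longrightarrow> V t \<in> {X. tree_perfect X}" "disjoint_family_on V {t. length t = n}"
          for p V by (rule R_dense[OF that])
      qed (rule dY)
      then obtain U where "\<forall>t\<in>{t. length t = n}. U t \<in> {X. tree_perfect X} \<and> U t \<subseteq> Y () t" "\<forall>p\<in>\<T> n. R p U" by blast
      then show ?thesis by (intro exI[of _ "\<lambda>_. U"]) (simp add: Q_def)
    qed
    show "UNIV \<in> {X. tree_perfect X}" using tree_perfect_cyl[of "[]"] by simp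
    show "disjoint_family_on (\<lambda>_ :: unit. UNIV :: cantor set) UNIV" by (simp add: disjoint_family_on_def)
  qed (rule that, assumption+)
  show thesis
  proof (rule that)
    show emb: "tree_emb (\<Phi> ())" by (rule \<Phi>(1)) simp
    fix l T t x y g x' y' g'
    assume T: "T \<in> [{t. length t = l}]\<^bsup>k\<^esup>" "t \<in> T"
      and 1: "x \<in> cyl t" "y \<in> cyl t" "x \<noteq> y" "\<And>s. s \<in> T \<Longrightarrow> g s \<in> cyl s"
      and 2: "x' \<in> cyl t" "y' \<in> cyl t" "x' \<noteq> y'" "\<And>s. s \<in> T \<Longrightarrow> g' s \<in> cyl s"
    have "R (T, t) (\<lambda>t. \<Phi> () ` cyl t)" using \<Phi>(3)[of l] T by (simp add: Q_def \<T>_def)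
    then obtain \<epsilon> where \<epsilon>: "\<And>x y g. x \<in> \<Phi> () ` cyl t \<Longrightarrow> y \<in> \<Phi> () ` cyl t \<Longrightarrow> x \<noteq> y \<Longrightarrow>
      (\<forall>s\<in>T. g s \<in> \<Phi> () ` cyl s) \<Longrightarrow> c (insert x (insert y (g ` (T - {t})))) = \<epsilon>"
      unfolding R_def fst_conv snd_conv by metis
    have "c (\<Phi> () ` insert x (insert y (g ` (T - {t})))) = \<epsilon>"
      if "x \<in> cyl t" "y \<in> cyl t" "x \<noteq> y" "\<And>s. s \<in> T \<Longrightarrow> g s \<in> cyl s" for x y g
      using \<epsilon>[of "\<Phi> () x" "\<Phi> () y" "\<lambda>s. \<Phi> () (g s)"] that injD[OF tree_emb_inj[OF emb], of x y]
      by (auto simp: image_image)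
    from this[OF 1] this[OF 2] show "c (\<Phi> () ` insert x (insert y (g ` (T - {t})))) =
      c (\<Phi> () ` insert x' (insert y' (g' ` (T - {t}))))" by simp
  qed
qed

text \<open>With \<open>Suc k\<close> points on \<open>k\<close> nodes, removing \<open>y\<close>
  makes \<open>stem n\<close> injective, and \<open>g\<close> is its inverse. This brings
  \<open>G\<close> into the form treated by \<open>end_homogeneous_embedding\<close>.\<close>

lemma split_set_representation:
  assumes G: "G \<in> [UNIV]\<^bsup>Suc k\<^esup>" "card (stem n ` G) = k" and xy: "x \<in> G" "y \<in> G" "x \<noteq> y" "stem n x = stem n y"
  obtains g where "G = insert x (insert y (g ` (stem n ` G - {stem n x})))" "\<And>s. s \<in> stem n ` G \<Longrightarrow> g s \<in> cyl s"
proof -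
  let ?H = "G - {y}"
  have "stem n z \<in> stem n ` ?H" if "z \<in> G" for z
  proof (cases "z = y")
    case True
    then show ?thesis using xy by (intro image_eqI[of _ _ x]) simp_all
  qed (use that in blast)
  then have im: "stem n ` ?H = stem n ` G" by blast
  have H: "finite ?H" "card ?H = k" using G(1) xy(2) by (auto simp: in_nsets_UNIV)
  then have inj: "inj_on (stem n) ?H" using im G(2) by (intro eq_card_imp_inj_on) simp_all
  define g where "g = inv_into ?H (stem n)"
  have g: "g s \<in> ?H" "stem n (g s) = s" if "s \<in> stem n ` G" for s
    using that im inv_into_into[of s "stem n" ?H] f_inv_into_f[of s "stem n" ?H] by (auto simp: g_def)
  have gz: "g (stem n z) = z" if "z \<in> ?H" for z unfolding g_def using inj that by (rule inv_into_f_f)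
  show thesis
  proof (rule that)
    show "g s \<in> cyl s" if s: "s \<in> stem n ` G" for s
    proof -
      have "length s = n" using s by auto
      then show ?thesis using g(2)[OF s] by (simp add: cyl_def)
    qed
    show "G = insert x (insert y (g ` (stem n ` G - {stem n x})))"
    proof (intro subset_antisym subsetI)
      fix z assume z: "z \<in> G"
      show "z \<in> insert x (insert y (g ` (stem n ` G - {stem n x})))"
      proof (cases "z = x \<or> z = y")
        case False
        then have "stem n z \<noteq> stem n x" using inj_onD[OF inj, of z x] z xy by auto
        then show ?thesis using gz[of z] z False by (metis DiffI image_eqI insert_iff singletonD)
      qed auto
    qed (use g(1) xy in auto)
  qed
qed

section \<open>A numbering of the binary tree and an embedding with one splitting node per
  level\<close>

fun node_code :: "bool list \<Rightarrow> nat" where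
  "node_code [] = 1"
| "node_code (b # t) = 2 * node_code t + of_bool b"

text \<open>A node is read as a binary number with its head as least significant digit and a leading
  1 contributed by the empty node. In particular, shorter nodes precede longer ones.\<close>

lemma node_code_bounds: "2 ^ length t \<le> node_code t \<and> node_code t < 2 ^ Suc (length t)"
  by (induction t) auto

lemma node_code_length:
  assumes "node_code s < 2 ^ n" shows "length s < n"
proof -
  have "(2::nat) ^ length s < 2 ^ n" using assms node_code_bounds[of s] by linarith
  then show ?thesis by simp
qed

lemma node_code_Cons_gt_1: "1 < node_code (b # t)"
proof -
  have "2 \<le> node_code (b # t)"
    by (rule order_trans[OF _ conjunct1[OF node_code_bounds]]) simp
  then show ?thesis by linarith
qed

lemma node_code_inj: "node_code s = node_code t \<Longrightarrow> s = t"
proof (induction s arbitrary: t)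
  case Nil
  then show ?case
  proof (cases t)
    case (Cons c u)
    then show ?thesis using Nil node_code_Cons_gt_1[of c u] by simp
  qed simp
next
  case (Cons b s)
  obtain c u where t: "t = c # u"
    using Cons.prems node_code_Cons_gt_1[of b s] by (cases t) auto
  have "2 * node_code s + of_bool b = 2 * node_code u + of_bool c" using Cons.prems t by simp
  then have "node_code s = node_code u" "b = c" by (cases b; cases c; simp; presburger)+
  then show ?case using Cons.IH t by simp
qed

text \<open>The splitting nodes of the image of the following embedding lie on pairwise different
  levels.\<close>

definition spread :: "cantor \<Rightarrow> cantor" where
  "spread x = (\<lambda>j. \<exists>n. node_code (stem n x) = j \<and> x n)"

lemma spread_node_code: "spread x (node_code (stem n x)) = x n"
proof -
  have "m = n" if "node_code (stem m x) = node_code (stem n x)" for m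
    using node_code_inj[OF that] by (metis length_stem)
  then show ?thesis unfolding spread_def by blast
qed

text \<open>Bit \<open>j\<close> can only come from the node numbered \<open>j\<close>. If
  \<open>j < 2 ^ n\<close>, this node is shorter than \<open>n\<close>; if \<open>j\<close> is below
  the number of \<open>stem n x\<close>, it has length at most \<open>n\<close> and differs from
  \<open>stem n x\<close>. So a node responsible for a \<open>True\<close> is shorter than
  \<open>n\<close>, and the first \<open>n\<close> bits decide.\<close>

lemma spread_eq_below:
  assumes "stem n x = stem n y" "j < 2 ^ n \<or> j < node_code (stem n x)"
  shows "spread x j = spread y j"
proof -
  have "spread v j" if eq: "stem n u = stem n v" "j < 2 ^ n \<or> j < node_code (stem n u)" and sj: "spread u j" for u v
  proof -
    obtain m where m: "node_code (stem m u) = j" "u m" using sj unfolding spread_def by blast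
    have "m < n"
    proof (cases "j < 2 ^ n")
      case True
      then show ?thesis using node_code_length[of "stem m u" n] m(1) by simp
    next
      case False
      then have j: "j < node_code (stem n u)" using eq(2) by blast
      then have "j < 2 ^ Suc n" using node_code_bounds[of "stem n u"] by simp
      then have "m \<le> n" using node_code_length[of "stem m u" "Suc n"] m(1) by simp
      moreover have "m \<noteq> n" using j m(1) by blast
      ultimately show ?thesis by simp
    qed
    then have "stem m u = stem m v" "u m = v m" using eq(1) by (simp_all add: stem_eq_iff)
    then show ?thesis unfolding spread_def using m by metis
  qed
  from this[OF assms] this[OF assms(1)[symmetric]] assms show ?thesis by metis
qed

lemma tree_emb_spread: "tree_emb spread"
  unfolding tree_emb_def
proof (intro exI[of _ "\<lambda>n. 2 ^ n"] allI iffI)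
  fix n x y assume "stem n x = stem n y"
  then show "stem (2 ^ n) (spread x) = stem (2 ^ n) (spread y)"
    using spread_eq_below unfolding stem_eq_iff[of "2 ^ n"] by blast
next
  fix n x y assume eq: "stem (2 ^ n) (spread x) = stem (2 ^ n) (spread y)"
  have "stem m x = stem m y" if "m \<le> n" for m
    using that
  proof (induction m)
    case (Suc m)
    then have "stem m x = stem m y" by simp
    moreover have "node_code (stem m x) < 2 ^ n"
    proof -
      have "(2::nat) ^ Suc m \<le> 2 ^ n" using Suc.prems by (intro power_increasing) auto
      then show ?thesis using node_code_bounds[of "stem m x"] by simp
    qed
    ultimately have "x m = y m"
      using eq spread_node_code[of x m] spread_node_code[of y m] unfolding stem_eq_iff[of "2 ^ n"] by simp
    then show ?case using \<open>stem m x = stem m y\<close> by (simp add: stem_Suc)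
  qed simp
  then show "stem n x = stem n y" by simp
qed

text \<open>Of two points that differ at \<open>l\<close>, one has the bit \<open>True\<close>
  there, so the node numbered \<open>l\<close> lies on its branch. That node is the same for both
  pairs, and it determines all bits below \<open>l\<close>.\<close>

lemma spread_split_unique:
  assumes "stem l (spread u) = stem l (spread v)" "spread u l \<noteq> spread v l"
    "stem l (spread u') = stem l (spread v')" "spread u' l \<noteq> spread v' l"
  shows "stem l (spread u) = stem l (spread u')"
proof -
  obtain w where w: "w = u \<or> w = v" "spread w l" using assms(2) by blast
  obtain w' where w': "w' = u' \<or> w' = v'" "spread w' l" using assms(4) by blast
  obtain n where n: "node_code (stem n w) = l" using w(2) unfolding spread_def by blast
  obtain n' where n': "node_code (stem n' w') = l" using w'(2) unfolding spread_def by blast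
  have "stem n w = stem n' w'" using n n' by (intro node_code_inj) simp
  then have "n = n'" by (metis length_stem)
  then have eq: "stem n w = stem n w'" using \<open>stem n w = stem n' w'\<close> by simp
  have "stem l (spread w) = stem l (spread w')"
    unfolding stem_eq_iff using spread_eq_below[OF eq] n by blast
  then show ?thesis using w(1) w'(1) assms(1,3) by metis
qed

section \<open>The dichotomy for continuous colourings\<close>

text \<open>This is the sum of the binomial coefficients \<open>n choose i\<close> over
  \<open>i < j\<close>, the number known from the Sauer-Shelah lemma.\<close>

fun subtree_bound :: "nat \<Rightarrow> nat \<Rightarrow> nat" where
  "subtree_bound 0 n = 0"
| "subtree_bound (Suc j) n = 1 + (\<Sum>m<n. subtree_bound j m)"

lemma subtree_bound_le: "subtree_bound j n \<le> (n + 1) ^ j"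
proof (induction j arbitrary: n)
  case (Suc j)
  have "(\<Sum>m<n. subtree_bound j m) \<le> (\<Sum>m<n. (n + 1) ^ j)"
  proof (rule sum_mono)
    fix m assume "m \<in> {..<n}"
    then have "(m + 1) ^ j \<le> (n + 1) ^ j" by (intro power_mono) auto
    then show "subtree_bound j m \<le> (n + 1) ^ j" using Suc.IH[of m] by simp
  qed
  also have "\<dots> = n * (n + 1) ^ j" by simp
  finally have "1 + (\<Sum>m<n. subtree_bound j m) \<le> (n + 1) ^ j + n * (n + 1) ^ j"
    using one_le_power[of "n + 1" j] by linarith
  then show ?case by simp
qed simp

text \<open>For \<open>J\<close> of size \<open>k\<close>, the sets \<open>G\<close> are those that
  double one node of \<open>J\<close>, with the splitting at any height above level
  \<open>n\<close>. For end-homogeneous \<open>d\<close> the choice of \<open>n\<close> does not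
  matter, by \<open>derived_colouring_iff\<close>.\<close>

definition derived_colouring :: "nat \<Rightarrow> (cantor set \<Rightarrow> bool) \<Rightarrow> cantor set \<Rightarrow> bool" where
  "derived_colouring k d J \<longleftrightarrow> (\<exists>n. inj_on (stem n) J \<and>
     (\<forall>G\<in>[UNIV]\<^bsup>Suc k\<^esup>. stem n ` G = stem n ` J \<longrightarrow> d G))"

text \<open>For \<open>Suc k\<close> points, having \<open>k\<close> stems of length
  \<open>n\<close> means that exactly one node carries two of them, namely the common stem of
  \<open>x\<close> and \<open>y\<close>.\<close>

definition end_homogeneous :: "nat \<Rightarrow> (cantor set \<Rightarrow> bool) \<Rightarrow> bool" where
  "end_homogeneous k d \<longleftrightarrow> (\<forall>n. \<forall>G\<in>[UNIV]\<^bsup>Suc k\<^esup>. \<forall>G'\<in>[UNIV]\<^bsup>Suc k\<^esup>. \<forall>x\<in>G. \<forall>y\<in>G. \<forall>x'\<in>G'. \<forall>y'\<in>G'.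
     card (stem n ` G) = k \<longrightarrow> stem n ` G = stem n ` G' \<longrightarrow> x \<noteq> y \<longrightarrow> x' \<noteq> y' \<longrightarrow>
     stem n x = stem n y \<longrightarrow> stem n x' = stem n x \<longrightarrow> stem n y' = stem n x \<longrightarrow> d G = d G')"

lemma end_homogeneousD:
  assumes "end_homogeneous k d" "G \<in> [UNIV]\<^bsup>Suc k\<^esup>" "G' \<in> [UNIV]\<^bsup>Suc k\<^esup>" "card (stem n ` G) = k"
    "stem n ` G = stem n ` G'" "x \<in> G" "y \<in> G" "x \<noteq> y" "stem n x = stem n y"
    "x' \<in> G'" "y' \<in> G'" "x' \<noteq> y'" "stem n x' = stem n x" "stem n y' = stem n x"
  shows "d G = d G'"
  using assms(1)[unfolded end_homogeneous_def, rule_format, OF assms(2,3,6,7,10,11,4,5,8,12,9,13,14)] .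

lemma end_homogeneous_exists:
  assumes c: "continuous_colouring (Suc k) c"
  obtains \<Phi> where "tree_emb \<Phi>" "end_homogeneous k (\<lambda>G. c (\<Phi> ` G))"
proof (rule end_homogeneous_embedding[OF c])
  fix \<Phi> assume emb: "tree_emb \<Phi>" and \<Phi>: "\<And>l T t x y g x' y' g'. T \<in> [{t. length t = l}]\<^bsup>k\<^esup> \<Longrightarrow> t \<in> T \<Longrightarrow>
      x \<in> cyl t \<Longrightarrow> y \<in> cyl t \<Longrightarrow> x \<noteq> y \<Longrightarrow> (\<And>s. s \<in> T \<Longrightarrow> g s \<in> cyl s) \<Longrightarrow>
      x' \<in> cyl t \<Longrightarrow> y' \<in> cyl t \<Longrightarrow> x' \<noteq> y' \<Longrightarrow> (\<And>s. s \<in> T \<Longrightarrow> g' s \<in> cyl s) \<Longrightarrow>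
      c (\<Phi> ` insert x (insert y (g ` (T - {t})))) = c (\<Phi> ` insert x' (insert y' (g' ` (T - {t}))))"
  have "end_homogeneous k (\<lambda>G. c (\<Phi> ` G))"
    unfolding end_homogeneous_def
  proof (intro allI ballI impI)
    fix n G G' x y x' y'
    assume G: "G \<in> [UNIV]\<^bsup>Suc k\<^esup>" "G' \<in> [UNIV]\<^bsup>Suc k\<^esup>" and xy: "x \<in> G" "y \<in> G" "x' \<in> G'" "y' \<in> G'"
      and card: "card (stem n ` G) = k" and eq: "stem n ` G = stem n ` G'" and ne: "x \<noteq> y" "x' \<noteq> y'"
      and st: "stem n x = stem n y" "stem n x' = stem n x" "stem n y' = stem n x"
    let ?T = "stem n ` G" and ?t = "stem n x"
    obtain g where g: "G = insert x (insert y (g ` (?T - {?t})))" "\<And>s. s \<in> ?T \<Longrightarrow> g s \<in> cyl s"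
      by (rule split_set_representation[OF G(1) card xy(1,2) ne(1) st(1)]) (rule that, assumption+)
    have card': "card (stem n ` G') = k" using card eq by simp
    have st': "stem n x' = stem n y'" using st by simp
    obtain g' where g': "G' = insert x' (insert y' (g' ` (stem n ` G' - {stem n x'})))" "\<And>s. s \<in> stem n ` G' \<Longrightarrow> g' s \<in> cyl s"
      by (rule split_set_representation[OF G(2) card' xy(3,4) ne(2) st']) (rule that, assumption+)
    have G': "G' = insert x' (insert y' (g' ` (?T - {?t})))" using g'(1) unfolding eq[symmetric] st(2) .
    have g'T: "g' s \<in> cyl s" if "s \<in> ?T" for s by (rule g'(2)) (use that eq in simp)
    have T: "?T \<in> [{t. length t = n}]\<^bsup>k\<^esup>" using card G(1) by (auto simp: nsets_def)
    have "?t \<in> ?T" using xy(1) by blast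
    moreover have "x \<in> cyl ?t" "y \<in> cyl ?t" "x' \<in> cyl ?t" "y' \<in> cyl ?t"
      using st by (simp_all add: cyl_def)
    ultimately have "c (\<Phi> ` insert x (insert y (g ` (?T - {?t})))) = c (\<Phi> ` insert x' (insert y' (g' ` (?T - {?t}))))"
      using T ne g(2) g'T by (intro \<Phi>)
    then show "c (\<Phi> ` G) = c (\<Phi> ` G')" by (simp only: g(1)[symmetric] G'[symmetric])
  qed
  then show thesis using emb that by blast
qed

lemma two_points_split:
  assumes "G \<in> [UNIV]\<^bsup>Suc k\<^esup>" "card (stem n ` G) = k"
  shows "\<exists>x y. x \<in> G \<and> y \<in> G \<and> x \<noteq> y \<and> stem n x = stem n y"
proof -
  have "\<not> inj_on (stem n) G" using assms card_image[of "stem n" G] by (auto simp: in_nsets_UNIV)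
  then show ?thesis unfolding inj_on_def by blast
qed

text \<open>Goodness moves from level \<open>m\<close> to level \<open>n\<close> by means of a new
  point \<open>j'\<close> that agrees with a point \<open>j\<close> of \<open>J\<close> on the first
  \<open>max m n\<close> bits. Adding it to \<open>J\<close> changes the stems at neither level, so
  the enlarged set is good by level \<open>m\<close>, and end-homogeneity at level \<open>n\<close>
  compares it with \<open>G\<close>.\<close>

lemma derived_colouring_iff:
  assumes hom: "end_homogeneous k d" and J: "J \<in> [UNIV]\<^bsup>k\<^esup>" "inj_on (stem n) J"
  shows "derived_colouring k d J \<longleftrightarrow> (\<forall>G\<in>[UNIV]\<^bsup>Suc k\<^esup>. stem n ` G = stem n ` J \<longrightarrow> d G)"
proof
  assume "derived_colouring k d J"
  then obtain m where m: "inj_on (stem m) J" "\<And>G. G \<in> [UNIV]\<^bsup>Suc k\<^esup> \<Longrightarrow> stem m ` G = stem m ` J \<Longrightarrow> d G"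
    unfolding derived_colouring_def by metis
  show "\<forall>G\<in>[UNIV]\<^bsup>Suc k\<^esup>. stem n ` G = stem n ` J \<longrightarrow> d G"
  proof (intro ballI impI)
    fix G assume G: "G \<in> [UNIV]\<^bsup>Suc k\<^esup>" "stem n ` G = stem n ` J"
    have card: "card (stem n ` G) = k" using G(2) J card_image[OF J(2)] by (simp add: in_nsets_UNIV)
    obtain x y where xy: "x \<in> G" "y \<in> G" "x \<noteq> y" "stem n x = stem n y"
      using two_points_split[OF G(1) card] by (elim exE conjE) (rule that)
    have "stem n x \<in> stem n ` J" using xy(1) G(2) by blast
    then obtain j where j: "j \<in> J" "stem n j = stem n x" by (metis imageE)
    define j' where "j' = (\<lambda>i. if i = max m n then \<not> j i else j i)"
    have jj: "stem n j' = stem n j" "stem m j' = stem m j" "j' \<noteq> j"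
      by (auto simp: stem_eq_iff j'_def fun_eq_iff)
    have "j' \<notin> J"
    proof
      assume "j' \<in> J"
      then have "j' = j" using inj_onD[OF J(2), of j' j] jj(1) j(1) by blast
      then show False using jj(3) by simp
    qed
    then have G': "insert j' J \<in> [UNIV]\<^bsup>Suc k\<^esup>" using J(1) by (simp add: in_nsets_UNIV)
    have im: "stem m ` insert j' J = stem m ` J" "stem n ` insert j' J = stem n ` J"
      using j(1) unfolding image_insert jj by blast+
    have "d (insert j' J)" by (rule m(2)[OF G' im(1)])
    moreover have "d G = d (insert j' J)"
    proof (rule end_homogeneousD[where x' = j and y' = j', OF hom G(1) G' card _ xy])
      show "stem n ` G = stem n ` insert j' J" using G(2) im(2) by simp
    qed (use j jj in auto)
    ultimately show "d G" by simp
  qed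
next
  assume "\<forall>G\<in>[UNIV]\<^bsup>Suc k\<^esup>. stem n ` G = stem n ` J \<longrightarrow> d G"
  then show "derived_colouring k d J" unfolding derived_colouring_def using J(2) by blast
qed

lemma continuous_derived_colouring:
  assumes hom: "end_homogeneous k d"
  shows "continuous_colouring k (derived_colouring k d)"
  unfolding continuous_colouring_def
proof
  fix J :: "cantor set" assume J: "J \<in> [UNIV]\<^bsup>k\<^esup>"
  obtain n where n: "inj_on (stem n) J" using finite_separated[of J] J by (auto simp: in_nsets_UNIV)
  have "derived_colouring k d J' = derived_colouring k d J"
    if J': "J' \<in> [UNIV]\<^bsup>k\<^esup>" "stem n ` J' = stem n ` J" for J'
  proof -
    have "card (stem n ` J') = card J'" using J J' card_image[OF n] by (simp add: in_nsets_UNIV)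
    then have "inj_on (stem n) J'" using J'(1) by (intro eq_card_imp_inj_on) (auto simp: in_nsets_UNIV)
    then show ?thesis unfolding derived_colouring_iff[OF hom J n] derived_colouring_iff[OF hom J'(1) \<open>inj_on (stem n) J'\<close>]
      by (simp only: J'(2))
  qed
  then show "\<exists>n. inj_on (stem n) J \<and> (\<forall>J'\<in>[UNIV]\<^bsup>k\<^esup>. stem n ` J' = stem n ` J \<longrightarrow>
      derived_colouring k d J' = derived_colouring k d J)" using n by (intro exI[of _ n] conjI ballI impI)
qed

lemma last_splitting_level:
  assumes "finite G" "card G \<ge> 2"
  shows "\<exists>n. inj_on (stem (Suc n)) G \<and> \<not> inj_on (stem n) G"
proof -
  have "\<exists>n. inj_on (stem n) G" using finite_separated[OF assms(1)] by blast
  then have *: "inj_on (stem (LEAST n. inj_on (stem n) G)) G" by (rule LeastI_ex)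
  have "\<not> inj_on (stem 0) G"
  proof
    assume "inj_on (stem 0) G"
    moreover have "stem 0 ` G \<subseteq> {[]}" by auto
    ultimately show False using assms card_inj_on_le[of "stem 0" G "{[]}"] by simp
  qed
  then have "(LEAST n. inj_on (stem n) G) \<noteq> 0" using * by (intro notI) simp
  then obtain n where n: "(LEAST n. inj_on (stem n) G) = Suc n" using not0_implies_Suc by blast
  then have "\<not> inj_on (stem n) G" by (intro not_less_Least) simp
  then show ?thesis using * n by metis
qed

text \<open>At the last level \<open>n\<close> where two points share a stem, all coincidences occur
  at one node by \<open>spread_split_unique\<close>, and that node carries only two points because
  they differ in bit \<open>n\<close>.\<close>

lemma spread_last_split:
  assumes G: "G \<in> [range spread]\<^bsup>Suc k\<^esup>" and k: "k \<ge> 1"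
  shows "\<exists>n. card (stem n ` G) = k"
proof -
  have fin: "finite G" "card G = Suc k" and sub: "G \<subseteq> range spread" using G by (auto simp: nsets_def)
  obtain n where n: "inj_on (stem (Suc n)) G" "\<not> inj_on (stem n) G"
    using last_splitting_level[OF fin(1)] fin(2) k by auto
  obtain x y where xy: "x \<in> G" "y \<in> G" "x \<noteq> y" "stem n x = stem n y" using n(2) unfolding inj_on_def by blast
  have diff: "u n \<noteq> v n" if "u \<in> G" "v \<in> G" "u \<noteq> v" "stem n u = stem n v" for u v
    using inj_onD[OF n(1), of u v] that by (auto simp: stem_Suc)
  have "inj_on (stem n) (G - {y})"
  proof (rule inj_onI)
    fix u v assume uv: "u \<in> G - {y}" "v \<in> G - {y}" "stem n u = stem n v"
    show "u = v"
    proof (rule ccontr)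
      assume ne: "u \<noteq> v"
      obtain x' y' u' v' where p: "x = spread x'" "y = spread y'" "u = spread u'" "v = spread v'"
        using sub xy uv by (metis DiffD1 rangeE subsetD)
      have "stem n u = stem n y"
        using spread_split_unique[of n u' v' y' x'] diff[of u v] diff[of y x] uv xy ne p by simp
      then have "u n \<noteq> y n" "v n \<noteq> y n" "u n \<noteq> v n"
        using diff[of u y] diff[of v y] diff[of u v] uv xy ne by auto
      then show False by blast
    qed
  qed
  then have "card (stem n ` (G - {y})) = k" using fin xy(2) by (simp add: card_image)
  moreover have "stem n ` G = stem n ` (G - {y})"
  proof -
    have "stem n ` G = insert (stem n y) (stem n ` (G - {y}))" using xy(2) by blast
    moreover have "stem n y \<in> stem n ` (G - {y})" unfolding xy(4)[symmetric] using xy by (intro imageI) simp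
    ultimately show ?thesis by (simp add: insert_absorb)
  qed
  ultimately show ?thesis by metis
qed

text \<open>Branches separated at level \<open>n\<close> stand for nodes of that level. This lets
  the inner induction on \<open>n\<close> pass to subsets of \<open>G\<close> without moving any
  point.\<close>

lemma homogeneous_or_small:
  assumes "continuous_colouring (Suc j) c"
  shows "\<exists>\<Phi>. tree_emb \<Phi> \<and> ((\<forall>G\<in>[UNIV]\<^bsup>Suc j\<^esup>. c (\<Phi> ` G)) \<or>
    (\<forall>n G. finite G \<longrightarrow> inj_on (stem n) G \<longrightarrow> (\<forall>K\<in>[G]\<^bsup>Suc j\<^esup>. c (\<Phi> ` K)) \<longrightarrow> card G \<le> subtree_bound j n))"
  using assms
proof (induction j arbitrary: c)
  case 0
  show ?case
  \<comment> \<open>A good point is good together with a whole cylinder around it. Without good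
    points \<open>G\<close> must be empty, which is the value 0 of
    \<open>subtree_bound 0 n\<close>.\<close>
  proof (cases "\<exists>x. c {x}")
    case True
    then obtain x where x: "c {x}" by blast
    have x1: "{x} \<in> [UNIV]\<^bsup>Suc 0\<^esup>" by (simp add: in_nsets_UNIV)
    obtain n where n: "\<forall>G'\<in>[UNIV]\<^bsup>Suc 0\<^esup>. stem n ` G' = stem n ` {x} \<longrightarrow> c G' = c {x}"
      using "0"[unfolded continuous_colouring_def, THEN bspec, OF x1] by (elim exE conjE) (rule that)
    have "c (prepend (stem n x) ` G)" if G: "G \<in> [UNIV]\<^bsup>Suc 0\<^esup>" for G
    proof -
      obtain y where y: "G = {y}" using G by (auto simp: in_nsets_UNIV card_1_singleton_iff)
      have "stem n (prepend (stem n x) y) = stem n x" using stem_prepend[of "stem n x" y] by simp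
      then have "stem n ` {prepend (stem n x) y} = stem n ` {x}" by simp
      from n[rule_format, OF _ this] have "c {prepend (stem n x) y} = c {x}" by (simp add: in_nsets_UNIV)
      then show ?thesis using x y by simp
    qed
    then show ?thesis using tree_emb_prepend by blast
  next
    case False
    have "card G \<le> subtree_bound 0 n" if "\<forall>K\<in>[G]\<^bsup>Suc 0\<^esup>. c ((\<lambda>x. x) ` K)" for G n
    proof -
      have "G = {}"
      proof (rule ccontr)
        assume "G \<noteq> {}"
        then obtain x where "x \<in> G" by blast
        then have "{x} \<in> [G]\<^bsup>Suc 0\<^esup>" by (simp add: nsets_def)
        from bspec[OF that this] show False using False by simp
      qed
      then show ?thesis by simp
    qed
    then show ?thesis using tree_emb_id by blast
  qed
next
  case (Suc j)
  define k where "k = Suc j"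
  obtain \<Phi> where \<Phi>: "tree_emb \<Phi>" "end_homogeneous k (\<lambda>G. c (\<Phi> ` G))"
    using end_homogeneous_exists[of k c] Suc.prems unfolding k_def by metis
  define d where "d = (\<lambda>G. c (\<Phi> ` G))"
  have hom: "end_homogeneous k d" using \<Phi>(2) by (simp only: d_def)
  \<comment> \<open>Pulling the derived colouring back along \<open>spread\<close> ensures that
    whatever embedding the induction returns, its points end up in the range of
    \<open>spread\<close>, where \<open>spread_last_split\<close> applies.\<close>
  define c' where "c' = (\<lambda>J. derived_colouring k d (spread ` J))"
  have c'_cont: "continuous_colouring (Suc j) c'"
    unfolding c'_def k_def[symmetric]
    by (rule continuous_colouring_tree_emb[OF continuous_derived_colouring[OF hom] tree_emb_spread])
  obtain \<Psi> where \<Psi>: "tree_emb \<Psi>" and alt: "(\<forall>G\<in>[UNIV]\<^bsup>k\<^esup>. c' (\<Psi> ` G)) \<or>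
    (\<forall>n G. finite G \<longrightarrow> inj_on (stem n) G \<longrightarrow> (\<forall>K\<in>[G]\<^bsup>k\<^esup>. c' (\<Psi> ` K)) \<longrightarrow> card G \<le> subtree_bound j n)"
    using Suc.IH[OF c'_cont] unfolding k_def by (elim exE conjE) (rule that[unfolded k_def])
  define \<Theta> where "\<Theta> x = spread (\<Psi> x)" for x
  have \<Theta>: "tree_emb \<Theta>" unfolding \<Theta>_def by (rule tree_emb_comp[OF tree_emb_spread \<Psi>])
  have emb: "tree_emb (\<lambda>x. \<Phi> (\<Theta> x))" by (rule tree_emb_comp[OF \<Phi>(1) \<Theta>])
  have d_eq: "c ((\<lambda>x. \<Phi> (\<Theta> x)) ` G) = d (\<Theta> ` G)" for G by (simp add: d_def image_image)
  have c'_eq: "c' (\<Psi> ` J) = derived_colouring k d (\<Theta> ` J)" for J by (simp add: c'_def \<Theta>_def image_image)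
  have inj\<Theta>: "inj_on \<Theta> A" for A using tree_emb_inj[OF \<Theta>] by (rule inj_on_subset) simp
  have ns: "\<Theta> ` G \<in> [UNIV]\<^bsup>m\<^esup>" if "G \<in> [UNIV]\<^bsup>m\<^esup>" for G m
    using that by (simp add: in_nsets_UNIV card_image[OF inj\<Theta>])
  from alt show ?case
  proof
    assume all: "\<forall>G\<in>[UNIV]\<^bsup>k\<^esup>. c' (\<Psi> ` G)"
    have "d (\<Theta> ` G)" if G: "G \<in> [UNIV]\<^bsup>Suc k\<^esup>" for G
    proof -
      have "\<Theta> ` G \<in> [range spread]\<^bsup>Suc k\<^esup>" using ns[OF G] by (auto simp: nsets_def \<Theta>_def)
      then obtain n where n: "card (stem n ` \<Theta> ` G) = k" using spread_last_split[of "\<Theta> ` G" k] by (auto simp: k_def)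
      obtain y x where xy: "y \<in> \<Theta> ` G" "x \<in> \<Theta> ` G" "y \<noteq> x" "stem n y = stem n x"
        using two_points_split[OF ns[OF G] n] by (elim exE conjE) (rule that)
      then obtain y' where y': "y' \<in> G" "y = \<Theta> y'" by blast
      \<comment> \<open>Removing one of the two points above the doubled node leaves
        \<open>k\<close> points with the same stems, so the derived colour of their image settles
        the colour of the image of \<open>G\<close>.\<close>
      let ?J = "G - {y'}"
      have J: "\<Theta> ` ?J = \<Theta> ` G - {y}" unfolding y'(2) using inj\<Theta>[of UNIV] by (simp add: image_set_diff)
      have im: "stem n ` \<Theta> ` G = stem n ` \<Theta> ` ?J"
      proof -
        have "\<Theta> ` G = insert y (\<Theta> ` ?J)" unfolding J by (rule insert_Diff[OF xy(1), symmetric])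
        then have "stem n ` \<Theta> ` G = insert (stem n y) (stem n ` \<Theta> ` ?J)" by (simp only: image_insert)
        moreover have "stem n y \<in> stem n ` \<Theta> ` ?J" unfolding xy(4) J using xy(2,3) by (intro imageI) simp
        ultimately show ?thesis by (simp add: insert_absorb)
      qed
      have Jk: "?J \<in> [UNIV]\<^bsup>k\<^esup>" using G y'(1) by (simp add: in_nsets_UNIV)
      have inj: "inj_on (stem n) (\<Theta> ` ?J)"
      proof (rule eq_card_imp_inj_on)
        show "card (stem n ` \<Theta> ` ?J) = card (\<Theta> ` ?J)" using n ns[OF Jk] by (simp add: im in_nsets_UNIV)
      qed (use ns[OF Jk] in \<open>simp add: in_nsets_UNIV\<close>)
      have "derived_colouring k d (\<Theta> ` ?J)" using all Jk by (simp add: c'_eq[symmetric])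
      then show ?thesis using derived_colouring_iff[OF hom ns[OF Jk] inj] ns[OF G] im by blast
    qed
    then have "\<forall>G\<in>[UNIV]\<^bsup>Suc k\<^esup>. c ((\<lambda>x. \<Phi> (\<Theta> x)) ` G)" by (simp add: d_eq)
    then show ?thesis using emb unfolding k_def by blast
  next
    assume small: "\<forall>n G. finite G \<longrightarrow> inj_on (stem n) G \<longrightarrow> (\<forall>K\<in>[G]\<^bsup>k\<^esup>. c' (\<Psi> ` K)) \<longrightarrow> card G \<le> subtree_bound j n"
    have "card G \<le> subtree_bound k n"
      if "finite G" "inj_on (stem n) G" "\<forall>K\<in>[G]\<^bsup>Suc k\<^esup>. d (\<Theta> ` K)" for n G
      using that
    proof (induction n arbitrary: G)
      case 0
      have "stem 0 ` G \<subseteq> {[]}" by auto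
      then have "card G \<le> 1" using card_inj_on_le[OF "0.prems"(2), of "{[]}"] by simp
      then show ?case by (simp add: k_def)
    next
      case (Suc n)
      \<comment> \<open>\<open>r\<close> picks one point of \<open>G\<close> above each node of
        level \<open>n\<close>. As \<open>G\<close> is separated at level \<open>Suc n\<close>, at
        most one further point remains above a node; these points form \<open>G1\<close>, and each
        has a twin in \<open>G0\<close>.\<close>
      define r where "r t = (SOME x. x \<in> G \<and> stem n x = t)" for t
      have r: "r t \<in> G" "stem n (r t) = t" if "t \<in> stem n ` G" for t
      proof -
        have "\<exists>x. x \<in> G \<and> stem n x = t" using that by blast
        from someI_ex[OF this] show "r t \<in> G" "stem n (r t) = t" unfolding r_def by blast+
      qed
      define G0 where "G0 = r ` stem n ` G"
      define G1 where "G1 = G - G0"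
      have G0: "G0 \<subseteq> G" using r(1) by (auto simp: G0_def)
      have inj0: "inj_on (stem n) G0" unfolding G0_def using r(2) by (intro inj_onI) auto
      have diff: "u n \<noteq> v n" if "u \<in> G" "v \<in> G" "u \<noteq> v" "stem n u = stem n v" for u v
        using inj_onD[OF Suc.prems(2), of u v] that by (auto simp: stem_Suc)
      have twin: "r (stem n x) \<in> G0" "stem n (r (stem n x)) = stem n x" "r (stem n x) \<noteq> x" if "x \<in> G1" for x
      proof -
        have x: "x \<in> G" "x \<notin> G0" using that by (auto simp: G1_def)
        then show "r (stem n x) \<in> G0" unfolding G0_def by blast
        then show "r (stem n x) \<noteq> x" using x(2) by metis
        show "stem n (r (stem n x)) = stem n x" using x(1) by (intro r(2)) blast
      qed
      have inj1: "inj_on (stem n) G1"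
      proof (rule inj_onI)
        fix u v assume uv: "u \<in> G1" "v \<in> G1" "stem n u = stem n v"
        show "u = v"
        proof (rule ccontr)
          assume "u \<noteq> v"
          let ?w = "r (stem n u)"
          have "?w \<in> G" "u \<in> G" "v \<in> G" using twin(1)[OF uv(1)] G0 uv by (auto simp: G1_def)
          moreover have "stem n ?w = stem n u" "stem n ?w = stem n v" "?w \<noteq> u" "?w \<noteq> v"
            using twin(2,3)[OF uv(1)] twin(3)[OF uv(2)] uv(3) by simp_all
          ultimately have "?w n \<noteq> u n" "?w n \<noteq> v n" "u n \<noteq> v n"
            using diff[of ?w u] diff[of ?w v] diff[of u v] uv(3) \<open>u \<noteq> v\<close> by blast+
          then show False by blast
        qed
      qed
      have "card G0 \<le> subtree_bound k n"
        by (rule Suc.IH[OF finite_subset[OF G0 Suc.prems(1)] inj0]) (use Suc.prems(3) G0 in \<open>auto simp: nsets_def\<close>)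
      moreover have "card G1 \<le> subtree_bound j n"
      proof -
        obtain L where L: "\<And>n x y. stem (L n) (\<Theta> x) = stem (L n) (\<Theta> y) \<longleftrightarrow> stem n x = stem n y"
          using tree_embE[OF \<Theta>] by metis
        \<comment> \<open>Adding to \<open>J\<close> the twin of one of its points gives
          \<open>Suc k\<close> points of \<open>G\<close>, whose image is good. End-homogeneity
          carries this over to every \<open>H\<close> that doubles the same node, at whatever
          height; in the image, level \<open>n\<close> has become \<open>L n\<close>.\<close>
        have "c' (\<Psi> ` J)" if J: "J \<in> [G1]\<^bsup>k\<^esup>" for J
        proof -
          have J': "J \<in> [UNIV]\<^bsup>k\<^esup>" "J \<subseteq> G1" using J by (auto simp: nsets_def)
          have inj: "inj_on (stem (L n)) (\<Theta> ` J)"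
          proof (rule inj_onI)
            fix u v assume "u \<in> \<Theta> ` J" "v \<in> \<Theta> ` J" "stem (L n) u = stem (L n) v"
            then obtain u' v' where "u = \<Theta> u'" "v = \<Theta> v'" "u' \<in> J" "v' \<in> J" "stem n u' = stem n v'"
              using L by (metis imageE)
            then show "u = v" using inj_onD[OF inj1, of u' v'] J'(2) by blast
          qed
          have "d H" if H: "H \<in> [UNIV]\<^bsup>Suc k\<^esup>" "stem (L n) ` H = stem (L n) ` \<Theta> ` J" for H
          proof -
            have card: "card (stem (L n) ` H) = k"
              using H(2) card_image[OF inj] ns[OF J'(1)] by (simp add: in_nsets_UNIV)
            obtain x y where xy: "x \<in> H" "y \<in> H" "x \<noteq> y" "stem (L n) x = stem (L n) y"
              using two_points_split[OF H(1) card] by (elim exE conjE) (rule that)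
            have "stem (L n) x \<in> stem (L n) ` \<Theta> ` J" using xy(1) H(2) by blast
            then obtain z where z: "z \<in> J" "stem (L n) x = stem (L n) (\<Theta> z)" by blast
            have zG: "z \<in> G1" using z(1) J'(2) by blast
            let ?z = "r (stem n z)"
            have z': "?z \<in> G" "?z \<notin> J" using twin(1)[OF zG] G0 J'(2) by (auto simp: G1_def)
            then have K: "insert ?z J \<in> [UNIV]\<^bsup>Suc k\<^esup>" "insert ?z J \<in> [G]\<^bsup>Suc k\<^esup>"
              using J'  by (auto simp: nsets_def G1_def)
            have tz: "stem (L n) (\<Theta> ?z) = stem (L n) (\<Theta> z)" using L twin(2)[OF zG] by metis
            have "stem (L n) ` \<Theta> ` insert ?z J = insert (stem (L n) (\<Theta> ?z)) (stem (L n) ` \<Theta> ` J)" by simp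
            also have "\<dots> = stem (L n) ` \<Theta> ` J" unfolding tz using z(1) by blast
            finally have im: "stem (L n) ` \<Theta> ` insert ?z J = stem (L n) ` \<Theta> ` J" .
            have "d H = d (\<Theta> ` insert ?z J)"
            proof (rule end_homogeneousD[where x' = "\<Theta> z" and y' = "\<Theta> ?z", OF hom H(1) ns[OF K(1)] card _ xy])
              show "stem (L n) ` H = stem (L n) ` \<Theta> ` insert ?z J" using H(2) im by simp
              show "\<Theta> z \<in> \<Theta> ` insert ?z J" "\<Theta> ?z \<in> \<Theta> ` insert ?z J" using z(1) by blast+
              show "\<Theta> z \<noteq> \<Theta> ?z" using twin(3)[OF zG] injD[OF tree_emb_inj[OF \<Theta>], of z ?z] by metis
              show "stem (L n) (\<Theta> z) = stem (L n) x" by (rule z(2)[symmetric])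
              show "stem (L n) (\<Theta> ?z) = stem (L n) x" by (rule trans[OF tz z(2)[symmetric]])
            qed
            then show ?thesis using bspec[OF Suc.prems(3) K(2)] by (simp only:)
          qed
          then have "derived_colouring k d (\<Theta> ` J)" unfolding derived_colouring_def using inj by blast
          then show ?thesis by (simp add: c'_eq)
        qed
        moreover have "finite G1" using Suc.prems(1) by (simp add: G1_def)
        ultimately show ?thesis using small inj1 by blast
      qed
      moreover have "card G = card G0 + card G1"
        using Suc.prems(1) G0 card_mono[OF Suc.prems(1) G0] unfolding G1_def
        by (simp add: card_Diff_subset finite_subset)
      \<comment> \<open>Splitting off the last summand gives \<open>subtree_bound (Suc j) (Suc n) =
        subtree_bound (Suc j) n + subtree_bound j n\<close>.\<close>
      ultimately show ?case by (simp add: k_def)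
    qed
    then have "\<forall>n G. finite G \<longrightarrow> inj_on (stem n) G \<longrightarrow> (\<forall>K\<in>[G]\<^bsup>Suc k\<^esup>. c ((\<lambda>x. \<Phi> (\<Theta> x)) ` K)) \<longrightarrow>
      card G \<le> subtree_bound k n" by (simp add: d_eq)
    then show ?thesis using emb unfolding k_def by blast
  qed
qed

section \<open>Baire category\<close>

lemma open_cantor_iff:
  "open U \<longleftrightarrow> (\<forall>x\<in>U. \<exists>n. \<forall>y :: cantor. stem n y = stem n x \<longrightarrow> y \<in> U)"
proof
  assume U: "open U"
  show "\<forall>x\<in>U. \<exists>n. \<forall>y. stem n y = stem n x \<longrightarrow> y \<in> U"
  proof
    fix x assume "x \<in> U"
    then obtain X where X: "x \<in> Pi\<^sub>E UNIV X" "finite {i. X i \<noteq> topspace euclidean}" "Pi\<^sub>E UNIV X \<subseteq> U"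
      using product_topology_open_contains_basis[of "\<lambda>_. euclidean" UNIV U x] U unfolding open_fun_def by blast
    obtain n where n: "\<forall>i\<in>{i. X i \<noteq> topspace euclidean}. i < n"
      using finite_nat_bounded[OF X(2)] by auto
    have "y \<in> U" if "stem n y = stem n x" for y
    proof -
      have "y i \<in> X i" for i
        using n that X(1) by (cases "X i = topspace euclidean") (auto simp: stem_eq_iff PiE_iff)
      then show ?thesis using X(3) by (auto simp: PiE_iff)
    qed
    then show "\<exists>n. \<forall>y. stem n y = stem n x \<longrightarrow> y \<in> U" by blast
  qed
next
  assume U: "\<forall>x\<in>U. \<exists>n. \<forall>y. stem n y = stem n x \<longrightarrow> y \<in> U"
  show "open U"
  proof (subst open_subopen, intro ballI)
    fix x assume "x \<in> U"
    then obtain n where n: "\<forall>y. stem n y = stem n x \<longrightarrow> y \<in> U" using U by blast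
    define X where "X i = (if i < n then {x i} else UNIV)" for i
    have "open (Pi\<^sub>E UNIV X)"
    proof (rule open_PiE)
      show "finite {i. X i \<noteq> UNIV}" by (rule finite_subset[of _ "{..<n}"]) (auto simp: X_def split: if_splits)
    qed (auto simp: X_def open_discrete)
    moreover have "x \<in> Pi\<^sub>E UNIV X" by (auto simp: X_def PiE_iff)
    moreover have "Pi\<^sub>E UNIV X \<subseteq> U"
    proof
      fix y assume "y \<in> Pi\<^sub>E UNIV X"
      then have "y i \<in> X i" for i by (simp add: PiE_iff)
      then have "stem n y = stem n x" unfolding stem_eq_iff X_def by (metis singletonD)
      then show "y \<in> U" using n by blast
    qed
    ultimately show "\<exists>T. open T \<and> x \<in> T \<and> T \<subseteq> U" by blast
  qed
qed

lemma perfect_if_tree_perfect: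
  assumes "tree_perfect X" shows "perfect X"
  unfolding perfect_def
proof (intro conjI ballI notI)
  show "X = {} \<Longrightarrow> False" using tree_perfect_nonempty[OF assms] by simp
  show "closed X"
    unfolding closed_def open_cantor_iff
  proof (intro ballI)
    fix x assume "x \<in> - X"
    then have "\<not> (\<forall>n. \<exists>y\<in>X. stem n x = stem n y)" using tree_perfect_closed[OF assms, of x] by blast
    then obtain n where "\<And>y. y \<in> X \<Longrightarrow> stem n x \<noteq> stem n y" by blast
    then show "\<exists>n. \<forall>y. stem n y = stem n x \<longrightarrow> y \<in> - X" by (metis ComplI)
  qed
  fix x assume "x isolated_in X"
  then obtain T where T: "open T" "T \<inter> X = {x}" unfolding isolated_in_def by blast
  obtain \<Phi> where emb: "tree_emb \<Phi>" "X = range \<Phi>" using assms by (auto simp: tree_perfect_def)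
  have "x \<in> X" "x \<in> T" using T(2) by blast+
  then obtain z where "x = \<Phi> z" using emb(2) by blast
  note \<Phi> = emb this
  obtain n where n: "\<And>y. stem n y = stem n x \<Longrightarrow> y \<in> T" using T(1) \<open>x \<in> T\<close> unfolding open_cantor_iff by metis
  \<comment> \<open>Flipping bit \<open>n\<close> of the preimage gives another point of
    \<open>X\<close> with the same first \<open>n\<close> bits as \<open>x\<close>.\<close>
  define z' where "z' = z(n := \<not> z n)"
  have "stem n z' = stem n z" by (simp add: stem_eq_iff z'_def)
  from tree_emb_cont[OF \<Phi>(1) this] have "\<Phi> z' \<in> T" by (intro n) (simp only: \<Phi>(3))
  then have "\<Phi> z' = \<Phi> z" using T(2) \<Phi>(2,3) by blast
  then have "z' = z" using tree_emb_inj[OF \<Phi>(1)] by (simp add: inj_eq)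
  then show False by (metis z'_def fun_upd_same)
qed

section \<open>Basic boxes and nowhere dense sets in the space of finite subsets\<close>

definition basic_box :: "nat \<Rightarrow> (nat \<Rightarrow> cantor) \<Rightarrow> nat \<Rightarrow> (nat \<times> (nat \<Rightarrow> cantor)) set" where
  "basic_box k x n = {k} \<times> {y \<in> increasing_seqs k. \<forall>i<k. stem n (y i) = stem n (x i)}"

text \<open>A point has finitely many coordinates, so one stem length serves them all. Boxes contain
  increasing sequences only, because short stems need not force the order.\<close>

lemma openin_finite_subsets_topology:
  "openin finite_subsets_topology U \<longleftrightarrow> U \<subseteq> Sigma {1..} increasing_seqs \<and>
     (\<forall>k x. (k, x) \<in> U \<longrightarrow> (\<exists>n. basic_box k x n \<subseteq> U))"
proof -
  have top: "topspace (subtopology (product_topology (\<lambda>_. euclidean) {..<k}) (increasing_seqs k)) = increasing_seqs k" for k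
    by (auto simp: increasing_seqs_def)
  have one: "openin (subtopology (product_topology (\<lambda>_. euclidean) {..<k}) (increasing_seqs k)) V \<longleftrightarrow>
     V \<subseteq> increasing_seqs k \<and> (\<forall>x\<in>V. \<exists>n. \<forall>y\<in>increasing_seqs k. (\<forall>i<k. stem n (y i) = stem n (x i)) \<longrightarrow> y \<in> V)"
    (is "?L \<longleftrightarrow> ?R") for k V
  proof
    assume ?L
    then obtain S where S: "openin (product_topology (\<lambda>_. euclidean :: cantor topology) {..<k}) S" "V = S \<inter> increasing_seqs k"
      by (auto simp: openin_subtopology)
    have "\<exists>n. \<forall>y\<in>increasing_seqs k. (\<forall>i<k. stem n (y i) = stem n (x i)) \<longrightarrow> y \<in> V" if "x \<in> V" for x
    proof -
      have "x \<in> S" using that S(2) by blast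
      then obtain U where U: "\<forall>i\<in>{..<k}. openin euclidean (U i)" "x \<in> Pi\<^sub>E {..<k} U" "Pi\<^sub>E {..<k} U \<subseteq> S"
        using S(1) unfolding openin_product_topology_alt by blast
      have "\<forall>i\<in>{..<k}. \<exists>n. \<forall>y. stem n y = stem n (x i) \<longrightarrow> y \<in> U i"
        using U(1,2) open_cantor_iff by (auto simp: PiE_iff)
      then obtain N where N: "\<And>i y. i < k \<Longrightarrow> stem (N i) y = stem (N i) (x i) \<Longrightarrow> y \<in> U i"
        by (metis lessThan_iff)
      define n where "n = Max (insert 0 (N ` {..<k}))"
      have n: "N i \<le> n" if "i < k" for i using that by (auto simp: n_def)
      have "y \<in> V" if y: "y \<in> increasing_seqs k" "\<forall>i<k. stem n (y i) = stem n (x i)" for y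
      proof -
        have "y i \<in> U i" if "i < k" for i
          using N[OF that] stem_eq_mono[of n "y i" "x i" "N i"] y(2) n[OF that] that by blast
        then have "y \<in> Pi\<^sub>E {..<k} U" using y(1) by (auto simp: increasing_seqs_def PiE_iff)
        then show ?thesis using U(3) y(1) S(2) by blast
      qed
      then show ?thesis by blast
    qed
    then show ?R using S(2) by blast
  next
    assume R: ?R
    show ?L
      unfolding openin_subopen[of _ V]
    proof
      fix x assume x: "x \<in> V"
      then obtain n where n: "\<forall>y\<in>increasing_seqs k. (\<forall>i<k. stem n (y i) = stem n (x i)) \<longrightarrow> y \<in> V" using R by blast
      define U where "U i = {y. stem n y = stem n (x i)}" for i
      have "open (U i)" for i unfolding open_cantor_iff U_def by (auto intro!: exI[of _ n])
      then have "openin (product_topology (\<lambda>_. euclidean) {..<k}) (Pi\<^sub>E {..<k} U)"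
        by (simp add: openin_PiE)
      then have "openin (subtopology (product_topology (\<lambda>_. euclidean) {..<k}) (increasing_seqs k)) (Pi\<^sub>E {..<k} U \<inter> increasing_seqs k)"
        by (auto simp: openin_subtopology)
      moreover have "x \<in> Pi\<^sub>E {..<k} U \<inter> increasing_seqs k"
        using x R by (auto simp: increasing_seqs_def PiE_iff U_def)
      moreover have "Pi\<^sub>E {..<k} U \<inter> increasing_seqs k \<subseteq> V"
        using n by (auto simp: PiE_iff U_def)
      ultimately show "\<exists>T. openin (subtopology (product_topology (\<lambda>_. euclidean) {..<k}) (increasing_seqs k)) T \<and> x \<in> T \<and> T \<subseteq> V"
        by blast
    qed
  qed
  show ?thesis
  proof (intro iffI conjI allI impI)
    assume "openin finite_subsets_topology U"
    then have *: "U \<subseteq> Sigma {1..} increasing_seqs"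
      "\<And>k. k \<ge> 1 \<Longrightarrow> (\<forall>x\<in>{x. (k, x) \<in> U}. \<exists>n. \<forall>y\<in>increasing_seqs k.
        (\<forall>i<k. stem n (y i) = stem n (x i)) \<longrightarrow> y \<in> {x. (k, x) \<in> U})"
      unfolding finite_subsets_topology_def openin_sum_topology top one comp_def by simp_all
    show "U \<subseteq> Sigma {1..} increasing_seqs" by (rule *(1))
    fix k x assume kx: "(k, x) \<in> U"
    then have "k \<ge> 1" using *(1) by auto
    then obtain n where "\<forall>y\<in>increasing_seqs k. (\<forall>i<k. stem n (y i) = stem n (x i)) \<longrightarrow> y \<in> {x. (k, x) \<in> U}"
      using *(2)[of k] kx by blast
    then have "basic_box k x n \<subseteq> U" unfolding basic_box_def by blast
    then show "\<exists>n. basic_box k x n \<subseteq> U" by blast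
  next
    assume *: "U \<subseteq> Sigma {1..} increasing_seqs \<and> (\<forall>k x. (k, x) \<in> U \<longrightarrow> (\<exists>n. basic_box k x n \<subseteq> U))"
    show "openin finite_subsets_topology U"
      unfolding finite_subsets_topology_def openin_sum_topology top one comp_def
    proof (intro conjI ballI)
      fix k x assume "x \<in> {x. (k, x) \<in> U}"
      then obtain n where n: "basic_box k x n \<subseteq> U" using * by blast
      have "(k, y) \<in> basic_box k x n" if "y \<in> increasing_seqs k" "\<forall>i<k. stem n (y i) = stem n (x i)" for y
        using that by (simp add: basic_box_def)
      then show "\<exists>n. \<forall>y\<in>increasing_seqs k. (\<forall>i<k. stem n (y i) = stem n (x i)) \<longrightarrow> y \<in> {x. (k, x) \<in> U}"
        using n by blast
    qed (use * in auto)
  qed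
qed

lemma basic_box_mono:
  assumes "x' \<in> increasing_seqs k" "(k, x') \<in> basic_box k x n" "n \<le> m"
  shows "basic_box k x' m \<subseteq> basic_box k x n"
proof
  fix p assume "p \<in> basic_box k x' m"
  then obtain y where p: "p = (k, y)" "y \<in> increasing_seqs k" "\<And>i. i < k \<Longrightarrow> stem m (y i) = stem m (x' i)"
    by (auto simp: basic_box_def)
  have "stem n (y i) = stem n (x i)" if "i < k" for i
    using stem_eq_mono[OF p(3)[OF that] assms(3)] assms(2) that by (simp add: basic_box_def)
  then show "p \<in> basic_box k x n" using p(1,2) by (simp add: basic_box_def)
qed

lemma basic_box_self: "x \<in> increasing_seqs k \<Longrightarrow> (k, x) \<in> basic_box k x n"
  by (simp add: basic_box_def)

lemma openin_basic_box:
  assumes "k \<ge> 1" shows "openin finite_subsets_topology (basic_box k x n)"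
  unfolding openin_finite_subsets_topology
proof (intro conjI allI impI)
  show "basic_box k x n \<subseteq> Sigma {1..} increasing_seqs" using assms by (auto simp: basic_box_def)
  fix l y assume y: "(l, y) \<in> basic_box k x n"
  then have "l = k" "y \<in> increasing_seqs k" by (auto simp: basic_box_def)
  then show "\<exists>m. basic_box l y m \<subseteq> basic_box k x n" using basic_box_mono[of y k x n n] y by blast
qed

text \<open>A box is open and nonempty, so the closure of \<open>N\<close> does not cover it, and a
  small box around an uncovered point misses \<open>N\<close>. The condition
  \<open>m \<ge> n\<close> keeps the new box inside the old one.\<close>

lemma nowhere_dense_avoid:
  assumes k: "k \<ge> 1" and N: "nowhere_dense_in finite_subsets_topology N" and x: "x \<in> increasing_seqs k"
  shows "\<exists>z\<in>increasing_seqs k. \<exists>m\<ge>n. (k, z) \<in> basic_box k x n \<and> basic_box k z m \<inter> N = {}"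
proof -
  let ?X = "finite_subsets_topology"
  have "\<not> basic_box k x n \<subseteq> ?X closure_of N"
  proof
    assume "basic_box k x n \<subseteq> ?X closure_of N"
    then have "basic_box k x n \<subseteq> ?X interior_of (?X closure_of N)"
      using openin_basic_box[OF k] by (rule interior_of_maximal)
    then show False using N basic_box_self[OF x, of n] by (auto simp: nowhere_dense_in_def)
  qed
  then obtain p where p: "p \<in> basic_box k x n" "p \<notin> ?X closure_of N" by blast
  then obtain z where z: "p = (k, z)" "z \<in> increasing_seqs k" by (auto simp: basic_box_def)
  have "openin ?X (topspace ?X - ?X closure_of N)"
    by (intro openin_diff openin_topspace closedin_closure_of)
  moreover have "(k, z) \<in> topspace ?X - ?X closure_of N"
    using p(2) z k by (simp add: topspace_finite_subsets_topology)
  ultimately obtain m where m: "basic_box k z m \<subseteq> topspace ?X - ?X closure_of N"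
    unfolding openin_finite_subsets_topology by blast
  have "N \<subseteq> ?X closure_of N" using N by (simp add: nowhere_dense_in_def closure_of_subset)
  then have "basic_box k z m \<inter> N = {}" using m by blast
  moreover have "basic_box k z (max m n) \<subseteq> basic_box k z m"
    by (rule basic_box_mono[OF z(2) basic_box_self[OF z(2)]]) simp
  ultimately have "basic_box k z (max m n) \<inter> N = {}" by blast
  then show ?thesis using p(1) z by (intro bexI[of _ z] exI[of _ "max m n"]) auto
qed

lemma finitely_many_nowhere_dense_avoid:
  fixes N :: "nat \<Rightarrow> (nat \<times> (nat \<Rightarrow> cantor)) set"
  assumes k: "k \<ge> 1" and N: "\<And>m. nowhere_dense_in finite_subsets_topology (N m)" and x: "x \<in> increasing_seqs k"
  shows "\<exists>z\<in>increasing_seqs k. \<exists>l\<ge>n. (k, z) \<in> basic_box k x n \<and> (\<forall>m<j. basic_box k z l \<inter> N m = {})"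
proof (induction j)
  case 0
  then show ?case using x basic_box_self[OF x, of n] by blast
next
  case (Suc j)
  then obtain z l where z: "z \<in> increasing_seqs k" "l \<ge> n" "(k, z) \<in> basic_box k x n"
    "\<And>m. m < j \<Longrightarrow> basic_box k z l \<inter> N m = {}" by blast
  obtain w l' where w: "w \<in> increasing_seqs k" "l' \<ge> l" "(k, w) \<in> basic_box k z l" "basic_box k w l' \<inter> N j = {}"
    using nowhere_dense_avoid[OF k N z(1)] by blast
  have "basic_box k w l' \<subseteq> basic_box k z l" by (rule basic_box_mono[OF w(1,3,2)])
  then have "basic_box k w l' \<inter> N m = {}" if "m < Suc j" for m
    using z(4)[of m] w(4) that by (cases "m = j") auto
  moreover have "(k, w) \<in> basic_box k x n"
    using basic_box_mono[OF z(1,3,2)] w(3) by blast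
  ultimately show ?case using w(1,2) z(2) by (intro bexI[of _ w] exI[of _ l']) auto
qed

lemma less_fun_stem:
  fixes x y :: cantor
  assumes "less_fun x y" "stem l x \<noteq> stem l y" "stem l x' = stem l x" "stem l y' = stem l y"
  shows "less_fun x' y'"
proof -
  obtain m where m: "x m < y m" "\<And>i. i < m \<Longrightarrow> x i = y i" using assms(1) unfolding less_fun_def by blast
  have "m < l"
  proof (rule ccontr)
    assume "\<not> m < l"
    then have "stem l x = stem l y" using m(2) by (simp add: stem_eq_iff)
    then show False using assms(2) by simp
  qed
  then have "x' i = x i" "y' i = y i" if "i \<le> m" for i using that assms(3,4) by (simp_all add: stem_eq_iff)
  then show ?thesis unfolding less_fun_def using m by (intro exI[of _ m]) simp
qed

lemma range_of_seq_inj: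
  assumes "p \<in> Sigma {1..} increasing_seqs" "q \<in> Sigma {1..} increasing_seqs" "range_of_seq p = range_of_seq q"
  shows "p = q"
  using bij_betw_range_of_seq assms unfolding bij_betw_def topspace_finite_subsets_topology
  by (meson inj_onD)

lemma range_of_seq_surj:
  assumes "G \<in> [UNIV]\<^bsup>k\<^esup>" "k \<ge> 1"
  obtains y where "y \<in> increasing_seqs k" "range_of_seq (k, y) = G" "inj_on y {..<k}"
proof -
  have "G \<in> finite_subsets" using assms by (auto simp: finite_subsets_def)
  then obtain p where p: "p \<in> Sigma {1..} increasing_seqs" "range_of_seq p = G"
    using bij_betw_range_of_seq unfolding bij_betw_def topspace_finite_subsets_topology by (metis imageE)
  obtain l y where y: "p = (l, y)" "y \<in> increasing_seqs l" using p(1) by auto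
  have inj: "inj_on y {..<l}"
  proof (rule inj_onI)
    fix i j assume ij: "i \<in> {..<l}" "j \<in> {..<l}" "y i = y j"
    have "less_fun (y i) (y j)" if "i < j" "j < l" for i j using y(2) that by (simp add: increasing_seqs_def)
    then show "i = j" using ij less_fun_irrefl by (metis lessThan_iff linorder_neqE_nat)
  qed
  have "card (y ` {..<l}) = k" using p(2) y(1) assms(1) by (simp add: range_of_seq_def in_nsets_UNIV)
  then have "l = k" using inj by (simp add: card_image)
  then show thesis using that y inj p(2) by blast
qed

text \<open>Bounding the index by \<open>n\<close> leaves finitely many nowhere dense sets for each
  level of the fusion, while a given set of branches is separated at arbitrarily high levels and so
  escapes all of them.\<close>

definition generic :: "(nat \<Rightarrow> (nat \<times> (nat \<Rightarrow> cantor)) set) \<Rightarrow> (nat \<times> (nat \<Rightarrow> cantor)) set \<Rightarrow> nat \<Rightarrow>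
    'a set \<Rightarrow> ('a \<Rightarrow> cantor set) \<Rightarrow> bool" where
  "generic N U n K V \<longleftrightarrow> (\<exists>\<epsilon>. \<forall>g. (\<forall>a\<in>K. g a \<in> V a) \<longrightarrow>
     (\<forall>p\<in>Sigma {1..} increasing_seqs. range_of_seq p = g ` K \<longrightarrow> (p \<in> U) = \<epsilon> \<and> (\<forall>m\<le>n. p \<notin> N m)))"

text \<open>The index set \<open>K\<close> is unordered, whereas points of the space are increasing
  sequences. One transversal \<open>x\<close> fixes an order on \<open>K\<close>; since stems of
  length \<open>l\<close> separate its points, every transversal of the smaller sets is ordered in
  the same way.\<close>

lemma generic_shrink:
  assumes K: "finite K" "K \<noteq> {}" "K \<subseteq> J" and V: "\<And>a. a \<in> J \<Longrightarrow> V a \<in> range cyl" "disjoint_family_on V J"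
    and N: "\<And>m. nowhere_dense_in finite_subsets_topology (N m)" and U: "openin finite_subsets_topology U"
  shows "\<exists>W. (\<forall>a\<in>J. W a \<in> range cyl \<and> W a \<subseteq> V a) \<and> generic N U n K W"
proof -
  define k where "k = card K"
  have k: "k \<ge> 1" using K by (simp add: k_def Suc_le_eq card_gt_0_iff)
  have "\<forall>a\<in>J. \<exists>t. V a = cyl t" using V(1) by blast
  then obtain T where T: "\<And>a. a \<in> J \<Longrightarrow> V a = cyl (T a)" by metis
  define x where "x a = prepend (T a) (\<lambda>_. False)" for a
  have x: "x a \<in> V a" if "a \<in> J" for a using T[OF that] prepend_in_cyl by (simp add: x_def)
  have disj: "disjoint_family_on V K" using V(2) K(3) disjoint_family_on_mono by blast
  have inj: "inj_on x K" by (rule transversal_inj[OF disj]) (use x K in blast)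
  have "x ` K \<in> [UNIV]\<^bsup>k\<^esup>" using K inj by (simp add: in_nsets_UNIV card_image k_def)
  then obtain y where y: "y \<in> increasing_seqs k" "range_of_seq (k, y) = x ` K" "inj_on y {..<k}"
    by (rule range_of_seq_surj[OF _ k])
  have yK: "y ` {..<k} = x ` K" using y(2) by (simp add: range_of_seq_def)
  \<comment> \<open>\<open>\<beta> a\<close> is the position of \<open>x a\<close> in the increasing
    enumeration \<open>y\<close>; the map \<open>\<alpha>\<close> obtained below is its
    inverse.\<close>
  define \<beta> where "\<beta> a = inv_into {..<k} y (x a)" for a
  have \<beta>: "\<beta> a < k" "y (\<beta> a) = x a" if "a \<in> K" for a
  proof -
    have "x a \<in> y ` {..<k}" using that yK by blast
    then show "\<beta> a < k" "y (\<beta> a) = x a"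
      using inv_into_into[of "x a" y "{..<k}"] f_inv_into_f[of "x a" y "{..<k}"] by (simp_all add: \<beta>_def)
  qed
  have "\<forall>i\<in>{..<k}. \<exists>a. a \<in> K \<and> \<beta> a = i"
  proof
    fix i assume i: "i \<in> {..<k}"
    then obtain a where "a \<in> K" "y i = x a" using yK by blast
    then show "\<exists>a. a \<in> K \<and> \<beta> a = i" using i inv_into_f_f[OF y(3) i] by (auto simp: \<beta>_def)
  qed
  then obtain \<alpha> where \<alpha>: "\<And>i. i < k \<Longrightarrow> \<alpha> i \<in> K" "\<And>i. i < k \<Longrightarrow> \<beta> (\<alpha> i) = i" by (metis lessThan_iff)
  have "\<exists>l0. \<forall>a\<in>K. length (T a) \<le> l0" using K(1) by (meson finite_imageI bdd_above_finite bdd_above_nat finite_nat_set_iff_bounded_le imageI)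
  then obtain l0 where l0: "\<And>a. a \<in> K \<Longrightarrow> length (T a) \<le> l0" by blast
  \<comment> \<open>The length \<open>l\<close> serves two ends: exceeding the lengths of the
    \<open>T a\<close>, it keeps the box around \<open>y\<close> inside the cylinders, and
    separating the points, it freezes their order.\<close>
  obtain l where l: "l0 \<le> l" "inj_on (stem l) (x ` K)" using finite_separated[of "x ` K" l0] K(1) by blast
  obtain z1 l1 where z1: "z1 \<in> increasing_seqs k" "l1 \<ge> l" "(k, z1) \<in> basic_box k y l"
    "\<forall>m<Suc n. basic_box k z1 l1 \<inter> N m = {}"
    using finitely_many_nowhere_dense_avoid[of k N, OF k N y(1), of l "Suc n"]
    by (elim bexE exE conjE) (rule that)
  \<comment> \<open>Either the box misses \<open>U\<close>, or a smaller box lies inside the open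
    set \<open>U\<close>; in both cases membership in \<open>U\<close> becomes constant.\<close>
  have "\<exists>z\<in>increasing_seqs k. \<exists>l'\<ge>l1. \<exists>\<epsilon>. (k, z) \<in> basic_box k z1 l1 \<and> (\<forall>p\<in>basic_box k z l'. (p \<in> U) = \<epsilon>)"
  proof (cases "basic_box k z1 l1 \<inter> U = {}")
    case True
    then show ?thesis using z1(1) basic_box_self[OF z1(1)] by (intro bexI[of _ z1] exI[of _ l1] conjI exI[of _ False]) auto
  next
    case False
    then obtain z where z: "(k, z) \<in> basic_box k z1 l1" "(k, z) \<in> U" "z \<in> increasing_seqs k" by (auto simp: basic_box_def)
    obtain m where m: "basic_box k z m \<subseteq> U" using U z(2) unfolding openin_finite_subsets_topology by blast
    have "basic_box k z (max m l1) \<subseteq> U"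
      using basic_box_mono[OF z(3) basic_box_self[OF z(3)], of m "max m l1"] m by auto
    then show ?thesis using z by (intro bexI[of _ z] exI[of _ "max m l1"] conjI exI[of _ True]) auto
  qed
  then obtain z l' \<epsilon> where z: "z \<in> increasing_seqs k" "l1 \<le> l'" "(k, z) \<in> basic_box k z1 l1"
    "\<forall>p\<in>basic_box k z l'. (p \<in> U) = \<epsilon>" by (elim bexE exE conjE) (rule that)
  have sub: "basic_box k z l' \<subseteq> basic_box k z1 l1" by (rule basic_box_mono[OF z(1,3,2)])
  have zy: "stem l (z i) = stem l (y i)" if "i < k" for i
    using basic_box_mono[OF z1(1,3,2)] z(3) that by (auto simp: basic_box_def)
  define W where "W a = (if a \<in> K then cyl (stem l' (z (\<beta> a))) else V a)" for a
  have WV: "W a \<subseteq> V a" if "a \<in> J" for a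
  proof (cases "a \<in> K")
    case True
    show ?thesis
    proof
      fix w assume "w \<in> W a"
      then have "stem l' w = stem l' (z (\<beta> a))" using True by (simp add: W_def cyl_def)
      then have "stem l w = stem l (z (\<beta> a))" by (rule stem_eq_mono) (use z1(2) z(2) in simp)
      also have "\<dots> = stem l (x a)" using zy[OF \<beta>(1)[OF True]] \<beta>(2)[OF True] by simp
      finally have "stem (length (T a)) w = stem (length (T a)) (x a)"
        by (rule stem_eq_mono) (use l0[OF True] l(1) in simp)
      then show "w \<in> V a" using x[OF that] T[OF that] by (simp add: cyl_def)
    qed
  qed (simp add: W_def)
  have "generic N U n K W"
    unfolding generic_def
  proof (intro exI[of _ \<epsilon>] allI impI ballI)
    fix g p assume g: "\<forall>a\<in>K. g a \<in> W a" and p: "p \<in> Sigma {1..} increasing_seqs" "range_of_seq p = g ` K"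
    define z' where "z' = restrict (\<lambda>i. g (\<alpha> i)) {..<k}"
    have z'z: "stem l' (z' i) = stem l' (z i)" if "i < k" for i
      using bspec[OF g \<alpha>(1)[OF that]] \<alpha>[OF that] that by (simp add: z'_def W_def cyl_def)
    have "less_fun (z' i) (z' j)" if "i < j" "j < k" for i j
    proof (rule less_fun_stem)
      show "less_fun (z i) (z j)" using z(1) that by (simp add: increasing_seqs_def)
      have "stem l (z i) \<noteq> stem l (z j)"
      proof
        assume "stem l (z i) = stem l (z j)"
        then have "stem l (y i) = stem l (y j)" using zy that by simp
        moreover have "y i \<in> x ` K" "y j \<in> x ` K" using yK that by auto
        ultimately have "y i = y j" using inj_onD[OF l(2)] by blast
        then show False using inj_onD[OF y(3), of i j] that by auto
      qed
      then show "stem l' (z i) \<noteq> stem l' (z j)"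
        using stem_eq_mono[of l' "z i" "z j" l] z1(2) z(2) by auto
    qed (use z'z that in auto)
    then have z': "z' \<in> increasing_seqs k" by (auto simp: increasing_seqs_def z'_def)
    have "\<alpha> ` {..<k} = K"
    proof (intro subset_antisym subsetI)
      fix a assume a: "a \<in> K"
      have "inj_on \<beta> K"
      proof (rule inj_onI)
        fix a b assume "a \<in> K" "b \<in> K" "\<beta> a = \<beta> b"
        then have "x a = x b" using \<beta>(2) by metis
        then show "a = b" using inj_onD[OF inj, of a b] \<open>a \<in> K\<close> \<open>b \<in> K\<close> by blast
      qed
      then have "\<alpha> (\<beta> a) = a" using \<alpha>[OF \<beta>(1)[OF a]] a by (auto dest: inj_onD)
      then show "a \<in> \<alpha> ` {..<k}" using \<beta>(1)[OF a] by force
    qed (use \<alpha>(1) in auto)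
    then have "range_of_seq (k, z') = g ` K" by (auto simp: range_of_seq_def z'_def)
    then have pz: "p = (k, z')" using z' k p by (intro range_of_seq_inj) auto
    then have pb: "p \<in> basic_box k z l'" using z' z'z by (simp add: basic_box_def)
    show "(p \<in> U) = \<epsilon> \<and> (\<forall>m\<le>n. p \<notin> N m)"
      
    proof (intro conjI allI impI)
      show "(p \<in> U) = \<epsilon>" by (rule bspec[OF z(4) pb])
      fix m assume "m \<le> n"
      then have "basic_box k z1 l1 \<inter> N m = {}" using z1(4) by simp
      then show "p \<notin> N m" using sub pb by blast
    qed
  qed
  moreover have "W a \<in> range cyl" if "a \<in> J" for a using V(1)[OF that] by (simp add: W_def)
  ultimately show ?thesis using WV by (intro exI[of _ W]) simp
qed

text \<open>Every \<open>k\<close>-set of branches is separated at arbitrarily high levels, so its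
  image avoids all \<open>N m\<close>. There \<open>\<F>\<close> coincides with the open set
  \<open>U\<close>, whose membership is read off the stems at any separating level.\<close>

lemma Baire_continuous_restriction:
  assumes baire: "has_Baire_property \<F>" and k: "k \<ge> 1"
  shows "\<exists>\<Phi>. tree_emb \<Phi> \<and> continuous_colouring k (\<lambda>G. \<Phi> ` G \<in> \<F>)"
proof -
  let ?S = "Sigma {1..} increasing_seqs"
  define A where "A = {p \<in> ?S. range_of_seq p \<in> \<F>}"
  obtain U N where U: "openin finite_subsets_topology U"
    and N: "\<And>n :: nat. nowhere_dense_in finite_subsets_topology (N n)" and AU: "(A - U) \<union> (U - A) = (\<Union>n. N n)"
    using baire unfolding has_Baire_property_def Baire_property_in_def meagre_in_def
      topspace_finite_subsets_topology A_def[symmetric] by metis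
  define Q where "Q n Y \<longleftrightarrow> (\<forall>K\<in>[{t. length t = n}]\<^bsup>k\<^esup>. generic N U n K (Y ()))"
    for n and Y :: "unit \<Rightarrow> bool list \<Rightarrow> cantor set"
  have gen_mono: "generic N U n K W" if V: "generic N U n K V" and W: "\<And>a. a \<in> K \<Longrightarrow> W a \<subseteq> V a"
    for n and K :: "bool list set" and V W
  proof -
    obtain \<epsilon> where \<epsilon>: "\<And>g p. (\<forall>a\<in>K. g a \<in> V a) \<Longrightarrow> p \<in> ?S \<Longrightarrow> range_of_seq p = g ` K \<Longrightarrow>
      (p \<in> U) = \<epsilon> \<and> (\<forall>m\<le>n. p \<notin> N m)" using V unfolding generic_def by metis
    show ?thesis
      unfolding generic_def
    proof (intro exI[of _ \<epsilon>] allI impI ballI)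
      fix g p assume g: "\<forall>a\<in>K. g a \<in> W a" and p: "p \<in> ?S" "range_of_seq p = g ` K"
      have "\<forall>a\<in>K. g a \<in> V a" using g W by blast
      then show "(p \<in> U) = \<epsilon> \<and> (\<forall>m\<le>n. p \<notin> N m)" using p by (rule \<epsilon>)
    qed
  qed
  obtain \<Psi> where \<Psi>: "\<And>i. i \<in> UNIV \<Longrightarrow> tree_emb (\<Psi> i)" "\<And>i. i \<in> UNIV \<Longrightarrow> range (\<Psi> i) \<subseteq> UNIV"
    "\<And>n. Q n (\<lambda>i t. \<Psi> i ` cyl t)"
  proof (rule fusion[OF fusion_class_cylinders, of UNIV "\<lambda>_ :: unit. UNIV" Q])
    show "Q n Z" if "Q n Y" "\<And>i t. i \<in> UNIV \<Longrightarrow> length t = n \<Longrightarrow> Z i t \<subseteq> Y i t" for n Y Z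
      unfolding Q_def
    proof
      fix K :: "bool list set" assume K: "K \<in> [{t. length t = n}]\<^bsup>k\<^esup>"
      then have "generic N U n K (Y ())" using that(1) unfolding Q_def by blast
      then show "generic N U n K (Z ())"
      proof (rule gen_mono)
        fix a assume "a \<in> K"
        then have "length a = n" using K by (auto simp: nsets_def)
        then show "Z () a \<subseteq> Y () a" using that(2) by simp
      qed
    qed
    show "\<exists>Z. Q n Z \<and> (\<forall>i\<in>UNIV. \<forall>t. length t = n \<longrightarrow> Z i t \<in> range cyl \<and> Z i t \<subseteq> Y i t)"
      if Y: "\<And>i t. i \<in> UNIV \<Longrightarrow> length t = n \<Longrightarrow> Y i t \<in> range cyl"
        "disjoint_family_on (\<lambda>(i, t). Y i t) (UNIV \<times> {t. length t = n})"
      for n and Y :: "unit \<Rightarrow> bool list \<Rightarrow> cantor set"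
    proof -
      let ?J = "{t :: bool list. length t = n}"
      have dY: "disjoint_family_on (Y ()) ?J"
        using Y(2) by (auto simp: disjoint_family_on_def)
      have "\<exists>W. (\<forall>a\<in>?J. W a \<in> range cyl \<and> W a \<subseteq> Y () a) \<and> (\<forall>K\<in>[?J]\<^bsup>k\<^esup>. generic N U n K W)"
      proof (rule shrink_finitely_often[OF finite_imp_finite_nsets[OF finite_lists_length]])
        show "generic N U n K W" if "K \<in> [?J]\<^bsup>k\<^esup>" "generic N U n K V" "\<And>a. a \<in> ?J \<Longrightarrow> W a \<subseteq> V a" for K V W
          by (rule gen_mono[OF that(2)]) (use that in \<open>auto simp: nsets_def\<close>)
      next
        show "Y () a \<in> range cyl" if "a \<in> ?J" for a using Y(1) that by simp
      next
        show "\<exists>W. (\<forall>a\<in>?J. W a \<in> range cyl \<and> W a \<subseteq> V a) \<and> generic N U n K W"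
          if "K \<in> [?J]\<^bsup>k\<^esup>" "\<And>a. a \<in> ?J \<Longrightarrow> V a \<in> range cyl" "disjoint_family_on V ?J" for K V
        proof (rule generic_shrink[OF _ _ _ that(2,3) N U])
          show "finite K" "K \<noteq> {}" "K \<subseteq> ?J" using that(1) k by (auto simp: nsets_def)
        qed
      qed (rule dY)
      then obtain W where "\<forall>a\<in>?J. W a \<in> range cyl \<and> W a \<subseteq> Y () a" "\<forall>K\<in>[?J]\<^bsup>k\<^esup>. generic N U n K W" by blast
      then show ?thesis by (intro exI[of _ "\<lambda>_. W"]) (simp add: Q_def)
    qed
    show "UNIV \<in> range cyl" using cyl_Nil by (metis rangeI)
    show "disjoint_family_on (\<lambda>_ :: unit. UNIV :: cantor set) UNIV" by (simp add: disjoint_family_on_def)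
  qed (rule that, assumption+)
  define \<Phi> where "\<Phi> = \<Psi> ()"
  have emb: "tree_emb \<Phi>" using \<Psi>(1) by (simp add: \<Phi>_def)
  have pt: "\<exists>g. \<Phi> ` G = g ` stem n ` G \<and> (\<forall>t\<in>stem n ` G. g t \<in> \<Phi> ` cyl t)"
    if inj: "inj_on (stem n) G" for n G
  proof (intro exI[of _ "\<lambda>t. \<Phi> (inv_into G (stem n) t)"] conjI ballI)
    show "\<Phi> ` G = (\<lambda>t. \<Phi> (inv_into G (stem n) t)) ` stem n ` G"
      unfolding image_image using inv_into_f_f[OF inj] by (intro image_cong) simp_all
    fix t assume t: "t \<in> stem n ` G"
    then have "stem n (inv_into G (stem n) t) = t" by (rule f_inv_into_f)
    then have "inv_into G (stem n) t \<in> cyl t" using t by (auto simp: cyl_def)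
    then show "\<Phi> (inv_into G (stem n) t) \<in> \<Phi> ` cyl t" by (rule imageI)
  qed
  have gen: "generic N U n (stem n ` G) (\<lambda>t. \<Phi> ` cyl t)" if "G \<in> [UNIV]\<^bsup>k\<^esup>" "inj_on (stem n) G" for n G
  proof -
    have "stem n ` G \<in> [{t. length t = n}]\<^bsup>k\<^esup>" using that by (auto simp: nsets_def card_image)
    then show ?thesis using \<Psi>(3)[of n] unfolding Q_def \<Phi>_def by blast
  qed
  have point: "\<exists>p\<in>?S. range_of_seq p = \<Phi> ` G" if "G \<in> [UNIV]\<^bsup>k\<^esup>" for G
  proof -
    have "\<Phi> ` G \<in> [UNIV]\<^bsup>k\<^esup>"
      using that inj_on_subset[OF tree_emb_inj[OF emb], of G] by (simp add: in_nsets_UNIV card_image)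
    then obtain y where "y \<in> increasing_seqs k" "range_of_seq (k, y) = \<Phi> ` G"
      by (rule range_of_seq_surj[OF _ k])
    then show ?thesis using k by (intro bexI[of _ "(k, y)"]) auto
  qed
  have inF: "\<Phi> ` G \<in> \<F> \<longleftrightarrow> p \<in> U" if G: "G \<in> [UNIV]\<^bsup>k\<^esup>" and p: "p \<in> ?S" "range_of_seq p = \<Phi> ` G" for G p
  proof -
    have "p \<notin> N m" for m
    proof -
      obtain n where n: "n \<ge> m" "inj_on (stem n) G" using finite_separated[of G m] G by (auto simp: in_nsets_UNIV)
      obtain g where g: "\<Phi> ` G = g ` stem n ` G" "\<forall>t\<in>stem n ` G. g t \<in> \<Phi> ` cyl t" using pt[OF n(2)] by blast
      have "range_of_seq p = g ` stem n ` G" using p(2) g(1) by simp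
      then have "\<forall>m\<le>n. p \<notin> N m" using gen[OF G n(2)] g(2) p(1) unfolding generic_def by metis
      then show ?thesis using n(1) by blast
    qed
    then have "p \<in> A \<longleftrightarrow> p \<in> U" using AU by blast
    then show ?thesis using p by (simp add: A_def)
  qed
  have "continuous_colouring k (\<lambda>G. \<Phi> ` G \<in> \<F>)"
    unfolding continuous_colouring_def
  proof
    fix G :: "cantor set" assume G: "G \<in> [UNIV]\<^bsup>k\<^esup>"
    obtain n where n: "inj_on (stem n) G" using finite_separated[of G] G by (auto simp: in_nsets_UNIV)
    have "\<Phi> ` G' \<in> \<F> \<longleftrightarrow> \<Phi> ` G \<in> \<F>" if G': "G' \<in> [UNIV]\<^bsup>k\<^esup>" "stem n ` G' = stem n ` G" for G'
    proof -
      have "card (stem n ` G') = card G'" using G G' card_image[OF n] by (simp add: in_nsets_UNIV)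
      then have n': "inj_on (stem n) G'" using G'(1) by (intro eq_card_imp_inj_on) (auto simp: in_nsets_UNIV)
      obtain p where p: "p \<in> ?S" "range_of_seq p = \<Phi> ` G" using point[OF G] by blast
      obtain p' where p': "p' \<in> ?S" "range_of_seq p' = \<Phi> ` G'" using point[OF G'(1)] by blast
      obtain g where g: "\<Phi> ` G = g ` stem n ` G" "\<forall>t\<in>stem n ` G. g t \<in> \<Phi> ` cyl t" using pt[OF n] by blast
      obtain g' where g': "\<Phi> ` G' = g' ` stem n ` G'" "\<forall>t\<in>stem n ` G'. g' t \<in> \<Phi> ` cyl t" using pt[OF n'] by blast
      obtain \<epsilon> where \<epsilon>: "\<And>g p. (\<forall>a\<in>stem n ` G. g a \<in> \<Phi> ` cyl a) \<Longrightarrow> p \<in> ?S \<Longrightarrow> range_of_seq p = g ` stem n ` G \<Longrightarrow>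
        (p \<in> U) = \<epsilon> \<and> (\<forall>m\<le>n. p \<notin> N m)" using gen[OF G n] unfolding generic_def by metis
      have "(p \<in> U) = \<epsilon>" using \<epsilon>[OF g(2) p(1)] p(2) g(1) by simp
      moreover have "(p' \<in> U) = \<epsilon>"
        using \<epsilon>[OF g'(2)[unfolded G'(2)] p'(1)] p'(2) g'(1) unfolding G'(2) by simp
      ultimately show ?thesis using inF[OF G p] inF[OF G'(1) p'] by simp
    qed
    then show "\<exists>n. inj_on (stem n) G \<and> (\<forall>G'\<in>[UNIV]\<^bsup>k\<^esup>. stem n ` G' = stem n ` G \<longrightarrow>
      (\<Phi> ` G' \<in> \<F>) = (\<Phi> ` G \<in> \<F>))" using n by (intro exI[of _ n] conjI ballI impI)
  qed
  then show ?thesis using emb by blast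
qed

section \<open>Density\<close>

text \<open>The density is a minimum, so one set of \<open>2 ^ n\<close> points suffices: the image
  of the nodes of length \<open>n\<close> prolonged by \<open>False\<close>. Heredity puts all
  subsets of size \<open>Suc j\<close> of a member into the family, so \<open>small\<close> applies
  to its preimage.\<close>

lemma family_density_le:
  assumes her: "hereditary \<F>" and \<Phi>: "tree_emb \<Phi>"
    and small: "\<And>G. finite G \<Longrightarrow> inj_on (stem n) G \<Longrightarrow> (\<forall>K\<in>[G]\<^bsup>Suc j\<^esup>. \<Phi> ` K \<in> \<F>) \<Longrightarrow> card G \<le> b"
  shows "family_density \<F> (2 ^ n) \<le> b"
proof -
  define T where "T = {t :: bool list. length t = n}"
  define E where "E = (\<lambda>t. prepend t (\<lambda>_. False)) ` T"
  have T: "finite T" "card T = 2 ^ n"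
    using finite_lists_length card_lists_length_eq[of "UNIV :: bool set" n] by (simp_all add: T_def)
  have st: "stem n (prepend t (\<lambda>_. False)) = t" if "t \<in> T" for t
    using stem_prepend[of t "\<lambda>_. False"] that by (simp add: T_def)
  have inj: "inj_on (stem n) E" unfolding E_def using st by (intro inj_onI) auto
  have "inj_on (\<lambda>t. prepend t (\<lambda>_. False)) T" using st by (intro inj_onI) metis
  then have E: "finite E" "card E = 2 ^ n" using T by (simp_all add: E_def card_image)
  have inj\<Phi>: "inj_on \<Phi> A" for A using tree_emb_inj[OF \<Phi>] by (rule inj_on_subset) simp
  have F: "\<Phi> ` E \<in> [UNIV]\<^bsup>(2 ^ n)\<^esup>" using E by (simp add: in_nsets_UNIV card_image[OF inj\<Phi>])
  have "max_member_card \<F> (\<Phi> ` E) \<le> b"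
    unfolding max_member_card_def
  proof (rule Max.boundedI)
    show "finite (insert 0 {card G |G. G \<subseteq> \<Phi> ` E \<and> G \<in> \<F>})"
      by (rule finite_max_member_card) (use E in simp)
    fix m assume "m \<in> insert 0 {card G |G. G \<subseteq> \<Phi> ` E \<and> G \<in> \<F>}"
    then consider "m = 0" | G where "m = card G" "G \<subseteq> \<Phi> ` E" "G \<in> \<F>" by blast
    then show "m \<le> b"
    proof cases
      case 2
      obtain H where H: "H \<subseteq> E" "G = \<Phi> ` H" using 2(2) by (meson subset_imageE)
      have "card H \<le> b"
      proof (rule small)
        show "finite H" "inj_on (stem n) H" using H(1) E(1) inj by (auto intro: finite_subset inj_on_subset)
        show "\<forall>K\<in>[H]\<^bsup>Suc j\<^esup>. \<Phi> ` K \<in> \<F>"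
        proof
          fix K assume "K \<in> [H]\<^bsup>Suc j\<^esup>"
          then have "\<Phi> ` K \<subseteq> G" "\<Phi> ` K \<noteq> {}" unfolding H(2) by (auto simp: nsets_def)
          then show "\<Phi> ` K \<in> \<F>" using her 2(3) unfolding hereditary_def by blast
        qed
      qed
      then show ?thesis using 2(1) H(2) by (simp add: card_image[OF inj\<Phi>])
    qed simp
  qed simp
  moreover have "family_density \<F> (2 ^ n) \<le> max_member_card \<F> (\<Phi> ` E)"
    unfolding family_density_def using F by (intro Min_le finite_family_density) blast
  ultimately show ?thesis by simp
qed

theorem theoremB:
  fixes \<F> :: "cantor set set"
  assumes "\<F> \<subseteq> finite_subsets"
    and "hereditary \<F>"
    and "has_Baire_property \<F>"
    and "limsup (\<lambda>n. ereal (log 2 (real (family_density \<F> (2 ^ n))) / log 2 (real n))) = \<infinity>"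
  shows "\<forall>k\<ge>1. \<exists>P :: cantor set. perfect P \<and> [P]\<^bsup>k\<^esup> \<subseteq> \<F>"
proof (intro allI impI)
  fix k :: nat assume k: "k \<ge> 1"
  then obtain j where j: "k = Suc j" by (metis Suc_le_D One_nat_def)
  obtain \<Phi> where \<Phi>: "tree_emb \<Phi>" "continuous_colouring (Suc j) (\<lambda>G. \<Phi> ` G \<in> \<F>)"
    using Baire_continuous_restriction[OF assms(3) k] unfolding j by blast
  obtain \<Psi> where \<Psi>: "tree_emb \<Psi>" and alt: "(\<forall>G\<in>[UNIV]\<^bsup>Suc j\<^esup>. \<Phi> ` \<Psi> ` G \<in> \<F>) \<or>
    (\<forall>n G. finite G \<longrightarrow> inj_on (stem n) G \<longrightarrow> (\<forall>K\<in>[G]\<^bsup>Suc j\<^esup>. \<Phi> ` \<Psi> ` K \<in> \<F>) \<longrightarrow> card G \<le> subtree_bound j n)"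
    using homogeneous_or_small[OF \<Phi>(2)] by (elim exE conjE) (rule that)
  define \<Theta> where "\<Theta> x = \<Phi> (\<Psi> x)" for x
  have \<Theta>: "tree_emb \<Theta>" unfolding \<Theta>_def by (rule tree_emb_comp[OF \<Phi>(1) \<Psi>])
  have im: "\<Phi> ` \<Psi> ` G = \<Theta> ` G" for G by (simp add: \<Theta>_def image_image)
  from alt show "\<exists>P. perfect P \<and> [P]\<^bsup>k\<^esup> \<subseteq> \<F>"
  proof
    assume all: "\<forall>G\<in>[UNIV]\<^bsup>Suc j\<^esup>. \<Phi> ` \<Psi> ` G \<in> \<F>"
    have "[range \<Theta>]\<^bsup>k\<^esup> \<subseteq> \<F>"
    proof
      fix G assume "G \<in> [range \<Theta>]\<^bsup>k\<^esup>"
      then have G: "G \<subseteq> range \<Theta>" "finite G" "card G = k" by (auto simp: nsets_def)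
      obtain H where H: "G = \<Theta> ` H" using G(1) by (meson subset_imageE)
      have inj: "inj_on \<Theta> H" using tree_emb_inj[OF \<Theta>] by (rule inj_on_subset) simp
      have "H \<in> [UNIV]\<^bsup>Suc j\<^esup>"
        using G(2,3) finite_imageD[OF _ inj] card_image[OF inj] unfolding H j by (simp add: in_nsets_UNIV)
      then show "G \<in> \<F>" using all unfolding im H by blast
    qed
    then show ?thesis using perfect_if_tree_perfect[OF tree_perfect_range[OF \<Theta>]] by blast
  next
    assume small: "\<forall>n G. finite G \<longrightarrow> inj_on (stem n) G \<longrightarrow> (\<forall>K\<in>[G]\<^bsup>Suc j\<^esup>. \<Phi> ` \<Psi> ` K \<in> \<F>) \<longrightarrow> card G \<le> subtree_bound j n"
    have d: "family_density \<F> (2 ^ n) \<le> (n + 1) ^ j" for n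
      using family_density_le[OF assms(2) \<Theta>, of n j "subtree_bound j n"] small subtree_bound_le[of j n]
      unfolding im by (meson order_trans)
    have "log 2 (real (family_density \<F> (2 ^ n))) / log 2 (real n) \<le> 2 * real j" if n: "n \<ge> 2" for n
    proof -
      have pos: "log 2 (real n) > 0" using n by simp
      have "log 2 (real (family_density \<F> (2 ^ n))) \<le> 2 * real j * log 2 (real n)"
      \<comment> \<open>The factor 2 comes from \<open>n + 1 \<le> n ^ 2\<close> for
        \<open>n \<ge> 2\<close>, which turns \<open>(n + 1) ^ j\<close> into
        \<open>n ^ (2 * j)\<close>. For density 0 the logarithm has the default value 0, below the
        nonnegative bound.\<close>
      proof (cases "family_density \<F> (2 ^ n) = 0")
        case False
        have "n + 1 \<le> 2 * n" using n by linarith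
        also have "\<dots> \<le> n * n" using n by (rule mult_le_mono1)
        finally have "n + 1 \<le> n ^ 2" by (simp only: power2_eq_square)
        then have "(n + 1) ^ j \<le> (n ^ 2) ^ j" by (rule power_mono) simp
        then have "family_density \<F> (2 ^ n) \<le> (n ^ 2) ^ j"
          using d[of n] by linarith
        then have "family_density \<F> (2 ^ n) \<le> n ^ (2 * j)" by (simp only: power_mult)
        then have "real (family_density \<F> (2 ^ n)) \<le> real n ^ (2 * j)" by (metis of_nat_le_iff of_nat_power)
        then have "log 2 (real (family_density \<F> (2 ^ n))) \<le> log 2 (real n ^ (2 * j))"
          using False n by (subst log_le_cancel_iff) auto
        also have "\<dots> = 2 * real j * log 2 (real n)" using n by (simp add: log_nat_power)
        finally show ?thesis .
      qed (use pos in \<open>simp add: log_def[of 2 0]\<close>)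
      then show ?thesis using pos by (simp add: divide_le_eq)
    qed
    then have "\<forall>\<^sub>F n in sequentially. ereal (log 2 (real (family_density \<F> (2 ^ n))) / log 2 (real n)) \<le> ereal (2 * real j)"
      by (auto simp: eventually_sequentially)
    then have "limsup (\<lambda>n. ereal (log 2 (real (family_density \<F> (2 ^ n))) / log 2 (real n))) \<le> ereal (2 * real j)"
      by (rule Limsup_bounded)
    then show ?thesis using assms(4) by simp
  qed
qed

end
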